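(* Let $k$ be a field, let $n\geq 2$ and $1\leq i<n$ be integers, let $R=k[[X_1,\dots,X_n]]$ be the formal power series algebra over $k$ in $n$ variables, and let $I=(X_1,\dots,X_i)R$. Let $Q(R)$ denote the quotient field of $R$. Then $$\dim_{Q(R)}\bigl(D(H^i_I(R))\otimes_R Q(R)\bigr)=\infty .$$
   Context: For a noetherian local ring $(R,\mathfrak m)$ and an ideal $I$ of $R$, $H^i_I(M)$ denotes the $i$-th local cohomology module of an $R$-module $M$ supported in $I$. $E_R(R/\mathfrak m)$ denotes a fixed $R$-injective hull of the residue field $R/\mathfrak m$, and $D$ is the Matlis dual functor $D(M)=\operatorname{Hom}_R(M,E_R(R/\mathfrak m))$ on the category of all $R$-modules. *)

theory Defs
  imports
    "HOL-Algebra.Ideal_Product"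
    "HOL-Algebra.Free_Abelian_Groups"
    "Jordan_Normal_Form.Missing_VectorSpace"
begin

hide_const (open) Wellorder_Constructions.zero

section \<open>Formal power series in \<open>n\<close> variables\<close>

text \<open>
  A monomial is encoded as the multiset in which \<open>j\<close> occurs as often as the exponent of \<open>X\<^sub>j\<close>
  says; a power series is its coefficient function.
\<close>

definition mps_ring :: "nat \<Rightarrow> (nat multiset \<Rightarrow> 'k::field) ring" where
  "mps_ring n =
     \<lparr>carrier = {f. \<forall>m. \<not> set_mset m \<subseteq> {1..n} \<longrightarrow> f m = 0},
      mult = (\<lambda>f g m. \<Sum>a | a \<subseteq># m. f a * g (m - a)),
      one = (\<lambda>m. if m = {#} then 1 else 0),
      zero = (\<lambda>m. 0),
      add = (\<lambda>f g m. f m + g m)\<rparr>"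

definition mps_var :: "nat \<Rightarrow> (nat multiset \<Rightarrow> 'k::field)" where
  "mps_var j = (\<lambda>m. if m = {#j#} then 1 else 0)"


section \<open>Modules\<close>

text \<open>
  Modules are records extending ring records; the fields \<open>mult\<close> and \<open>one\<close> play no role for a
  module and are left undefined below.
\<close>

definition regular_module :: "('r, 'z) ring_scheme \<Rightarrow> ('r, 'r) module" where
  "regular_module R =
     \<lparr>carrier = carrier R, mult = undefined, one = undefined,
      zero = \<zero>\<^bsub>R\<^esub>, add = (\<oplus>\<^bsub>R\<^esub>), smult = (\<otimes>\<^bsub>R\<^esub>)\<rparr>"

definition quot_module :: "('r, 'z) ring_scheme \<Rightarrow> ('r, 'm) module \<Rightarrow> 'm set \<Rightarrow> ('r, 'm set) module" where
  "quot_module R M N =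
     \<lparr>carrier = a_rcosets\<^bsub>M\<^esub> N, mult = undefined, one = undefined,
      zero = N, add = set_add M,
      smult = (\<lambda>r C. \<Union>x\<in>C. N +>\<^bsub>M\<^esub> (r \<odot>\<^bsub>M\<^esub> x))\<rparr>"

text \<open>Homomorphisms are made extensional so that distinct elements are distinct maps on the carrier.\<close>

definition Hom_module :: "('r, 'z) ring_scheme \<Rightarrow> ('r, 'm) module \<Rightarrow> ('r, 'n) module
    \<Rightarrow> ('r, 'm \<Rightarrow> 'n) module" where
  "Hom_module R M N =
     \<lparr>carrier = module_hom R M N \<inter> extensional (carrier M),
      mult = undefined, one = undefined,
      zero = (\<lambda>x\<in>carrier M. \<zero>\<^bsub>N\<^esub>),
      add = (\<lambda>f g. \<lambda>x\<in>carrier M. f x \<oplus>\<^bsub>N\<^esub> g x),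
      smult = (\<lambda>r f. \<lambda>x\<in>carrier M. r \<odot>\<^bsub>N\<^esub> f x)\<rparr>"


section \<open>Injective modules, injective hulls and injective resolutions\<close>

text \<open>
  HOL cannot quantify over modules of all types, so the test modules \<open>A\<close> and \<open>B\<close> have their
  carriers in the type of the ring elements. All ideals of \<open>R\<close> (as submodules of \<open>R\<close>) are among
  them, so by Baer's criterion this is injectivity in the category of all \<open>R\<close>-modules.
\<close>

definition injective_module :: "('r, 'z) ring_scheme \<Rightarrow> ('r, 'e) module \<Rightarrow> bool" where
  "injective_module R E \<longleftrightarrow> module R E \<and>
     (\<forall>(A :: ('r, 'r) module) (B :: ('r, 'r) module) f g.
        module R A \<and> module R B \<and> f \<in> module_hom R A B \<and> inj_on f (carrier A) \<and> g \<in> module_hom R A E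
        \<longrightarrow> (\<exists>h\<in>module_hom R B E. \<forall>x\<in>carrier A. h (f x) = g x))"

text \<open>An injective hull of \<open>M\<close> is an injective module that is an essential extension of \<open>M\<close> via \<open>\<iota>\<close>.\<close>

definition injective_hull :: "('r, 'z) ring_scheme \<Rightarrow> ('r, 'm) module \<Rightarrow> ('r, 'e) module
    \<Rightarrow> ('m \<Rightarrow> 'e) \<Rightarrow> bool" where
  "injective_hull R M E \<iota> \<longleftrightarrow>
     injective_module R E \<and> \<iota> \<in> module_hom R M E \<and> inj_on \<iota> (carrier M) \<and>
     (\<forall>U. submodule R U E \<and> U \<noteq> {\<zero>\<^bsub>E\<^esub>} \<longrightarrow> U \<inter> \<iota> ` carrier M \<noteq> {\<zero>\<^bsub>E\<^esub>})"

definition mod_kernel :: "('r, 'm) module \<Rightarrow> ('r, 'n) module \<Rightarrow> ('m \<Rightarrow> 'n) \<Rightarrow> 'm set" where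
  "mod_kernel M N f = {x \<in> carrier M. f x = \<zero>\<^bsub>N\<^esub>}"

text \<open>The sequence \<open>0 \<rightarrow> M \<rightarrow> E 0 \<rightarrow> E 1 \<rightarrow> \<dots>\<close> with maps \<open>\<epsilon>, d 0, d 1, \<dots>\<close> is exact.\<close>

definition injective_resolution :: "('r, 'z) ring_scheme \<Rightarrow> ('r, 'm) module
    \<Rightarrow> (nat \<Rightarrow> ('r, 'e) module) \<Rightarrow> (nat \<Rightarrow> 'e \<Rightarrow> 'e) \<Rightarrow> ('m \<Rightarrow> 'e) \<Rightarrow> bool" where
  "injective_resolution R M E d \<epsilon> \<longleftrightarrow>
     (\<forall>j. injective_module R (E j)) \<and>
     (\<forall>j. d j \<in> module_hom R (E j) (E (Suc j))) \<and>
     \<epsilon> \<in> module_hom R M (E 0) \<and> inj_on \<epsilon> (carrier M) \<and>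
     \<epsilon> ` carrier M = mod_kernel (E 0) (E 1) (d 0) \<and>
     (\<forall>j. d j ` carrier (E j) = mod_kernel (E (Suc j)) (E (Suc (Suc j))) (d (Suc j)))"


section \<open>Local cohomology and Matlis duality\<close>

definition torsion_module :: "('r, 'z) ring_scheme \<Rightarrow> 'r set \<Rightarrow> ('r, 'm) module \<Rightarrow> ('r, 'm) module" where
  "torsion_module R I M =
     M\<lparr>carrier := {x \<in> carrier M. \<exists>t::nat. \<forall>a \<in> I [^]\<^bsub>ideals_set R\<^esub> t. a \<odot>\<^bsub>M\<^esub> x = \<zero>\<^bsub>M\<^esub>}\<rparr>"

fun torsion_coboundaries :: "('r, 'z) ring_scheme \<Rightarrow> 'r set \<Rightarrow> (nat \<Rightarrow> ('r, 'e) module)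
    \<Rightarrow> (nat \<Rightarrow> 'e \<Rightarrow> 'e) \<Rightarrow> nat \<Rightarrow> 'e set" where
  "torsion_coboundaries R I E d 0 = {\<zero>\<^bsub>E 0\<^esub>}"
| "torsion_coboundaries R I E d (Suc j) = d j ` carrier (torsion_module R I (E j))"

text \<open>
  The right derived functors of the \<open>I\<close>-torsion functor: if \<open>(E, d)\<close> is an injective resolution of
  \<open>M\<close>, this is the \<open>j\<close>-th cohomology of the complex of \<open>I\<close>-torsion submodules, that is, the
  \<open>j\<close>-th local cohomology module of \<open>M\<close> supported in \<open>I\<close>.
\<close>

definition local_cohomology :: "('r, 'z) ring_scheme \<Rightarrow> 'r set \<Rightarrow> (nat \<Rightarrow> ('r, 'e) module)
    \<Rightarrow> (nat \<Rightarrow> 'e \<Rightarrow> 'e) \<Rightarrow> nat \<Rightarrow> ('r, 'e set) module" where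
  "local_cohomology R I E d j =
     quot_module R
       ((E j)\<lparr>carrier := mod_kernel (torsion_module R I (E j)) (torsion_module R I (E (Suc j))) (d j)\<rparr>)
       (torsion_coboundaries R I E d j)"

text \<open>\<open>E\<close> is to be an injective hull of the residue field of the local ring \<open>R\<close>.\<close>

definition matlis_dual :: "('r, 'z) ring_scheme \<Rightarrow> ('r, 'e) module \<Rightarrow> ('r, 'm) module
    \<Rightarrow> ('r, 'm \<Rightarrow> 'e) module" where
  "matlis_dual R E M = Hom_module R M E"


section \<open>Quotient fields and extension of scalars\<close>

definition quotient_field :: "('r, 'z) ring_scheme \<Rightarrow> ('q, 'y) ring_scheme \<Rightarrow> ('r \<Rightarrow> 'q) \<Rightarrow> bool" where
  "quotient_field R Q \<phi> \<longleftrightarrow>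
     field Q \<and> \<phi> \<in> ring_hom R Q \<and> inj_on \<phi> (carrier R) \<and>
     (\<forall>q\<in>carrier Q. \<exists>a\<in>carrier R. \<exists>b\<in>carrier R - {\<zero>\<^bsub>R\<^esub>}. q = \<phi> a \<otimes>\<^bsub>Q\<^esub> inv\<^bsub>Q\<^esub> (\<phi> b))"

definition restrict_scalars :: "('r \<Rightarrow> 'q) \<Rightarrow> ('q, 'y) ring_scheme \<Rightarrow> ('r, 'q) module" where
  "restrict_scalars \<phi> Q =
     \<lparr>carrier = carrier Q, mult = undefined, one = undefined,
      zero = \<zero>\<^bsub>Q\<^esub>, add = (\<oplus>\<^bsub>Q\<^esub>), smult = (\<lambda>r q. \<phi> r \<otimes>\<^bsub>Q\<^esub> q)\<rparr>"

text \<open>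
  The tensor product \<open>M \<otimes> N\<close> over \<open>R\<close> is the free abelian group on \<open>M \<times> N\<close> (whose group operation
  is addition of finitely supported integer-valued functions) modulo the subgroup generated by the
  bilinearity relations.
\<close>

definition tensor_relators :: "('r, 'z) ring_scheme \<Rightarrow> ('r, 'm) module \<Rightarrow> ('r, 'n) module
    \<Rightarrow> ('m \<times> 'n \<Rightarrow>\<^sub>0 int) set" where
  "tensor_relators R M N =
     {frag_of (x \<oplus>\<^bsub>M\<^esub> x', y) - frag_of (x, y) - frag_of (x', y) | x x' y.
        x \<in> carrier M \<and> x' \<in> carrier M \<and> y \<in> carrier N} \<union>
     {frag_of (x, y \<oplus>\<^bsub>N\<^esub> y') - frag_of (x, y) - frag_of (x, y') | x y y'.
        x \<in> carrier M \<and> y \<in> carrier N \<and> y' \<in> carrier N} \<union>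
     {frag_of (r \<odot>\<^bsub>M\<^esub> x, y) - frag_of (x, r \<odot>\<^bsub>N\<^esub> y) | r x y.
        r \<in> carrier R \<and> x \<in> carrier M \<and> y \<in> carrier N}"

definition tensor_kernel :: "('r, 'z) ring_scheme \<Rightarrow> ('r, 'm) module \<Rightarrow> ('r, 'n) module
    \<Rightarrow> ('m \<times> 'n \<Rightarrow>\<^sub>0 int) set" where
  "tensor_kernel R M N =
     generate (free_Abelian_group (carrier M \<times> carrier N)) (tensor_relators R M N)"

definition tensor_group :: "('r, 'z) ring_scheme \<Rightarrow> ('r, 'm) module \<Rightarrow> ('r, 'n) module
    \<Rightarrow> ('m \<times> 'n \<Rightarrow>\<^sub>0 int) set monoid" where
  "tensor_group R M N =
     free_Abelian_group (carrier M \<times> carrier N) Mod tensor_kernel R M N"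

text \<open>
  \<open>M \<otimes> Q\<close> over \<open>R\<close>, with \<open>Q\<close> an \<open>R\<close>-algebra via \<open>\<phi>\<close>, is a \<open>Q\<close>-module by letting \<open>q\<close> act through
  \<open>x \<otimes> p \<mapsto> x \<otimes> q p\<close>.
\<close>

definition extend_scalars :: "('r, 'z) ring_scheme \<Rightarrow> ('q, 'y) ring_scheme \<Rightarrow> ('r \<Rightarrow> 'q)
    \<Rightarrow> ('r, 'm) module \<Rightarrow> ('q, ('m \<times> 'q \<Rightarrow>\<^sub>0 int) set) module" where
  "extend_scalars R Q \<phi> M =
     (let N = restrict_scalars \<phi> Q; T = tensor_group R M N in
      \<lparr>carrier = carrier T, mult = undefined, one = undefined,
       zero = \<one>\<^bsub>T\<^esub>, add = (\<otimes>\<^bsub>T\<^esub>),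
       smult = (\<lambda>q C. \<Union>c\<in>C. tensor_kernel R M N
                  #>\<^bsub>free_Abelian_group (carrier M \<times> carrier N)\<^esub>
                  frag_extend (\<lambda>(x, p). frag_of (x, q \<otimes>\<^bsub>Q\<^esub> p)) c)\<rparr>)"

end

theory Submission
  imports Defs
begin

text \<open>
  Write \<open>X\<close> for the product \<open>X\<^sub>1 \<cdots> X\<^sub>i\<close> and \<open>Y\<close> for the product \<open>X\<^bsub>i+1\<^esub> \<cdots> X\<^sub>n\<close> of the other variables.
  The local cohomology module \<open>H\<close> is the direct limit of the rings \<open>R / (X\<^sub>1\<^sup>s, \<dots>, X\<^sub>i\<^sup>s)\<close> along
  multiplication by \<open>X\<close>; its generators \<open>h s\<close> behave like the fractions \<open>1 / X\<^sup>s\<close>. So a homomorphism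
  from \<open>H\<close> to \<open>E\<close> is the same as a sequence of elements \<open>e s\<close> of \<open>E\<close> with \<open>X e (s + 1) = e s\<close> and with
  \<open>e s\<close> killed by \<open>X\<^sub>1\<^sup>s, \<dots>, X\<^sub>i\<^sup>s\<close>. Since \<open>E\<close> contains the inverse polynomials of Macaulay, every
  formal sum of terms \<open>X\<^sup>t Y\<^sup>-\<^sup>c\<^sup>(\<^sup>t\<^sup>)\<close> over all \<open>t\<close> yields such a sequence through its truncations.
  For exponents \<open>c\<close> that grow fast enough, and at different speeds for different \<open>l\<close>, the
  homomorphisms \<open>\<delta> l\<close> obtained in this way are linearly independent over \<open>R\<close>: in a relation between
  them one coefficient of a single summand survives (\<open>nodes_independent\<close>). Independence over \<open>R\<close>
  passes to independence over the field of fractions (\<open>infinite_rank\<close>), because a relation in the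
  tensor product holds in the module itself after denominators have been cleared (\<open>ev_K\<close>).

  The description of \<open>H\<close> has to be found inside an arbitrary injective resolution
  (\<open>fraction_system_exists\<close>, \<open>local_cohomology_fractions\<close>). Variables are added one at a time. Given
  the elements \<open>h s\<close> for \<open>p\<close> variables in the cocycles of degree \<open>p\<close>, injectivity provides compatible
  elements \<open>w s\<close> of the resolution with \<open>X\<^bsub>p+1\<^esub>\<^sup>s w s = h s\<close>, and the differentials of the \<open>w s\<close> are the
  elements for \<open>p + 1\<close> variables. That they generate the cohomology, with the right
  annihilators, follows from the case of \<open>p\<close> variables, from the vanishing of local cohomology above
  degree \<open>p\<close> (\<open>torsion_cocycles_vanish\<close>), and from the divisibility of torsion submodules of injective
  modules by the next variable (\<open>torsion_divisible\<close>). All instances of injectivity are solutions of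
  consistent linear equations (\<open>injective_module_solves_relation\<close>), and consistency is read off from
  coefficients of power series.
\<close>

section \<open>The power series ring\<close>

lemma finite_submultisets: "finite {a. a \<subseteq># m}"
proof (rule finite_subset)
  show "{a. a \<subseteq># m} \<subseteq> mset ` {xs. set xs \<subseteq> set_mset m \<and> length xs \<le> size m}"
  proof
    fix a assume "a \<in> {a. a \<subseteq># m}"
    moreover obtain xs where "mset xs = a" using ex_mset by blast
    ultimately show "a \<in> mset ` {xs. set xs \<subseteq> set_mset m \<and> length xs \<le> size m}"
      by (force dest: set_mset_mono size_mset_mono intro!: image_eqI[of _ _ xs])
  qed
  show "finite (mset ` {xs. set xs \<subseteq> set_mset m \<and> length xs \<le> size m})"
    by (intro finite_imageI finite_lists_length_le) simp
qed

lemma sum_submultisets_commute: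
  "(\<Sum>a | a \<subseteq># m. f a (m - a)) = (\<Sum>a | a \<subseteq># m. f (m - a) a)"
  by (rule sum.reindex_bij_witness[of _ "\<lambda>a. m - a" "\<lambda>a. m - a"])
     (auto simp: subset_mset.diff_diff_right)

lemma sum_submultisets_assoc:
  "(\<Sum>a | a \<subseteq># m. \<Sum>b | b \<subseteq># a. f b (a - b) (m - a))
     = (\<Sum>b | b \<subseteq># m. \<Sum>c | c \<subseteq># m - b. f b c (m - b - c))"
proof -
  have "(\<Sum>a | a \<subseteq># m. \<Sum>b | b \<subseteq># a. f b (a - b) (m - a))
      = (\<Sum>(a, b) \<in> Sigma {a. a \<subseteq># m} (\<lambda>a. {b. b \<subseteq># a}). f b (a - b) (m - a))"
    by (rule sum.Sigma) (auto simp: finite_submultisets)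
  also have "\<dots> = (\<Sum>(b, c) \<in> Sigma {b. b \<subseteq># m} (\<lambda>b. {c. c \<subseteq># m - b}). f b c (m - b - c))"
  proof (rule sum.reindex_bij_witness[of _ "\<lambda>(b, c). (b + c, b)" "\<lambda>(a, b). (b, a - b)"], goal_cases)
    case (1 ab)
    then show ?case by (auto simp: subset_mset.add_diff_inverse)
  next
    case (2 ab)
    then show ?case by (auto simp: subseteq_mset_def diff_le_mono intro: le_trans)
  next
    case (3 bc)
    then show ?case by auto
  next
    case (4 bc)
    have "b + c \<subseteq># m" if "b \<subseteq># m" "c \<subseteq># m - b" for b c
      using that by (simp add: subset_mset.le_diff_conv2 add.commute)
    with 4 show ?case by auto
  next
    case (5 ab)
    have "m - b - (a - b) = m - a" if "b \<subseteq># a" for a b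
      using that by (metis diff_diff_add_mset subset_mset.add_diff_inverse)
    with 5 show ?case by auto
  qed
  also have "\<dots> = (\<Sum>b | b \<subseteq># m. \<Sum>c | c \<subseteq># m - b. f b c (m - b - c))"
    by (rule sum.Sigma[symmetric]) (auto simp: finite_submultisets)
  finally show ?thesis .
qed

lemma sum_submultisets_single:
  assumes "A \<subseteq># m" and "\<And>a. a \<subseteq># m \<Longrightarrow> a \<noteq> A \<Longrightarrow> f a = 0"
  shows "(\<Sum>a | a \<subseteq># m. f a) = (f A :: 'k::comm_monoid_add)"
proof -
  have "(\<Sum>a | a \<subseteq># m. f a) = (\<Sum>a\<in>{A}. f a)"
    by (rule sum.mono_neutral_right) (use assms finite_submultisets in auto)
  then show ?thesis by simp
qed

definition monomial :: "nat multiset \<Rightarrow> (nat multiset \<Rightarrow> 'k::field)" where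
  "monomial A = (\<lambda>m. if m = A then 1 else 0)"

lemma mps_var_eq_monomial: "mps_var j = monomial {#j#}"
  by (simp add: mps_var_def monomial_def)

locale power_series =
  fixes n :: nat and R :: "(nat multiset \<Rightarrow> 'k::field) ring" (structure)
  assumes R_def: "R = mps_ring n"
begin

lemma carrier_iff: "f \<in> carrier R \<longleftrightarrow> (\<forall>m. \<not> set_mset m \<subseteq> {1..n} \<longrightarrow> f m = 0)"
  by (simp add: R_def mps_ring_def)

lemma coeff_mult: "(f \<otimes> g) m = (\<Sum>a | a \<subseteq># m. f a * g (m - a))"
  by (simp add: R_def mps_ring_def)

lemma coeff_add: "(f \<oplus> g) m = f m + g m"
  by (simp add: R_def mps_ring_def)

lemma coeff_zero: "\<zero> m = 0"
  by (simp add: R_def mps_ring_def)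

lemma one_eq_monomial: "\<one> = monomial {#}"
  by (simp add: R_def mps_ring_def monomial_def)

lemma coeff_eqI: "(\<And>m. f m = g m) \<Longrightarrow> f = g"
  by auto

lemma cring_R: "cring R"
proof (rule cringI)
  have mult_closed: "f \<otimes> g \<in> carrier R" if "f \<in> carrier R" "g \<in> carrier R" for f g
    unfolding carrier_iff
  proof (intro allI impI)
    fix m :: "nat multiset" assume m: "\<not> set_mset m \<subseteq> {1..n}"
    have "f a * g (m - a) = 0" if a: "a \<subseteq># m" for a
    proof -
      have "set_mset m = set_mset a \<union> set_mset (m - a)"
        using a by (metis set_mset_union subset_mset.add_diff_inverse)
      then have "\<not> set_mset a \<subseteq> {1..n} \<or> \<not> set_mset (m - a) \<subseteq> {1..n}" using m by blast
      then show ?thesis using \<open>f \<in> carrier R\<close> \<open>g \<in> carrier R\<close> by (auto simp: carrier_iff)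
    qed
    then show "(f \<otimes> g) m = 0" unfolding coeff_mult by (intro sum.neutral) blast
  qed
  show "abelian_group R"
  proof (rule abelian_groupI)
    fix f assume f: "f \<in> carrier R"
    show "\<exists>g\<in>carrier R. g \<oplus> f = \<zero>"
      by (rule bexI[of _ "\<lambda>m. - f m"]) (use f in \<open>auto simp: carrier_iff coeff_add coeff_zero intro!: coeff_eqI\<close>)
  qed (auto simp: carrier_iff coeff_add coeff_zero add.assoc add.commute intro!: coeff_eqI)
  show "Group.comm_monoid R"
  proof (rule comm_monoidI)
    fix f g h
    show "f \<otimes> g \<otimes> h = f \<otimes> (g \<otimes> h)"
    proof (rule coeff_eqI)
      fix m
      have "(f \<otimes> g \<otimes> h) m = (\<Sum>a | a \<subseteq># m. \<Sum>b | b \<subseteq># a. f b * g (a - b) * h (m - a))"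
        by (simp add: coeff_mult sum_distrib_right)
      also have "\<dots> = (\<Sum>b | b \<subseteq># m. \<Sum>c | c \<subseteq># m - b. f b * g c * h (m - b - c))"
        by (rule sum_submultisets_assoc)
      finally show "(f \<otimes> g \<otimes> h) m = (f \<otimes> (g \<otimes> h)) m"
        by (simp add: coeff_mult sum_distrib_left mult.assoc)
    qed
    show "f \<otimes> g = g \<otimes> f"
      by (rule coeff_eqI)
         (simp add: coeff_mult sum_submultisets_commute[of "\<lambda>a b. f a * g b"] mult.commute)
    show "\<one> \<otimes> f = f"
      by (rule coeff_eqI)
         (simp add: coeff_mult one_eq_monomial monomial_def, subst sum_submultisets_single[of "{#}"], auto)
  qed (auto simp: mult_closed, simp add: carrier_iff one_eq_monomial monomial_def)
  fix f g h
  show "(f \<oplus> g) \<otimes> h = f \<otimes> h \<oplus> g \<otimes> h"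
    by (rule coeff_eqI) (simp add: coeff_mult coeff_add algebra_simps sum.distrib)
qed

end

sublocale power_series \<subseteq> cring R
  by (rule cring_R)

context power_series
begin

lemma coeff_minus:
  assumes "f \<in> carrier R"
  shows "(\<ominus> f) m = - f m"
proof -
  have "(\<ominus> f \<oplus> f) m = 0" using assms by (simp only: l_neg coeff_zero)
  then show ?thesis by (simp only: coeff_add eq_neg_iff_add_eq_0)
qed

lemma monomial_closed [simp, intro]: "set_mset A \<subseteq> {1..n} \<Longrightarrow> monomial A \<in> carrier R"
  by (auto simp: carrier_iff monomial_def)

lemma coeff_monomial_mult: "(monomial A \<otimes> f) m = (if A \<subseteq># m then f (m - A) else 0)"
proof (cases "A \<subseteq># m")
  case True
  have "(monomial A \<otimes> f) m = monomial A A * f (m - A)"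
    unfolding coeff_mult by (rule sum_submultisets_single[OF True]) (auto simp: monomial_def)
  then show ?thesis using True by (simp add: monomial_def)
next
  case False
  have "(monomial A \<otimes> f) m = 0"
    unfolding coeff_mult by (rule sum.neutral) (use False in \<open>auto simp: monomial_def\<close>)
  then show ?thesis using False by simp
qed

lemma monomial_mult: "monomial A \<otimes> monomial B = monomial (A + B)"
proof (rule coeff_eqI)
  fix m
  have "m - A = B \<longleftrightarrow> m = A + B" if "A \<subseteq># m"
    using that by (auto simp: subset_mset.add_diff_inverse)
  then show "(monomial A \<otimes> monomial B) m = (monomial (A + B) :: _ \<Rightarrow> 'k) m"
    unfolding coeff_monomial_mult by (auto simp: monomial_def)
qed

lemma coeff_monomial_mult_add: "(monomial A \<otimes> f) (m + A) = f m"
  by (simp add: coeff_monomial_mult)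

lemmas coeff_simps = coeff_add coeff_zero coeff_minus coeff_monomial_mult

text \<open>
  In terms of coefficients, \<open>monomial_ideal p s\<close> is the ideal generated by the powers
  \<open>X\<^sub>1\<^sup>s, \<dots>, X\<^sub>p\<^sup>s\<close>: a series lies in it as soon as every monomial occurring in it is divisible by
  one of them. Working with coefficients makes all colon ideals below visible at once.
\<close>

definition monomial_ideal :: "nat \<Rightarrow> nat \<Rightarrow> (nat multiset \<Rightarrow> 'k) set" where
  "monomial_ideal p s = {f \<in> carrier R. \<forall>m. (\<forall>j\<in>{1..p}. count m j < s) \<longrightarrow> f m = 0}"

lemma monomial_ideal_closed: "f \<in> monomial_ideal p s \<Longrightarrow> f \<in> carrier R"
  by (simp add: monomial_ideal_def)

lemma monomial_ideal_zero [simp]: "\<zero> \<in> monomial_ideal p s"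
  by (simp add: monomial_ideal_def coeff_simps)

lemma monomial_ideal_add:
  "f \<in> monomial_ideal p s \<Longrightarrow> g \<in> monomial_ideal p s \<Longrightarrow> f \<oplus> g \<in> monomial_ideal p s"
  by (simp add: monomial_ideal_def coeff_simps)

lemma monomial_ideal_mult:
  assumes "r \<in> carrier R" "f \<in> monomial_ideal p s"
  shows "r \<otimes> f \<in> monomial_ideal p s"
proof -
  have "r a * f (m - a) = 0" if "\<forall>j\<in>{1..p}. count m j < s" for m a
  proof -
    have "\<forall>j\<in>{1..p}. count (m - a) j < s" using that by (simp add: less_imp_diff_less)
    then show ?thesis using assms(2) by (simp add: monomial_ideal_def)
  qed
  then show ?thesis
    using assms by (auto simp: monomial_ideal_def coeff_mult intro!: sum.neutral)
qed

lemma monomial_ideal_minus: "f \<in> monomial_ideal p s \<Longrightarrow> \<ominus> f \<in> monomial_ideal p s"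
  by (simp add: monomial_ideal_def coeff_simps)

lemma monomial_ideal_0: "monomial_ideal 0 s = {\<zero>}"
  by (auto simp: monomial_ideal_def coeff_simps intro!: coeff_eqI)

lemma monomial_ideal_mono: "monomial_ideal p s \<subseteq> monomial_ideal (Suc p) s"
  by (auto simp: monomial_ideal_def)

lemma monomial_ideal_antimono:
  "s \<le> t \<Longrightarrow> monomial_ideal p t \<subseteq> monomial_ideal p s"
  by (force simp: monomial_ideal_def)

lemma power_in_monomial_ideal:
  assumes "j \<in> {1..p}" "p \<le> n"
  shows "monomial (replicate_mset s j) \<in> monomial_ideal p s"
proof -
  have "\<not> (\<forall>j'\<in>{1..p}. count (replicate_mset s j) j' < s)"
    using assms(1) by (auto intro!: bexI[of _ j])
  then show ?thesis
    using assms monomial_closed[of "replicate_mset s j"]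
    by (auto simp: monomial_ideal_def) (auto simp: monomial_def split: if_splits)
qed

definition next_var :: "nat \<Rightarrow> nat \<Rightarrow> (nat multiset \<Rightarrow> 'k)" where
  "next_var p t = monomial (replicate_mset t (Suc p))"

definition var_product :: "nat \<Rightarrow> nat \<Rightarrow> (nat multiset \<Rightarrow> 'k)" where
  "var_product p e = monomial (repeat_mset e (mset_set {1..p}))"

lemma next_var_closed: "Suc p \<le> n \<Longrightarrow> next_var p t \<in> carrier R"
  unfolding next_var_def by (rule monomial_closed) auto

lemma var_product_closed: "p \<le> n \<Longrightarrow> var_product p e \<in> carrier R"
  unfolding var_product_def
  by (rule monomial_closed)
     (auto simp: count_greater_zero_iff[symmetric] count_mset_set' simp del: count_greater_zero_iff split: if_splits)

lemma next_var_add: "next_var p (s + t) = next_var p s \<otimes> next_var p t"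
  by (simp add: next_var_def monomial_mult) (rule arg_cong[of _ _ monomial], rule multiset_eqI, simp)

lemma next_var_0 [simp]: "next_var p 0 = \<one>"
  by (simp add: next_var_def one_eq_monomial)

lemma var_product_add: "var_product p (s + t) = var_product p s \<otimes> var_product p t"
  by (simp add: var_product_def monomial_mult repeat_mset_distrib)

lemma var_product_0 [simp]: "var_product p 0 = \<one>"
  by (simp add: var_product_def one_eq_monomial)

lemma var_product_0_vars [simp]: "var_product 0 e = \<one>"
  by (simp add: var_product_def one_eq_monomial)

lemma var_product_Suc_vars: "var_product (Suc p) e = next_var p e \<otimes> var_product p e"
  by (simp add: next_var_def var_product_def monomial_mult atLeastAtMostSuc_conv repeat_mset_distrib2)

lemma next_var_in_monomial_ideal: "Suc p \<le> n \<Longrightarrow> next_var p s \<in> monomial_ideal (Suc p) s"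
  unfolding next_var_def by (rule power_in_monomial_ideal) auto

lemma monomial_ideal_Suc_split:
  assumes f: "f \<in> monomial_ideal (Suc p) s" and p: "Suc p \<le> n"
  obtains g f' where "g \<in> carrier R" "f' \<in> monomial_ideal p s"
    "f = next_var p s \<otimes> g \<oplus> f'"
proof
  let ?g = "\<lambda>m. f (m + replicate_mset s (Suc p))"
  let ?f' = "\<lambda>m. if count m (Suc p) < s then f m else 0"
  show "?g \<in> carrier R"
    using f by (auto simp: monomial_ideal_def carrier_iff)
  show "?f' \<in> monomial_ideal p s"
    using f by (auto simp: monomial_ideal_def carrier_iff atLeastAtMostSuc_conv)
  show "f = next_var p s \<otimes> ?g \<oplus> ?f'"
    unfolding next_var_def by (rule coeff_eqI) (auto simp: coeff_simps count_le_replicate_mset_subset_eq[symmetric])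
qed

lemma monomial_ideal_cancel_next:
  assumes r: "r \<in> carrier R" and "next_var p t \<otimes> r \<in> monomial_ideal p s"
  shows "r \<in> monomial_ideal p s"
proof -
  have "r m = 0" if "\<forall>j\<in>{1..p}. count m j < s" for m
  proof -
    have "(monomial (replicate_mset t (Suc p)) \<otimes> r) (m + replicate_mset t (Suc p)) = 0"
      using that assms(2) unfolding next_var_def by (force simp: monomial_ideal_def)
    then show ?thesis by (simp only: next_var_def var_product_def coeff_monomial_mult_add)
  qed
  then show ?thesis using r by (simp add: monomial_ideal_def)
qed

lemma monomial_ideal_cancel_var_product:
  assumes r: "r \<in> carrier R" and "var_product p e \<otimes> r \<in> monomial_ideal p (s + e)"
  shows "r \<in> monomial_ideal p s"
proof -
  have "r m = 0" if "\<forall>j\<in>{1..p}. count m j < s" for m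
  proof -
    have "(var_product p e \<otimes> r) (m + repeat_mset e (mset_set {1..p})) = 0"
      using that assms(2) by (simp add: monomial_ideal_def)
    then show ?thesis by (simp only: next_var_def var_product_def coeff_monomial_mult_add)
  qed
  then show ?thesis using r by (simp add: monomial_ideal_def)
qed

text \<open>
  For the product \<open>P = X\<^sub>1 \<cdots> X\<^sub>p\<close>, a relation \<open>P r + X\<^bsub>p+1\<^esub>\<^sup>t r' = 0\<close> modulo \<open>(X\<^sub>1\<^sup>s, \<dots>, X\<^sub>p\<^sup>s)\<close> forces \<open>r'\<close> to be
  a multiple of \<open>P\<close> modulo that ideal, since \<open>X\<^bsub>p+1\<^esub>\<close> occurs neither in \<open>P\<close> nor in the generators.
\<close>

lemma monomial_ideal_syzygy:
  assumes r: "r \<in> carrier R" "r' \<in> carrier R" and p: "Suc p \<le> n"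
    and in_ideal: "var_product p 1 \<otimes> r \<oplus> next_var p t \<otimes> r' \<in> monomial_ideal p s"
  obtains a k where "a \<in> carrier R" "k \<in> monomial_ideal p s" "r' = var_product p 1 \<otimes> a \<oplus> k"
proof
  let ?P = "mset_set {1..p}" and ?Y = "replicate_mset t (Suc p)"
  let ?a = "\<lambda>m. r' (m + ?P)"
  let ?k = "\<lambda>m. if ?P \<subseteq># m then 0 else r' m"
  show "?a \<in> carrier R" using r(2) by (auto simp: carrier_iff)
  show "r' = var_product p 1 \<otimes> ?a \<oplus> ?k"
    unfolding var_product_def by (rule coeff_eqI) (auto simp: coeff_simps)
  have "?k m = 0" if m: "\<forall>j\<in>{1..p}. count m j < s" for m
  proof (cases "?P \<subseteq># m")
    case False
    then obtain j where "count m j < count ?P j"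
      by (auto simp: subseteq_mset_def not_le)
    then have j: "j \<in> {1..p}" "count m j = 0"
      by (simp_all add: count_mset_set' split: if_splits)
    then have "\<not> ?P \<subseteq># m + ?Y"
      by (simp add: subseteq_mset_def count_mset_set' not_le) (rule exI[of _ j], simp)
    moreover have "(var_product p 1 \<otimes> r \<oplus> next_var p t \<otimes> r') (m + ?Y) = 0"
      using in_ideal m by (force simp: monomial_ideal_def)
    ultimately show ?thesis by (simp add: next_var_def var_product_def coeff_simps)
  qed simp
  then show "?k \<in> monomial_ideal p s" using r(2) by (auto simp: monomial_ideal_def carrier_iff)
qed

lemma monomial_ideal_annihilates:
  assumes M: "module R M" and v: "v \<in> carrier M" and "p \<le> n"
    and "\<And>j. j \<in> {1..p} \<Longrightarrow> monomial (replicate_mset s j) \<odot>\<^bsub>M\<^esub> v = \<zero>\<^bsub>M\<^esub>"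
    and "f \<in> monomial_ideal p s"
  shows "f \<odot>\<^bsub>M\<^esub> v = \<zero>\<^bsub>M\<^esub>"
proof -
  interpret M: module R M by (rule M)
  show ?thesis
    using assms(3-5)
  proof (induction p arbitrary: f)
    case 0
    then show ?case using v by (simp add: monomial_ideal_0)
  next
    case (Suc p)
    obtain g f' where g: "g \<in> carrier R" and f': "f' \<in> monomial_ideal p s"
      and f: "f = next_var p s \<otimes> g \<oplus> f'"
      using monomial_ideal_Suc_split Suc.prems(1,3) by metis
    have Y: "next_var p s \<in> carrier R" using Suc.prems(1) by (rule next_var_closed)
    have "f' \<odot>\<^bsub>M\<^esub> v = \<zero>\<^bsub>M\<^esub>" using Suc f' by auto
    moreover have "f = g \<otimes> next_var p s \<oplus> f'" using f g Y m_comm by simp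
    ultimately show ?case
      using v g f' Y Suc.prems(2)[of "Suc p", folded next_var_def]
      by (simp add: M.smult_l_distr M.smult_assoc1 monomial_ideal_closed)
  qed
qed

end


section \<open>Injective modules\<close>

lemma module_regular_module:
  fixes R (structure)
  assumes "cring R"
  shows "module R (regular_module R)"
proof -
  interpret cring R by (rule assms)
  show ?thesis
    by (rule module_criteria)
       (auto simp: regular_module_def a_ac m_assoc l_distr r_distr intro: cring_axioms l_neg r_neg
             intro!: bexI[of _ "\<ominus> _"])
qed

text \<open>
  Baer's criterion read backwards: a consistent system of linear equations \<open>a \<odot> w = u\<close> has a
  solution \<open>w\<close> in an injective module. The left-hand sides form an ideal, on which
  \<open>a \<mapsto> u\<close> is a homomorphism, and \<open>w\<close> is the value at \<open>\<one>\<close> of an extension to the ring.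
\<close>

lemma injective_module_solves_relation:
  fixes R :: "('r, 'z) ring_scheme" (structure) and J :: "('r, 'e) module"
  assumes inj: "injective_module R J"
    and S: "S \<subseteq> carrier R \<times> carrier J" "(\<zero>, \<zero>\<^bsub>J\<^esub>) \<in> S"
    and add: "\<And>a u b v. (a, u) \<in> S \<Longrightarrow> (b, v) \<in> S \<Longrightarrow> (a \<oplus> b, u \<oplus>\<^bsub>J\<^esub> v) \<in> S"
    and smult: "\<And>r a u. r \<in> carrier R \<Longrightarrow> (a, u) \<in> S \<Longrightarrow> (r \<otimes> a, r \<odot>\<^bsub>J\<^esub> u) \<in> S"
    and consistent: "\<And>u. (\<zero>, u) \<in> S \<Longrightarrow> u = \<zero>\<^bsub>J\<^esub>"
  obtains w where "w \<in> carrier J" "\<And>a u. (a, u) \<in> S \<Longrightarrow> a \<odot>\<^bsub>J\<^esub> w = u"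
proof -
  interpret J: module R J using inj by (simp add: injective_module_def)
  interpret reg: module R "regular_module R" by (rule module_regular_module) (rule J.is_cring)
  let ?A = "(regular_module R)\<lparr>carrier := fst ` S\<rparr>"
  have carr: "a \<in> carrier R" "u \<in> carrier J" if "(a, u) \<in> S" for a u using S that by auto
  have single_valued: "u = v" if uv: "(a, u) \<in> S" "(a, v) \<in> S" for a u v
  proof -
    have "(a \<oplus> (\<ominus> \<one>) \<otimes> a, u \<oplus>\<^bsub>J\<^esub> (\<ominus> \<one>) \<odot>\<^bsub>J\<^esub> v) \<in> S"
      using uv by (intro add smult) auto
    then have "(\<zero>, u \<oplus>\<^bsub>J\<^esub> (\<ominus>\<^bsub>J\<^esub> v)) \<in> S"
      using carr uv by (simp add: J.smult_minus_1 J.R.l_minus J.R.r_neg)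
    then have "u \<oplus>\<^bsub>J\<^esub> (\<ominus>\<^bsub>J\<^esub> v) = \<zero>\<^bsub>J\<^esub>" by (rule consistent)
    then show ?thesis using carr uv by (metis J.minus_equality J.minus_minus J.a_inv_closed J.M.add.inv_equality)
  qed
  define g where "g a = (SOME u. (a, u) \<in> S)" for a
  have g: "g a = u" if "(a, u) \<in> S" for a u
    unfolding g_def using that by (rule someI2) (use that single_valued in blast)
  have "submodule R (fst ` S) (regular_module R)"
  proof (rule submodule.intro[OF reg.module_axioms])
    show "fst ` S \<subseteq> carrier (regular_module R)" using carr by (auto simp: regular_module_def)
    show "\<zero>\<^bsub>regular_module R\<^esub> \<in> fst ` S" using S(2) by (force simp: regular_module_def)
    fix x assume "x \<in> fst ` S"
    then obtain u where xu: "(x, u) \<in> S" by auto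
    show "r \<odot>\<^bsub>regular_module R\<^esub> x \<in> fst ` S" if "r \<in> carrier R" for r
      using imageI[OF smult[OF that xu], of fst] by (simp add: regular_module_def)
    fix y assume "y \<in> fst ` S"
    then obtain v where yv: "(y, v) \<in> S" by auto
    show "x \<oplus>\<^bsub>regular_module R\<^esub> y \<in> fst ` S"
      using imageI[OF add[OF xu yv], of fst] by (simp add: regular_module_def)
  qed
  then have A: "module R ?A" by (rule reg.submodule_is_module)
  have "g \<in> module_hom R ?A J"
    unfolding module_hom_def
  proof (intro CollectI conjI allI impI)
    show "g \<in> carrier ?A \<rightarrow> carrier J" using g carr by auto
    fix x y assume "x \<in> carrier ?A \<and> y \<in> carrier ?A"
    then obtain u v where "(x, u) \<in> S" "(y, v) \<in> S" by auto
    then show "g (x \<oplus>\<^bsub>?A\<^esub> y) = g x \<oplus>\<^bsub>J\<^esub> g y"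
      using g[OF add] g by (simp add: regular_module_def)
  next
    fix r x assume rx: "r \<in> carrier R \<and> x \<in> carrier ?A"
    then obtain u where "(x, u) \<in> S" by auto
    then show "g (r \<odot>\<^bsub>?A\<^esub> x) = r \<odot>\<^bsub>J\<^esub> g x"
      using g[OF smult] g rx by (simp add: regular_module_def)
  qed
  moreover have "(\<lambda>x. x) \<in> module_hom R ?A (regular_module R)"
    using carr by (auto simp: module_hom_def regular_module_def)
  ultimately obtain h where h: "h \<in> module_hom R (regular_module R) J" "\<forall>x\<in>carrier ?A. h x = g x"
    using inj[unfolded injective_module_def, THEN conjunct2, rule_format, of ?A "regular_module R" "\<lambda>x. x" g]
      A reg.module_axioms by (auto simp: inj_on_def)
  show thesis
  proof
    show "h \<one> \<in> carrier J" using module_hom_closed[OF h(1)] by (auto simp: regular_module_def)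
    fix a u assume au: "(a, u) \<in> S"
    have "a \<odot>\<^bsub>J\<^esub> h \<one> = h (a \<odot>\<^bsub>regular_module R\<^esub> \<one>)"
      using carr[OF au] by (intro module_hom_smult[OF h(1), symmetric]) (auto simp: regular_module_def)
    also have "\<dots> = h a" using carr[OF au] by (simp add: regular_module_def)
    also have "\<dots> = u" using h(2) au g by (force simp: regular_module_def)
    finally show "a \<odot>\<^bsub>J\<^esub> h \<one> = u" .
  qed
qed

text \<open>
  One equation \<open>a \<odot> w = u\<close> divides \<open>u\<close> by \<open>a\<close>; the ideal \<open>K\<close> keeps the quotient \<open>w\<close> in a torsion
  submodule. The second equation serves to choose quotients of the members of a sequence compatibly.
\<close>

lemma injective_module_solves_two:
  fixes R :: "('r, 'z) ring_scheme" (structure) and J :: "('r, 'e) module"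
  assumes inj: "injective_module R J"
    and ab: "a \<in> carrier R" "b \<in> carrier R" and uv: "u \<in> carrier J" "v \<in> carrier J"
    and K: "K \<subseteq> carrier R" "\<zero> \<in> K" "\<And>x y. x \<in> K \<Longrightarrow> y \<in> K \<Longrightarrow> x \<oplus> y \<in> K"
      "\<And>r x. r \<in> carrier R \<Longrightarrow> x \<in> K \<Longrightarrow> r \<otimes> x \<in> K"
    and consistent: "\<And>r r' k. r \<in> carrier R \<Longrightarrow> r' \<in> carrier R \<Longrightarrow> k \<in> K \<Longrightarrow>
      r \<otimes> a \<oplus> r' \<otimes> b \<oplus> k = \<zero> \<Longrightarrow> r \<odot>\<^bsub>J\<^esub> u \<oplus>\<^bsub>J\<^esub> r' \<odot>\<^bsub>J\<^esub> v = \<zero>\<^bsub>J\<^esub>"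
  obtains w where "w \<in> carrier J" "a \<odot>\<^bsub>J\<^esub> w = u" "b \<odot>\<^bsub>J\<^esub> w = v" "\<And>k. k \<in> K \<Longrightarrow> k \<odot>\<^bsub>J\<^esub> w = \<zero>\<^bsub>J\<^esub>"
proof -
  interpret J: module R J using inj by (simp add: injective_module_def)
  note uv[simp] ab[simp]
  define S where "S = {(r \<otimes> a \<oplus> r' \<otimes> b \<oplus> k, r \<odot>\<^bsub>J\<^esub> u \<oplus>\<^bsub>J\<^esub> r' \<odot>\<^bsub>J\<^esub> v) | r r' k.
      r \<in> carrier R \<and> r' \<in> carrier R \<and> k \<in> K}"
  have Kc: "k \<in> K \<Longrightarrow> k \<in> carrier R" for k using K(1) by blast
  have SI: "(x, y) \<in> S" if "r \<in> carrier R" "r' \<in> carrier R" "k \<in> K"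
    "x = r \<otimes> a \<oplus> r' \<otimes> b \<oplus> k" "y = r \<odot>\<^bsub>J\<^esub> u \<oplus>\<^bsub>J\<^esub> r' \<odot>\<^bsub>J\<^esub> v" for x y r r' k
    using that unfolding S_def by blast
  have SE: "\<exists>r\<in>carrier R. \<exists>r'\<in>carrier R. \<exists>k\<in>K. x = r \<otimes> a \<oplus> r' \<otimes> b \<oplus> k \<and> y = r \<odot>\<^bsub>J\<^esub> u \<oplus>\<^bsub>J\<^esub> r' \<odot>\<^bsub>J\<^esub> v"
    if "(x, y) \<in> S" for x y
    using that unfolding S_def by blast
  obtain w where w: "w \<in> carrier J" "\<And>x y. (x, y) \<in> S \<Longrightarrow> x \<odot>\<^bsub>J\<^esub> w = y"
  proof (rule injective_module_solves_relation[OF inj, of S])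
    show "S \<subseteq> carrier R \<times> carrier J"
      using Kc by (auto simp: S_def)
    show "(\<zero>, \<zero>\<^bsub>J\<^esub>) \<in> S" by (rule SI[of \<zero> \<zero> \<zero>]) (use K in auto)
    fix x y x' y' assume xy: "(x, y) \<in> S"
    obtain r r' k where 1: "r \<in> carrier R" "r' \<in> carrier R" "k \<in> K"
      "x = r \<otimes> a \<oplus> r' \<otimes> b \<oplus> k" "y = r \<odot>\<^bsub>J\<^esub> u \<oplus>\<^bsub>J\<^esub> r' \<odot>\<^bsub>J\<^esub> v"
      using SE[OF xy] by blast
    {
      assume x'y': "(x', y') \<in> S"
      obtain q q' l where 2: "q \<in> carrier R" "q' \<in> carrier R" "l \<in> K"
        "x' = q \<otimes> a \<oplus> q' \<otimes> b \<oplus> l" "y' = q \<odot>\<^bsub>J\<^esub> u \<oplus>\<^bsub>J\<^esub> q' \<odot>\<^bsub>J\<^esub> v"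
        using SE[OF x'y'] by blast
      show "(x \<oplus> x', y \<oplus>\<^bsub>J\<^esub> y') \<in> S"
      proof (rule SI[of "r \<oplus> q" "r' \<oplus> q'" "k \<oplus> l"])
        show "x \<oplus> x' = (r \<oplus> q) \<otimes> a \<oplus> (r' \<oplus> q') \<otimes> b \<oplus> (k \<oplus> l)"
          using 1 2 Kc by (simp add: J.R.l_distr J.R.a_ac)
        show "y \<oplus>\<^bsub>J\<^esub> y' = (r \<oplus> q) \<odot>\<^bsub>J\<^esub> u \<oplus>\<^bsub>J\<^esub> (r' \<oplus> q') \<odot>\<^bsub>J\<^esub> v"
          using 1 2 by (simp add: J.smult_l_distr J.M.a_ac)
      qed (use 1 2 K in auto)
    }
    fix c assume c: "c \<in> carrier R"
    show "(c \<otimes> x, c \<odot>\<^bsub>J\<^esub> y) \<in> S"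
    proof (rule SI[of "c \<otimes> r" "c \<otimes> r'" "c \<otimes> k"])
      show "c \<otimes> x = c \<otimes> r \<otimes> a \<oplus> c \<otimes> r' \<otimes> b \<oplus> c \<otimes> k"
        using 1 Kc c by (simp add: J.R.r_distr J.R.m_assoc)
      show "c \<odot>\<^bsub>J\<^esub> y = (c \<otimes> r) \<odot>\<^bsub>J\<^esub> u \<oplus>\<^bsub>J\<^esub> (c \<otimes> r') \<odot>\<^bsub>J\<^esub> v"
        using 1 c by (simp add: J.smult_r_distr J.smult_assoc1)
    qed (use 1 c K in auto)
  next
    fix y assume "(\<zero>, y) \<in> S"
    then show "y = \<zero>\<^bsub>J\<^esub>" using SE consistent by metis
  next
    fix w assume "w \<in> carrier J" "\<And>x y. (x, y) \<in> S \<Longrightarrow> x \<odot>\<^bsub>J\<^esub> w = y"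
    then show thesis by (rule that)
  qed
  show thesis
  proof
    show "w \<in> carrier J" by (rule w)
    show "a \<odot>\<^bsub>J\<^esub> w = u" by (rule w(2), rule SI[of \<one> \<zero> \<zero>]) (use K in auto)
    show "b \<odot>\<^bsub>J\<^esub> w = v" by (rule w(2), rule SI[of \<zero> \<one> \<zero>]) (use K in auto)
    show "k \<odot>\<^bsub>J\<^esub> w = \<zero>\<^bsub>J\<^esub>" if "k \<in> K" for k by (rule w(2), rule SI[of \<zero> \<zero> k]) (use K that in auto)
  qed
qed


section \<open>Local cohomology of the power series ring at its first variables\<close>

lemma (in module) smult_minus_right:
  "a \<in> carrier R \<Longrightarrow> x \<in> carrier M \<Longrightarrow> y \<in> carrier M \<Longrightarrow> a \<odot>\<^bsub>M\<^esub> (x \<ominus>\<^bsub>M\<^esub> y) = a \<odot>\<^bsub>M\<^esub> x \<ominus>\<^bsub>M\<^esub> a \<odot>\<^bsub>M\<^esub> y"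
  by (simp add: a_minus_def smult_r_distr smult_r_minus)

lemma (in module) smult_minus_left:
  "a \<in> carrier R \<Longrightarrow> b \<in> carrier R \<Longrightarrow> x \<in> carrier M \<Longrightarrow> (a \<ominus> b) \<odot>\<^bsub>M\<^esub> x = a \<odot>\<^bsub>M\<^esub> x \<ominus>\<^bsub>M\<^esub> b \<odot>\<^bsub>M\<^esub> x"
  by (simp add: a_minus_def R.minus_eq smult_l_distr smult_l_minus)

locale resolution_of_power_series = power_series n R
  for n :: nat and R :: "(nat multiset \<Rightarrow> 'k::field) ring" (structure) +
  fixes J :: "nat \<Rightarrow> (nat multiset \<Rightarrow> 'k, 'e) module" and d :: "nat \<Rightarrow> 'e \<Rightarrow> 'e"
    and \<epsilon> :: "(nat multiset \<Rightarrow> 'k) \<Rightarrow> 'e"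
  assumes resolution: "injective_resolution R (regular_module R) J d \<epsilon>"
begin

lemma injective_J: "injective_module R (J j)"
  using resolution by (simp add: injective_resolution_def)

lemma module_J: "module R (J j)"
  using injective_J by (simp add: injective_module_def)

sublocale J: module R "J j" for j
  by (rule module_J)

lemma d_hom: "d j \<in> module_hom R (J j) (J (Suc j))"
  using resolution by (simp add: injective_resolution_def)

sublocale d: mod_hom R "J j" "J (Suc j)" "d j" for j
  by unfold_locales (rule d_hom)

definition cocycles :: "nat \<Rightarrow> 'e set" where
  "cocycles j = mod_kernel (J j) (J (Suc j)) (d j)"

lemma cocycles_iff: "z \<in> cocycles j \<longleftrightarrow> z \<in> carrier (J j) \<and> d j z = \<zero>\<^bsub>J (Suc j)\<^esub>"
  by (simp add: cocycles_def mod_kernel_def)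

lemma cocycles_Suc: "cocycles (Suc j) = d j ` carrier (J j)"
  using resolution by (simp add: injective_resolution_def cocycles_def)

lemma cocycles_0: "cocycles 0 = \<epsilon> ` carrier R"
  using resolution by (simp add: injective_resolution_def cocycles_def regular_module_def)

lemma d_d: "x \<in> carrier (J j) \<Longrightarrow> d (Suc j) (d j x) = \<zero>\<^bsub>J (Suc (Suc j))\<^esub>"
  using cocycles_Suc[of j] cocycles_iff[of "d j x" "Suc j"] by auto

text \<open>The submodule of \<open>J j\<close> supported in \<open>X\<^sub>1, \<dots>, X\<^sub>p\<close>.\<close>

definition torsion :: "nat \<Rightarrow> nat \<Rightarrow> 'e set" where
  "torsion p j = {v \<in> carrier (J j). \<exists>s. \<forall>f\<in>monomial_ideal p s. f \<odot>\<^bsub>J j\<^esub> v = \<zero>\<^bsub>J j\<^esub>}"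

lemma torsion_closed: "v \<in> torsion p j \<Longrightarrow> v \<in> carrier (J j)"
  by (simp add: torsion_def)

lemma torsionI:
  "v \<in> carrier (J j) \<Longrightarrow> (\<And>f. f \<in> monomial_ideal p s \<Longrightarrow> f \<odot>\<^bsub>J j\<^esub> v = \<zero>\<^bsub>J j\<^esub>) \<Longrightarrow> v \<in> torsion p j"
  by (auto simp: torsion_def)

lemma torsion_0: "torsion 0 j = carrier (J j)"
  by (auto simp: torsion_def monomial_ideal_0)

lemma submodule_torsion: "submodule R (torsion p j) (J j)"
proof (rule submodule.intro[OF module_J])
  show "torsion p j \<subseteq> carrier (J j)" by (auto simp: torsion_def)
  show "\<zero>\<^bsub>J j\<^esub> \<in> torsion p j"
    by (rule torsionI[of _ _ _ 0]) (auto simp: monomial_ideal_closed)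
  fix v assume v: "v \<in> torsion p j"
  then obtain s where s: "\<And>f. f \<in> monomial_ideal p s \<Longrightarrow> f \<odot>\<^bsub>J j\<^esub> v = \<zero>\<^bsub>J j\<^esub>"
    by (auto simp: torsion_def)
  show "c \<odot>\<^bsub>J j\<^esub> v \<in> torsion p j" if c: "c \<in> carrier R" for c
  proof (rule torsionI[of _ _ _ s])
    fix f assume f: "f \<in> monomial_ideal p s"
    have "f \<odot>\<^bsub>J j\<^esub> (c \<odot>\<^bsub>J j\<^esub> v) = (c \<otimes> f) \<odot>\<^bsub>J j\<^esub> v"
      using f c v by (simp add: monomial_ideal_closed torsion_closed J.smult_assoc1[symmetric] m_comm)
    then show "f \<odot>\<^bsub>J j\<^esub> (c \<odot>\<^bsub>J j\<^esub> v) = \<zero>\<^bsub>J j\<^esub>" using s monomial_ideal_mult c f by simp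
  qed (use v c torsion_closed in auto)
  fix w assume w: "w \<in> torsion p j"
  then obtain t where t: "\<And>f. f \<in> monomial_ideal p t \<Longrightarrow> f \<odot>\<^bsub>J j\<^esub> w = \<zero>\<^bsub>J j\<^esub>"
    by (auto simp: torsion_def)
  show "v \<oplus>\<^bsub>J j\<^esub> w \<in> torsion p j"
  proof (rule torsionI[of _ _ _ "max s t"])
    fix f assume f: "f \<in> monomial_ideal p (max s t)"
    then have "f \<in> monomial_ideal p s" "f \<in> monomial_ideal p t"
      using monomial_ideal_antimono[of s "max s t" p] monomial_ideal_antimono[of t "max s t" p] by auto
    then show "f \<odot>\<^bsub>J j\<^esub> (v \<oplus>\<^bsub>J j\<^esub> w) = \<zero>\<^bsub>J j\<^esub>"
      using s t v w by (simp add: torsion_closed monomial_ideal_closed J.smult_r_distr)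
  qed (use v w torsion_closed in auto)
qed

lemma submodule_minus:
  assumes "submodule R N (J j)" "x \<in> N" "y \<in> N"
  shows "x \<ominus>\<^bsub>J j\<^esub> y \<in> N"
proof -
  interpret N: submodule R N "J j" by (rule assms)
  have "y \<in> carrier (J j)" using assms N.subset by auto
  then have "x \<ominus>\<^bsub>J j\<^esub> y = x \<oplus>\<^bsub>J j\<^esub> (\<ominus> \<one>) \<odot>\<^bsub>J j\<^esub> y" by (simp add: a_minus_def J.smult_minus_1)
  then show ?thesis using assms by simp
qed

lemma torsion_Suc:
  assumes p: "Suc p \<le> n"
  shows "v \<in> torsion (Suc p) j \<longleftrightarrow> v \<in> torsion p j \<and> (\<exists>t. next_var p t \<odot>\<^bsub>J j\<^esub> v = \<zero>\<^bsub>J j\<^esub>)"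
proof
  assume v: "v \<in> torsion (Suc p) j"
  then obtain s where s: "\<And>f. f \<in> monomial_ideal (Suc p) s \<Longrightarrow> f \<odot>\<^bsub>J j\<^esub> v = \<zero>\<^bsub>J j\<^esub>"
    by (auto simp: torsion_def)
  then show "v \<in> torsion p j \<and> (\<exists>t. next_var p t \<odot>\<^bsub>J j\<^esub> v = \<zero>\<^bsub>J j\<^esub>)"
    using torsionI[OF torsion_closed[OF v], of p s] monomial_ideal_mono[of p s]
      next_var_in_monomial_ideal[OF p, of s]
    by auto
next
  assume "v \<in> torsion p j \<and> (\<exists>t. next_var p t \<odot>\<^bsub>J j\<^esub> v = \<zero>\<^bsub>J j\<^esub>)"
  then obtain s t where v: "v \<in> carrier (J j)"
    and s: "\<And>f. f \<in> monomial_ideal p s \<Longrightarrow> f \<odot>\<^bsub>J j\<^esub> v = \<zero>\<^bsub>J j\<^esub>"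
    and t: "next_var p t \<odot>\<^bsub>J j\<^esub> v = \<zero>\<^bsub>J j\<^esub>"
    by (auto simp: torsion_def)
  show "v \<in> torsion (Suc p) j"
  proof (rule torsionI[of _ _ _ "s + t"])
    fix f assume "f \<in> monomial_ideal (Suc p) (s + t)"
    then obtain g f' where g: "g \<in> carrier R" and f': "f' \<in> monomial_ideal p (s + t)"
      and f: "f = next_var p (s + t) \<otimes> g \<oplus> f'"
      using monomial_ideal_Suc_split p by metis
    have "f' \<in> monomial_ideal p s" using f' monomial_ideal_antimono[of s "s + t" p] by auto
    moreover have "f = (next_var p s \<otimes> g) \<otimes> next_var p t \<oplus> f'"
      unfolding f next_var_add using next_var_closed[OF p] g by (simp add: m_ac)
    ultimately show "f \<odot>\<^bsub>J j\<^esub> v = \<zero>\<^bsub>J j\<^esub>"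
      using v s t g next_var_closed[OF p] by (simp add: J.smult_l_distr J.smult_assoc1 monomial_ideal_closed)
  qed (rule v)
qed

lemma d_torsion: "v \<in> torsion p j \<Longrightarrow> d j v \<in> torsion p (Suc j)"
  unfolding torsion_def
proof (clarify, intro conjI)
  fix s assume v: "v \<in> carrier (J j)" and s: "\<forall>f\<in>monomial_ideal p s. f \<odot>\<^bsub>J j\<^esub> v = \<zero>\<^bsub>J j\<^esub>"
  show "d j v \<in> carrier (J (Suc j))" using v by (rule d.f_im)
  have "f \<odot>\<^bsub>J (Suc j)\<^esub> d j v = \<zero>\<^bsub>J (Suc j)\<^esub>" if f: "f \<in> monomial_ideal p s" for f
    using d.f_smult[OF monomial_ideal_closed[OF f] v] s f by simp
  then show "\<exists>s. \<forall>f\<in>monomial_ideal p s. f \<odot>\<^bsub>J (Suc j)\<^esub> d j v = \<zero>\<^bsub>J (Suc j)\<^esub>" by blast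
qed

text \<open>
  The submodule supported in \<open>X\<^sub>1, \<dots>, X\<^sub>p\<close> is divisible by the next variable because that
  variable is a nonzerodivisor modulo \<open>(X\<^sub>1\<^sup>s, \<dots>, X\<^sub>p\<^sup>s)\<close>.
\<close>

lemma torsion_divisible:
  assumes p: "Suc p \<le> n" and v: "v \<in> torsion p j"
  obtains v' where "v' \<in> torsion p j" "next_var p t \<odot>\<^bsub>J j\<^esub> v' = v"
proof -
  obtain s where s: "\<And>f. f \<in> monomial_ideal p s \<Longrightarrow> f \<odot>\<^bsub>J j\<^esub> v = \<zero>\<^bsub>J j\<^esub>"
    using v by (auto simp: torsion_def)
  note closed = next_var_closed[OF p] torsion_closed[OF v]
  obtain w where w: "w \<in> carrier (J j)" "next_var p t \<odot>\<^bsub>J j\<^esub> w = v"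
    "\<And>f. f \<in> monomial_ideal p s \<Longrightarrow> f \<odot>\<^bsub>J j\<^esub> w = \<zero>\<^bsub>J j\<^esub>"
  proof (rule injective_module_solves_two[OF injective_J, of "next_var p t" \<zero> v j "\<zero>\<^bsub>J j\<^esub>" "monomial_ideal p s"])
    fix r r' k assume r: "r \<in> carrier R" "r' \<in> carrier R" "k \<in> monomial_ideal p s"
      "r \<otimes> next_var p t \<oplus> r' \<otimes> \<zero> \<oplus> k = \<zero>"
    then have "next_var p t \<otimes> r = \<ominus> k"
      using closed monomial_ideal_closed by (simp add: m_comm minus_equality)
    then have "r \<in> monomial_ideal p s"
      using r monomial_ideal_minus monomial_ideal_cancel_next by metis
    then show "r \<odot>\<^bsub>J j\<^esub> v \<oplus>\<^bsub>J j\<^esub> r' \<odot>\<^bsub>J j\<^esub> \<zero>\<^bsub>J j\<^esub> = \<zero>\<^bsub>J j\<^esub>" using s r by simp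
  next
    fix w assume "w \<in> carrier (J j)" "next_var p t \<odot>\<^bsub>J j\<^esub> w = v"
      "\<And>k. k \<in> monomial_ideal p s \<Longrightarrow> k \<odot>\<^bsub>J j\<^esub> w = \<zero>\<^bsub>J j\<^esub>"
    then show thesis by (rule that)
  next
    show "monomial_ideal p s \<subseteq> carrier R" using monomial_ideal_closed by blast
  qed (simp_all add: closed monomial_ideal_add monomial_ideal_mult)
  have "w \<in> torsion p j" by (rule torsionI[of w j p s]) (fact w)+
  with w(2) show thesis by (intro that[of w])
qed

end

lemma (in abelian_group) minus_eq_add_swap:
  assumes "x \<in> carrier G" "e \<in> carrier G" "y \<in> carrier G" "b \<in> carrier G" "x \<ominus> e = y \<oplus> b"
  shows "x \<ominus> y = e \<oplus> b"
proof -
  have "x = (x \<ominus> e) \<oplus> e" using assms(1,2) by (simp add: a_minus_def a_assoc l_neg)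
  also have "\<dots> = y \<oplus> (e \<oplus> b)" unfolding assms(5) using assms(2-4) by (simp add: a_ac)
  finally show ?thesis using assms(2-4) by (simp add: a_minus_def a_comm[of y] a_assoc r_neg)
qed

lemma (in power_series) var_product_iterate:
  assumes "p \<le> n" and M: "module R M" and "\<And>s. h s \<in> carrier M"
    and "\<And>s. var_product p 1 \<odot>\<^bsub>M\<^esub> h (Suc s) = h s"
  shows "var_product p e \<odot>\<^bsub>M\<^esub> h (s + e) = h s"
proof -
  interpret M: module R M by (rule M)
  show ?thesis
  proof (induction e)
    case 0
    then show ?case using assms by (simp add: M.smult_one)
  next
    case (Suc e)
    have "var_product p (Suc e) \<odot>\<^bsub>M\<^esub> h (s + Suc e) = var_product p e \<odot>\<^bsub>M\<^esub> (var_product p 1 \<odot>\<^bsub>M\<^esub> h (Suc (s + e)))"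
      using assms var_product_closed[OF \<open>p \<le> n\<close>] var_product_add[of p e 1] by (simp add: M.smult_assoc1)
    then show ?case using assms(4) Suc by simp
  qed
qed

context resolution_of_power_series
begin

definition coboundaries :: "nat \<Rightarrow> nat \<Rightarrow> 'e set" where
  "coboundaries p j = (case j of 0 \<Rightarrow> {\<zero>\<^bsub>J 0\<^esub>} | Suc j' \<Rightarrow> d j' ` torsion p j')"

lemma coboundaries_0 [simp]: "coboundaries p 0 = {\<zero>\<^bsub>J 0\<^esub>}"
  by (simp add: coboundaries_def)

lemma coboundaries_Suc [simp]: "coboundaries p (Suc j) = d j ` torsion p j"
  by (simp add: coboundaries_def)

lemma submodule_coboundaries: "submodule R (coboundaries p j) (J j)"
proof (cases j)
  case 0
  have "submodule R {\<zero>\<^bsub>J 0\<^esub>} (J 0)" by (rule submodule.intro[OF module_J]) auto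
  then show ?thesis by (simp add: 0)
next
  case (Suc j')
  interpret T: submodule R "torsion p j'" "J j'" by (rule submodule_torsion)
  have Tc: "v \<in> torsion p j' \<Longrightarrow> v \<in> carrier (J j')" for v by (rule torsion_closed)
  have "submodule R (d j' ` torsion p j') (J (Suc j'))"
  proof (rule submodule.intro[OF module_J])
    show "d j' ` torsion p j' \<subseteq> carrier (J (Suc j'))" using Tc d.f_im by blast
    show "\<zero>\<^bsub>J (Suc j')\<^esub> \<in> d j' ` torsion p j'"
      by (rule image_eqI[of _ _ "\<zero>\<^bsub>J j'\<^esub>"]) (simp_all add: d.f0_is_0)
    fix x assume "x \<in> d j' ` torsion p j'"
    then obtain v where v: "x = d j' v" "v \<in> torsion p j'" by blast
    show "r \<odot>\<^bsub>J (Suc j')\<^esub> x \<in> d j' ` torsion p j'" if r: "r \<in> carrier R" for r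
      unfolding v(1) using d.f_smult[OF r Tc[OF v(2)]] T.smult_closed[OF r v(2)] by (metis image_eqI)
    fix y assume "y \<in> d j' ` torsion p j'"
    then obtain w where w: "y = d j' w" "w \<in> torsion p j'" by blast
    show "x \<oplus>\<^bsub>J (Suc j')\<^esub> y \<in> d j' ` torsion p j'"
      unfolding v(1) w(1) using d.f_add[OF Tc[OF v(2)] Tc[OF w(2)]] T.m_closed[OF v(2) w(2)] by (metis image_eqI)
  qed
  then show ?thesis by (simp add: Suc)
qed

lemma coboundaries_subset_torsion: "coboundaries p j \<subseteq> torsion p j"
proof (cases j)
  case 0
  interpret T: submodule R "torsion p 0" "J 0" by (rule submodule_torsion)
  show ?thesis by (simp add: 0)
next
  case (Suc j')
  then show ?thesis using d_torsion by auto
qed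

lemma coboundaries_subset_cocycles: "coboundaries p j \<subseteq> cocycles j"
  by (cases j) (auto simp: cocycles_iff d_d torsion_closed intro: d.f_im)

lemma coboundaries_divisible:
  assumes p: "Suc p \<le> n" and b: "b \<in> coboundaries p j"
  obtains b' where "b' \<in> coboundaries p j" "next_var p t \<odot>\<^bsub>J j\<^esub> b' = b"
proof (cases j)
  case 0
  then show thesis using b that[of b] next_var_closed[OF p] by simp
next
  case (Suc j')
  then obtain v where v: "b = d j' v" "v \<in> torsion p j'" using b by auto
  obtain v' where v': "v' \<in> torsion p j'" "next_var p t \<odot>\<^bsub>J j'\<^esub> v' = v"
    using torsion_divisible[OF p v(2)] by blast
  have "next_var p t \<odot>\<^bsub>J j\<^esub> d j' v' = b"
    using d.f_smult[OF next_var_closed[OF p] torsion_closed[OF v'(1)], of t] v'(2) v(1) Suc by simp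
  then show thesis using that[of "d j' v'"] v'(1) Suc by simp
qed

text \<open>
  Vanishing of local cohomology above the number of generators of the ideal: one more variable
  can raise the last nonvanishing degree only by one.
\<close>

lemma torsion_cocycles_vanish:
  assumes "p \<le> n" "p < q" "z \<in> cocycles q" "z \<in> torsion p q"
  shows "z \<in> coboundaries p q"
  using assms
proof (induction p arbitrary: q z)
  case 0
  then obtain q' where "q = Suc q'" using gr0_conv_Suc by auto
  then show ?case using 0 by (simp add: cocycles_Suc torsion_0)
next
  case (Suc p)
  obtain q' where q: "q = Suc q'" "p < q'" using Suc.prems(2) by (metis Suc_lessE)
  note p = Suc.prems(1)
  have z: "z \<in> torsion p q" "\<exists>t. next_var p t \<odot>\<^bsub>J q\<^esub> z = \<zero>\<^bsub>J q\<^esub>"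
    using Suc.prems(4) torsion_Suc[OF p] by auto
  then obtain t where t: "next_var p t \<odot>\<^bsub>J q\<^esub> z = \<zero>\<^bsub>J q\<^esub>" by blast
  have "z \<in> coboundaries p q" using Suc.IH[of q z] Suc.prems z q by simp
  then obtain y where y: "z = d q' y" "y \<in> torsion p q'" using q by auto
  interpret T: submodule R "torsion p q'" "J q'" by (rule submodule_torsion)
  note Y = next_var_closed[OF p, of t] and yc = torsion_closed[OF y(2)]
  have "d q' (next_var p t \<odot>\<^bsub>J q'\<^esub> y) = \<zero>\<^bsub>J (Suc q')\<^esub>"
    using t y(1) q(1) d.f_smult[OF Y yc] by simp
  then have "next_var p t \<odot>\<^bsub>J q'\<^esub> y \<in> coboundaries p q'"
    using Suc.IH[of q' "next_var p t \<odot>\<^bsub>J q'\<^esub> y"] p q(2) T.smult_closed[OF Y y(2)] Y yc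
    by (simp add: cocycles_iff)
  then obtain b where b: "b \<in> coboundaries p q'" "next_var p t \<odot>\<^bsub>J q'\<^esub> b = next_var p t \<odot>\<^bsub>J q'\<^esub> y"
    using coboundaries_divisible[OF p] by metis
  have bT: "b \<in> torsion p q'" and bZ: "b \<in> cocycles q'"
    using b(1) coboundaries_subset_torsion coboundaries_subset_cocycles by blast+
  have bc: "b \<in> carrier (J q')" using bT by (rule torsion_closed)
  have "y \<ominus>\<^bsub>J q'\<^esub> b \<in> torsion (Suc p) q'"
    unfolding torsion_Suc[OF p]
  proof (intro conjI exI)
    show "y \<ominus>\<^bsub>J q'\<^esub> b \<in> torsion p q'" by (rule submodule_minus[OF submodule_torsion y(2) bT])
    show "next_var p t \<odot>\<^bsub>J q'\<^esub> (y \<ominus>\<^bsub>J q'\<^esub> b) = \<zero>\<^bsub>J q'\<^esub>"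
      using Y yc bc b(2) by (simp add: J.smult_minus_right)
  qed
  moreover have "d q' (y \<ominus>\<^bsub>J q'\<^esub> b) = z"
    using d.f_minus[OF yc bc] bZ y(1) yc by (simp add: cocycles_iff a_minus_def)
  ultimately show ?case using q(1) by (simp add: image_iff) metis
qed

text \<open>
  A fraction system identifies, by \<open>\<lambda>r s. r \<odot> h s\<close>, the \<open>p\<close>-th cohomology of the complex of
  submodules supported in \<open>X\<^sub>1, \<dots>, X\<^sub>p\<close> with the direct limit of the quotients of the ring by
  \<open>(X\<^sub>1\<^sup>s, \<dots>, X\<^sub>p\<^sup>s)\<close> along multiplication by \<open>X\<^sub>1 \<cdots> X\<^sub>p\<close>; one may think of \<open>h s\<close> as
  the class of \<open>1 / (X\<^sub>1 \<cdots> X\<^sub>p)\<^sup>s\<close>.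
\<close>

definition fraction_system :: "nat \<Rightarrow> (nat \<Rightarrow> 'e) \<Rightarrow> bool" where
  "fraction_system p h \<longleftrightarrow>
     (\<forall>s. h s \<in> cocycles p) \<and>
     (\<forall>s. \<forall>f\<in>monomial_ideal p s. f \<odot>\<^bsub>J p\<^esub> h s = \<zero>\<^bsub>J p\<^esub>) \<and>
     (\<forall>s. var_product p 1 \<odot>\<^bsub>J p\<^esub> h (Suc s) = h s) \<and>
     (\<forall>z\<in>cocycles p \<inter> torsion p p. \<exists>r\<in>carrier R. \<exists>s. \<exists>b\<in>coboundaries p p. z = r \<odot>\<^bsub>J p\<^esub> h s \<oplus>\<^bsub>J p\<^esub> b) \<and>
     (\<forall>s. \<forall>r\<in>carrier R. r \<odot>\<^bsub>J p\<^esub> h s \<in> coboundaries p p \<longrightarrow> r \<in> monomial_ideal p s)"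

lemma fraction_systemD:
  assumes "fraction_system p h"
  shows "h s \<in> cocycles p" "h s \<in> carrier (J p)"
    "f \<in> monomial_ideal p s \<Longrightarrow> f \<odot>\<^bsub>J p\<^esub> h s = \<zero>\<^bsub>J p\<^esub>"
    "var_product p 1 \<odot>\<^bsub>J p\<^esub> h (Suc s) = h s"
    "z \<in> cocycles p \<Longrightarrow> z \<in> torsion p p \<Longrightarrow>
       \<exists>r\<in>carrier R. \<exists>s. \<exists>b\<in>coboundaries p p. z = r \<odot>\<^bsub>J p\<^esub> h s \<oplus>\<^bsub>J p\<^esub> b"
    "r \<in> carrier R \<Longrightarrow> r \<odot>\<^bsub>J p\<^esub> h s \<in> coboundaries p p \<Longrightarrow> r \<in> monomial_ideal p s"
  using assms by (auto simp: fraction_system_def cocycles_iff)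

lemma fraction_system_0: "fraction_system 0 (\<lambda>s. \<epsilon> \<one>)"
proof -
  interpret reg: module R "regular_module R" by (rule module_regular_module) (rule cring_R)
  interpret eps: mod_hom R "regular_module R" "J 0" \<epsilon>
    by unfold_locales (use resolution in \<open>simp add: injective_resolution_def\<close>)
  have eps: "r \<odot>\<^bsub>J 0\<^esub> \<epsilon> \<one> = \<epsilon> r" if "r \<in> carrier R" for r
    using eps.f_smult[of r \<one>] that by (simp add: regular_module_def)
  have eps1: "\<epsilon> \<one> \<in> carrier (J 0)" using eps.f_im[of \<one>] by (simp add: regular_module_def)
  have inj: "r = \<zero>" if "r \<in> carrier R" "\<epsilon> r = \<zero>\<^bsub>J 0\<^esub>" for r
    using that eps.f0_is_0 resolution
    by (auto simp: injective_resolution_def regular_module_def inj_on_def)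
  show ?thesis
    unfolding fraction_system_def
  proof (intro conjI allI ballI impI)
    show "\<epsilon> \<one> \<in> cocycles 0" by (simp add: cocycles_0)
    show "f \<odot>\<^bsub>J 0\<^esub> \<epsilon> \<one> = \<zero>\<^bsub>J 0\<^esub>" if "f \<in> monomial_ideal 0 s" for f s
      using that eps1 by (simp add: monomial_ideal_0)
    show "var_product 0 1 \<odot>\<^bsub>J 0\<^esub> \<epsilon> \<one> = \<epsilon> \<one>"
      using eps1 by simp
    show "r \<in> monomial_ideal 0 s" if "r \<in> carrier R" "r \<odot>\<^bsub>J 0\<^esub> \<epsilon> \<one> \<in> coboundaries 0 0" for r s
      using that eps inj by (simp add: monomial_ideal_0)
    fix z assume "z \<in> cocycles 0 \<inter> torsion 0 0"
    then obtain r where r: "r \<in> carrier R" "z = \<epsilon> r" by (auto simp: cocycles_0)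
    then have "z = r \<odot>\<^bsub>J 0\<^esub> \<epsilon> \<one> \<oplus>\<^bsub>J 0\<^esub> \<zero>\<^bsub>J 0\<^esub>" using eps eps.f_im[of r] by (simp add: regular_module_def)
    then show "\<exists>r\<in>carrier R. \<exists>s. \<exists>b\<in>coboundaries 0 0. z = r \<odot>\<^bsub>J 0\<^esub> \<epsilon> \<one> \<oplus>\<^bsub>J 0\<^esub> b"
      using r(1) by auto
  qed
qed

text \<open>
  Elements \<open>w s\<close> that play the role of \<open>h s / X\<^bsub>p+1\<^esub>\<^sup>s\<close>. They are found one after another by
  solving linear equations in an injective module; the equations are consistent because
  \<open>X\<^sub>1, \<dots>, X\<^bsub>p+1\<^esub>\<close> is a regular sequence.
\<close>

lemma fraction_system_denominators:
  assumes p: "Suc p \<le> n" and h: "fraction_system p h"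
  obtains w where "\<And>s. w s \<in> carrier (J p)" "\<And>s. next_var p s \<odot>\<^bsub>J p\<^esub> w s = h s"
    "\<And>s f. f \<in> monomial_ideal p s \<Longrightarrow> f \<odot>\<^bsub>J p\<^esub> w s = \<zero>\<^bsub>J p\<^esub>"
    "\<And>s. var_product (Suc p) 1 \<odot>\<^bsub>J p\<^esub> w (Suc s) = w s"
proof -
  let ?P = "\<lambda>s x. x \<in> carrier (J p) \<and> next_var p s \<odot>\<^bsub>J p\<^esub> x = h s \<and>
    (\<forall>f\<in>monomial_ideal p s. f \<odot>\<^bsub>J p\<^esub> x = \<zero>\<^bsub>J p\<^esub>)"
  note h' = fraction_systemD[OF h]
  have "\<exists>w. \<forall>s. ?P s (w s) \<and> var_product (Suc p) 1 \<odot>\<^bsub>J p\<^esub> w (Suc s) = w s"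
  proof (rule dependent_nat_choice)
    show "\<exists>x. ?P 0 x"
      by (rule exI[of _ "h 0"]) (simp add: h')
    fix x s assume x: "?P s x"
    note X = var_product_closed[OF Suc_leD[OF p], of 1] and Y = next_var_closed[OF p]
    obtain y where "y \<in> carrier (J p)" "var_product (Suc p) 1 \<odot>\<^bsub>J p\<^esub> y = x" "next_var p (Suc s) \<odot>\<^bsub>J p\<^esub> y = h (Suc s)"
      "\<And>f. f \<in> monomial_ideal p (Suc s) \<Longrightarrow> f \<odot>\<^bsub>J p\<^esub> y = \<zero>\<^bsub>J p\<^esub>"
    proof (rule injective_module_solves_two[OF injective_J, of "var_product (Suc p) 1" "next_var p (Suc s)" x p "h (Suc s)" "monomial_ideal p (Suc s)"])
      fix r r' k assume r: "r \<in> carrier R" "r' \<in> carrier R" "k \<in> monomial_ideal p (Suc s)"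
        and eq: "r \<otimes> var_product (Suc p) 1 \<oplus> r' \<otimes> next_var p (Suc s) \<oplus> k = \<zero>"
      note k = monomial_ideal_closed[OF r(3)]
      have "r \<otimes> var_product (Suc p) 1 \<oplus> r' \<otimes> next_var p (Suc s)
          = next_var p 1 \<otimes> (var_product p 1 \<otimes> r \<oplus> next_var p s \<otimes> r')"
        using r X Y next_var_add[of p 1 s]
        by (simp add: var_product_Suc_vars r_distr m_ac)
      moreover have "r \<otimes> var_product (Suc p) 1 \<oplus> r' \<otimes> next_var p (Suc s) = \<ominus> k"
        using minus_equality[OF eq k] r X Y by (simp add: var_product_Suc_vars)
      ultimately have multiple: "next_var p 1 \<otimes> (var_product p 1 \<otimes> r \<oplus> next_var p s \<otimes> r') \<in> monomial_ideal p (Suc s)"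
        using monomial_ideal_minus[OF r(3)] by simp
      have in_ideal: "var_product p 1 \<otimes> r \<oplus> next_var p s \<otimes> r' \<in> monomial_ideal p (Suc s)"
        by (rule monomial_ideal_cancel_next[OF _ multiple]) (use r X Y in simp)
      then obtain a k' where a: "a \<in> carrier R" and k': "k' \<in> monomial_ideal p (Suc s)"
        and r': "r' = var_product p 1 \<otimes> a \<oplus> k'"
        using monomial_ideal_syzygy[OF r(1,2) p] by metis
      note k'c = monomial_ideal_closed[OF k']
      have "var_product p 1 \<otimes> r \<oplus> next_var p s \<otimes> r'
          = var_product p 1 \<otimes> (r \<oplus> next_var p s \<otimes> a) \<oplus> next_var p s \<otimes> k'"
        unfolding r' using r a k'c X Y by (simp add: r_distr m_ac a_ac)
      then have "var_product p 1 \<otimes> (r \<oplus> next_var p s \<otimes> a)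
          = (var_product p 1 \<otimes> r \<oplus> next_var p s \<otimes> r') \<oplus> \<ominus> (next_var p s \<otimes> k')"
        using r a k'c X Y by (simp add: a_assoc r_neg)
      then have multiple': "var_product p 1 \<otimes> (r \<oplus> next_var p s \<otimes> a) \<in> monomial_ideal p (s + 1)"
        using in_ideal monomial_ideal_minus[OF monomial_ideal_mult[OF Y[of s] k']]
        by (simp add: monomial_ideal_add)
      have "r \<oplus> next_var p s \<otimes> a \<in> monomial_ideal p s"
        by (rule monomial_ideal_cancel_var_product[OF _ multiple']) (use r a Y in simp)
      then have "\<zero>\<^bsub>J p\<^esub> = (r \<oplus> next_var p s \<otimes> a) \<odot>\<^bsub>J p\<^esub> x" using x by simp
      also have "\<dots> = (r \<oplus> a \<otimes> next_var p s) \<odot>\<^bsub>J p\<^esub> x" using a Y by (simp add: m_comm)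
      also have "\<dots> = r \<odot>\<^bsub>J p\<^esub> x \<oplus>\<^bsub>J p\<^esub> a \<odot>\<^bsub>J p\<^esub> h s"
        using x r(1) a Y by (simp add: J.smult_l_distr J.smult_assoc1)
      also have "a \<odot>\<^bsub>J p\<^esub> h s = (a \<otimes> var_product p 1) \<odot>\<^bsub>J p\<^esub> h (Suc s)"
        using a X h' by (simp only: J.smult_assoc1)
      also have "\<dots> = r' \<odot>\<^bsub>J p\<^esub> h (Suc s)"
        unfolding r' using a X h' k' k'c by (simp add: J.smult_l_distr m_comm)
      finally show "r \<odot>\<^bsub>J p\<^esub> x \<oplus>\<^bsub>J p\<^esub> r' \<odot>\<^bsub>J p\<^esub> h (Suc s) = \<zero>\<^bsub>J p\<^esub>" by simp
    next
      fix y assume "y \<in> carrier (J p)" "var_product (Suc p) 1 \<odot>\<^bsub>J p\<^esub> y = x" "next_var p (Suc s) \<odot>\<^bsub>J p\<^esub> y = h (Suc s)"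
        "\<And>k. k \<in> monomial_ideal p (Suc s) \<Longrightarrow> k \<odot>\<^bsub>J p\<^esub> y = \<zero>\<^bsub>J p\<^esub>"
      then show thesis by (rule that)
    next
      show "monomial_ideal p (Suc s) \<subseteq> carrier R" using monomial_ideal_closed by blast
      show "var_product (Suc p) 1 \<in> carrier R" by (rule var_product_closed[OF p])
      show "next_var p (Suc s) \<in> carrier R" by (rule Y)
      show "x \<in> carrier (J p)" using x by simp
    qed (simp_all only: h' monomial_ideal_add monomial_ideal_mult monomial_ideal_zero)
    then show "\<exists>y. ?P (Suc s) y \<and> var_product (Suc p) 1 \<odot>\<^bsub>J p\<^esub> y = x" by blast
  qed
  then obtain w where "\<forall>s. ?P s (w s) \<and> var_product (Suc p) 1 \<odot>\<^bsub>J p\<^esub> w (Suc s) = w s" ..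
  then show thesis by (intro that[of w]) blast+
qed

text \<open>
  The passage from \<open>p\<close> to \<open>p + 1\<close> variables: the differentials of the elements
  \<open>h s / X\<^bsub>p+1\<^esub>\<^sup>s\<close> form a system in the next degree.
\<close>

lemma fraction_system_Suc:
  assumes p: "Suc p \<le> n" and h: "fraction_system p h"
  obtains h' where "fraction_system (Suc p) h'"
proof -
  note h' = fraction_systemD[OF h]
  have pn: "p \<le> n" using p by simp
  obtain w where wc: "\<And>s. w s \<in> carrier (J p)" and wh: "\<And>s. next_var p s \<odot>\<^bsub>J p\<^esub> w s = h s"
    and wK: "\<And>s f. f \<in> monomial_ideal p s \<Longrightarrow> f \<odot>\<^bsub>J p\<^esub> w s = \<zero>\<^bsub>J p\<^esub>"
    and wX: "\<And>s. var_product (Suc p) 1 \<odot>\<^bsub>J p\<^esub> w (Suc s) = w s"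
    using fraction_system_denominators[OF p h] by blast
  note X = var_product_closed[OF pn] and Y = next_var_closed[OF p] and X' = var_product_closed[OF p]
  note h_iterate = var_product_iterate[OF pn module_J, of h, OF h'(2,4)]
  note w_iterate = var_product_iterate[OF p module_J, of w, OF wc wX]
  have wT: "w s \<in> torsion p p" for s
    by (rule torsionI[of _ _ _ s]) (auto simp: wc wK)
  have dw: "r \<odot>\<^bsub>J (Suc p)\<^esub> d p (w s) = d p (r \<odot>\<^bsub>J p\<^esub> w s)" if "r \<in> carrier R" for r s
    using d.f_smult[OF that wc] by simp
  interpret T: submodule R "torsion p p" "J p" by (rule submodule_torsion)
  show thesis
  proof (rule that[of "\<lambda>s. d p (w s)"], unfold fraction_system_def, intro conjI allI ballI impI)
    show "d p (w s) \<in> cocycles (Suc p)" for s using wc by (simp add: cocycles_Suc)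
    show "var_product (Suc p) 1 \<odot>\<^bsub>J (Suc p)\<^esub> d p (w (Suc s)) = d p (w s)" for s
      by (simp only: dw[OF X'] wX)
  next
    fix s f assume "f \<in> monomial_ideal (Suc p) s"
    then obtain g f' where g: "g \<in> carrier R" and f': "f' \<in> monomial_ideal p s"
      and f: "f = next_var p s \<otimes> g \<oplus> f'"
      using monomial_ideal_Suc_split p by metis
    note f'c = monomial_ideal_closed[OF f']
    have "f = g \<otimes> next_var p s \<oplus> f'" using f g Y by (simp add: m_comm)
    then have "f \<odot>\<^bsub>J p\<^esub> w s = g \<odot>\<^bsub>J p\<^esub> h s"
      using g f' f'c Y wc wK wh h'(2) by (simp add: J.smult_l_distr J.smult_assoc1)
    then have "f \<odot>\<^bsub>J (Suc p)\<^esub> d p (w s) = g \<odot>\<^bsub>J (Suc p)\<^esub> d p (h s)"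
      using dw[of f s] f g f'c Y d.f_smult[OF g h'(2)] by simp
    then show "f \<odot>\<^bsub>J (Suc p)\<^esub> d p (w s) = \<zero>\<^bsub>J (Suc p)\<^esub>"
      using h'(1)[of s] g by (simp add: cocycles_iff)
  next
    fix z assume z: "z \<in> cocycles (Suc p) \<inter> torsion (Suc p) (Suc p)"
    then have zT: "z \<in> torsion p (Suc p)" and "\<exists>t. next_var p t \<odot>\<^bsub>J (Suc p)\<^esub> z = \<zero>\<^bsub>J (Suc p)\<^esub>"
      using torsion_Suc[OF p] by auto
    then obtain t where t: "next_var p t \<odot>\<^bsub>J (Suc p)\<^esub> z = \<zero>\<^bsub>J (Suc p)\<^esub>" by blast
    have "z \<in> coboundaries p (Suc p)"
      by (rule torsion_cocycles_vanish) (use pn z zT in auto)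
    then obtain y where y: "z = d p y" "y \<in> torsion p p" by auto
    note yc = torsion_closed[OF y(2)]
    have "next_var p t \<odot>\<^bsub>J p\<^esub> y \<in> cocycles p"
      using t y(1) yc d.f_smult[OF Y yc, of t] Y by (simp add: cocycles_iff)
    then obtain r s b where r: "r \<in> carrier R" and b: "b \<in> coboundaries p p"
      and ty: "next_var p t \<odot>\<^bsub>J p\<^esub> y = r \<odot>\<^bsub>J p\<^esub> h s \<oplus>\<^bsub>J p\<^esub> b"
      using h'(5) T.smult_closed[OF Y y(2)] by blast
    \<comment> \<open>Divide the equation for \<open>y\<close> by \<open>X\<^bsub>p+1\<^esub>\<^sup>t\<close>: this is possible for the coboundary, and for \<open>h s\<close> after
      passing to \<open>w (s + t)\<close>. The remainder \<open>?e\<close> is killed by \<open>X\<^bsub>p+1\<^esub>\<^sup>t\<close>.\<close>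
    obtain b' where b': "b' \<in> coboundaries p p" "next_var p t \<odot>\<^bsub>J p\<^esub> b' = b"
      using coboundaries_divisible[OF p b] by blast
    have b'T: "b' \<in> torsion p p" and b'Z: "b' \<in> cocycles p"
      using b'(1) coboundaries_subset_torsion coboundaries_subset_cocycles by blast+
    note b'c = torsion_closed[OF b'T]
    let ?c = "r \<otimes> var_product p t \<otimes> next_var p s"
    have c: "?c \<in> carrier R" using r X Y by simp
    let ?e = "(y \<ominus>\<^bsub>J p\<^esub> b') \<ominus>\<^bsub>J p\<^esub> ?c \<odot>\<^bsub>J p\<^esub> w (s + t)"
    have "r \<odot>\<^bsub>J p\<^esub> h s = next_var p t \<odot>\<^bsub>J p\<^esub> (?c \<odot>\<^bsub>J p\<^esub> w (s + t))"
    proof -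
      have "r \<odot>\<^bsub>J p\<^esub> h s = r \<odot>\<^bsub>J p\<^esub> (var_product p t \<odot>\<^bsub>J p\<^esub> (next_var p (s + t) \<odot>\<^bsub>J p\<^esub> w (s + t)))"
        by (simp only: wh h_iterate)
      also have "\<dots> = (r \<otimes> (var_product p t \<otimes> next_var p (s + t))) \<odot>\<^bsub>J p\<^esub> w (s + t)"
        using r X Y wc by (simp add: J.smult_assoc1)
      also have "r \<otimes> (var_product p t \<otimes> next_var p (s + t)) = next_var p t \<otimes> ?c"
        using r X Y by (simp add: next_var_add m_ac)
      finally show ?thesis using c Y wc by (simp only: J.smult_assoc1)
    qed
    then have ty': "next_var p t \<odot>\<^bsub>J p\<^esub> y
        = next_var p t \<odot>\<^bsub>J p\<^esub> (?c \<odot>\<^bsub>J p\<^esub> w (s + t)) \<oplus>\<^bsub>J p\<^esub> next_var p t \<odot>\<^bsub>J p\<^esub> b'"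
      using ty b'(2) by simp
    have "next_var p t \<odot>\<^bsub>J p\<^esub> ?e
        = next_var p t \<odot>\<^bsub>J p\<^esub> y \<ominus>\<^bsub>J p\<^esub> next_var p t \<odot>\<^bsub>J p\<^esub> b' \<ominus>\<^bsub>J p\<^esub> next_var p t \<odot>\<^bsub>J p\<^esub> (?c \<odot>\<^bsub>J p\<^esub> w (s + t))"
      using Y yc b'c c wc by (simp add: J.smult_minus_right)
    also have "\<dots> = \<zero>\<^bsub>J p\<^esub>"
      unfolding ty' using Y b'c c wc by (simp add: a_minus_def J.M.a_assoc J.M.r_neg)
    finally have Ye: "next_var p t \<odot>\<^bsub>J p\<^esub> ?e = \<zero>\<^bsub>J p\<^esub>" .
    have "?e \<in> torsion p p"
      by (intro submodule_minus[OF submodule_torsion] y(2) b'T T.smult_closed[OF c wT])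
    then have eT: "?e \<in> torsion (Suc p) p"
      unfolding torsion_Suc[OF p] using Ye by blast
    note ec = torsion_closed[OF eT]
    have "d p ?e = z \<ominus>\<^bsub>J (Suc p)\<^esub> ?c \<odot>\<^bsub>J (Suc p)\<^esub> d p (w (s + t))"
      using yc b'c c wc b'Z y(1) d.f_im[OF yc] by (simp add: cocycles_iff a_minus_def)
    then have "z = ?c \<odot>\<^bsub>J (Suc p)\<^esub> d p (w (s + t)) \<oplus>\<^bsub>J (Suc p)\<^esub> d p ?e"
      using c wc y(1) d.f_im[OF yc] d.f_im[OF wc] by (simp add: a_minus_def J.M.a_lcomm J.M.r_neg)
    then show "\<exists>r\<in>carrier R. \<exists>s. \<exists>b\<in>coboundaries (Suc p) (Suc p). z = r \<odot>\<^bsub>J (Suc p)\<^esub> d p (w s) \<oplus>\<^bsub>J (Suc p)\<^esub> b"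
      using c eT by (intro bexI[of _ ?c] exI[of _ "s + t"] bexI[of _ "d p ?e"]) auto
  next
    fix s r assume r: "r \<in> carrier R" and "r \<odot>\<^bsub>J (Suc p)\<^esub> d p (w s) \<in> coboundaries (Suc p) (Suc p)"
    then have "d p (r \<odot>\<^bsub>J p\<^esub> w s) \<in> d p ` torsion (Suc p) p" using dw[OF r, of s] by simp
    then obtain e where e: "e \<in> torsion (Suc p) p" "d p (r \<odot>\<^bsub>J p\<^esub> w s) = d p e" by auto
    then obtain T where eT: "e \<in> torsion p p" and T: "next_var p T \<odot>\<^bsub>J p\<^esub> e = \<zero>\<^bsub>J p\<^esub>"
      using torsion_Suc[OF p] by blast
    note ec = torsion_closed[OF eT]
    have "r \<odot>\<^bsub>J p\<^esub> w s \<ominus>\<^bsub>J p\<^esub> e \<in> cocycles p"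
      using e(2) ec r wc d.f_im[OF ec] by (simp add: cocycles_iff)
    moreover have "r \<odot>\<^bsub>J p\<^esub> w s \<ominus>\<^bsub>J p\<^esub> e \<in> torsion p p"
      by (rule submodule_minus[OF submodule_torsion T.smult_closed[OF r wT] eT])
    ultimately obtain r' s' b where r': "r' \<in> carrier R" and b: "b \<in> coboundaries p p"
      and eq: "r \<odot>\<^bsub>J p\<^esub> w s \<ominus>\<^bsub>J p\<^esub> e = r' \<odot>\<^bsub>J p\<^esub> h s' \<oplus>\<^bsub>J p\<^esub> b"
      using h'(5) by blast
    \<comment> \<open>Write everything as a multiple of the single element \<open>w (s + s')\<close>; a high power of the next variable
      kills \<open>e\<close> and turns that element into a multiple of \<open>h (s + s')\<close>, whose annihilator is known.\<close>
    let ?S = "s + s'"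
    note bc = torsion_closed[OF subsetD[OF coboundaries_subset_torsion b]]
    define u where "u = r \<otimes> var_product (Suc p) s'"
    define v where "v = r' \<otimes> var_product p s \<otimes> next_var p ?S"
    have uv: "u \<in> carrier R" "v \<in> carrier R" using r r' X X' Y by (simp_all add: u_def v_def)
    have "r \<odot>\<^bsub>J p\<^esub> w s = u \<odot>\<^bsub>J p\<^esub> w ?S"
      using w_iterate[of s' s] r X' wc by (simp add: u_def J.smult_assoc1)
    moreover have "r' \<odot>\<^bsub>J p\<^esub> h s' = v \<odot>\<^bsub>J p\<^esub> w ?S"
    proof -
      have "r' \<odot>\<^bsub>J p\<^esub> h s' = r' \<odot>\<^bsub>J p\<^esub> (var_product p s \<odot>\<^bsub>J p\<^esub> (next_var p ?S \<odot>\<^bsub>J p\<^esub> w ?S))"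
        using h_iterate[of s s'] by (simp only: wh add.commute[of s' s])
      then show ?thesis using r' X Y wc by (simp add: v_def J.smult_assoc1)
    qed
    ultimately have "(u \<ominus> v) \<odot>\<^bsub>J p\<^esub> w ?S = e \<oplus>\<^bsub>J p\<^esub> b"
      using eq uv wc ec bc J.M.minus_eq_add_swap[of "u \<odot>\<^bsub>J p\<^esub> w ?S" p e "v \<odot>\<^bsub>J p\<^esub> w ?S" b]
      by (simp add: J.smult_minus_left)
    then have "next_var p (T + ?S) \<odot>\<^bsub>J p\<^esub> ((u \<ominus> v) \<odot>\<^bsub>J p\<^esub> w ?S) = next_var p (T + ?S) \<odot>\<^bsub>J p\<^esub> (e \<oplus>\<^bsub>J p\<^esub> b)"
      by simp
    moreover have "next_var p (T + ?S) \<odot>\<^bsub>J p\<^esub> e = \<zero>\<^bsub>J p\<^esub>"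
    proof -
      have "next_var p (T + ?S) = next_var p ?S \<otimes> next_var p T" by (metis next_var_add add.commute)
      then show ?thesis using Y ec T by (simp only: J.smult_assoc1) simp
    qed
    moreover have "next_var p (T + ?S) \<odot>\<^bsub>J p\<^esub> ((u \<ominus> v) \<odot>\<^bsub>J p\<^esub> w ?S)
        = (next_var p T \<otimes> (u \<ominus> v)) \<odot>\<^bsub>J p\<^esub> h ?S"
    proof -
      have "next_var p (T + ?S) \<otimes> (u \<ominus> v) = next_var p T \<otimes> (u \<ominus> v) \<otimes> next_var p ?S"
        unfolding next_var_add[of p T ?S] using uv Y by (simp add: m_ac)
      then have "next_var p (T + ?S) \<odot>\<^bsub>J p\<^esub> ((u \<ominus> v) \<odot>\<^bsub>J p\<^esub> w ?S)
          = (next_var p T \<otimes> (u \<ominus> v) \<otimes> next_var p ?S) \<odot>\<^bsub>J p\<^esub> w ?S"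
        using uv Y wc by (simp add: J.smult_assoc1[symmetric])
      also have "\<dots> = (next_var p T \<otimes> (u \<ominus> v)) \<odot>\<^bsub>J p\<^esub> h ?S"
        using uv Y wc wh[of ?S] by (simp only: J.smult_assoc1 m_closed minus_closed)
      finally show ?thesis .
    qed
    ultimately have "(next_var p T \<otimes> (u \<ominus> v)) \<odot>\<^bsub>J p\<^esub> h ?S = next_var p (T + ?S) \<odot>\<^bsub>J p\<^esub> b"
      using Y ec bc by (simp add: J.smult_r_distr)
    moreover have "next_var p (T + ?S) \<odot>\<^bsub>J p\<^esub> b \<in> coboundaries p p"
      using submodule.smult_closed[OF submodule_coboundaries Y b] .
    ultimately have cobounds: "(next_var p T \<otimes> (u \<ominus> v)) \<odot>\<^bsub>J p\<^esub> h ?S \<in> coboundaries p p"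
      by (simp only:)
    have uvc: "u \<ominus> v \<in> carrier R" using uv by (rule minus_closed)
    have "next_var p T \<otimes> (u \<ominus> v) \<in> monomial_ideal p ?S"
      by (rule h'(6)[OF m_closed[OF Y uvc] cobounds])
    then have "u \<ominus> v \<in> monomial_ideal p ?S" by (rule monomial_ideal_cancel_next[OF uvc])
    then have "u \<ominus> v \<in> monomial_ideal (Suc p) ?S" by (rule subsetD[OF monomial_ideal_mono])
    moreover have "v \<in> monomial_ideal (Suc p) ?S"
      unfolding v_def by (rule monomial_ideal_mult) (use r' X next_var_in_monomial_ideal[OF p] in auto)
    ultimately have "u \<ominus> v \<oplus> v \<in> monomial_ideal (Suc p) ?S" by (rule monomial_ideal_add)
    then have "var_product (Suc p) s' \<otimes> r \<in> monomial_ideal (Suc p) ?S"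
      using uv r X' by (simp add: minus_eq a_assoc l_neg u_def m_comm)
    then show "r \<in> monomial_ideal (Suc p) s" by (rule monomial_ideal_cancel_var_product[OF r])
  qed
qed

lemma fraction_system_exists: "p \<le> n \<Longrightarrow> \<exists>h. fraction_system p h"
proof (induction p)
  case 0
  show ?case using fraction_system_0 by blast
next
  case (Suc p)
  then obtain h where "fraction_system p h" by auto
  then show ?case using fraction_system_Suc[OF Suc.prems] by metis
qed

end


section \<open>Quotient modules and modules of homomorphisms\<close>

lemma submodule_imp_abelian_subgroup:
  assumes "submodule R N M"
  shows "abelian_subgroup N M"
proof -
  interpret N: submodule R N M by (rule assms)
  interpret M: module R M by (rule N.module)
  show ?thesis
  proof (rule abelian_subgroupI3, rule additive_subgroupI)
    show "subgroup N (add_monoid M)"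
    proof (rule M.add.subgroupI)
      fix x assume x: "x \<in> N"
      then have "\<ominus>\<^bsub>M\<^esub> x = (\<ominus>\<^bsub>R\<^esub> \<one>\<^bsub>R\<^esub>) \<odot>\<^bsub>M\<^esub> x" using N.subset M.smult_minus_1 by auto
      then show "\<ominus>\<^bsub>M\<^esub> x \<in> N" using x by simp
    next
      show "N \<noteq> {}" using N.zero_closed by blast
    qed (use N.subset in auto)
  qed (rule M.M.abelian_group_axioms)
qed

lemma quot_module_facts:
  assumes N: "submodule R N M"
  shows carrier_quot_module: "carrier (quot_module R M N) = (\<lambda>x. N +>\<^bsub>M\<^esub> x) ` carrier M"
    and zero_quot_module: "\<zero>\<^bsub>quot_module R M N\<^esub> = N"
    and add_quot_module: "x \<in> carrier M \<Longrightarrow> y \<in> carrier M \<Longrightarrow>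
      (N +>\<^bsub>M\<^esub> x) \<oplus>\<^bsub>quot_module R M N\<^esub> (N +>\<^bsub>M\<^esub> y) = N +>\<^bsub>M\<^esub> (x \<oplus>\<^bsub>M\<^esub> y)"
    and smult_quot_module: "r \<in> carrier R \<Longrightarrow> x \<in> carrier M \<Longrightarrow>
      r \<odot>\<^bsub>quot_module R M N\<^esub> (N +>\<^bsub>M\<^esub> x) = N +>\<^bsub>M\<^esub> (r \<odot>\<^bsub>M\<^esub> x)"
    and coset_eq_zero_iff: "x \<in> carrier M \<Longrightarrow> N +>\<^bsub>M\<^esub> x = N \<longleftrightarrow> x \<in> N"
proof -
  interpret N: submodule R N M by (rule N)
  interpret M: module R M by (rule N.module)
  interpret A: abelian_subgroup N M by (rule submodule_imp_abelian_subgroup[OF N])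
  show "carrier (quot_module R M N) = (\<lambda>x. N +>\<^bsub>M\<^esub> x) ` carrier M"
    by (auto simp: quot_module_def A_RCOSETS_def')
  show "\<zero>\<^bsub>quot_module R M N\<^esub> = N" by (simp add: quot_module_def)
  show "(N +>\<^bsub>M\<^esub> x) \<oplus>\<^bsub>quot_module R M N\<^esub> (N +>\<^bsub>M\<^esub> y) = N +>\<^bsub>M\<^esub> (x \<oplus>\<^bsub>M\<^esub> y)"
    if "x \<in> carrier M" "y \<in> carrier M"
    using A.a_rcos_sum[OF that] by (simp add: quot_module_def)
  have eq_iff: "N +>\<^bsub>M\<^esub> x = N +>\<^bsub>M\<^esub> y \<longleftrightarrow> x \<ominus>\<^bsub>M\<^esub> y \<in> N" if "x \<in> carrier M" "y \<in> carrier M" for x y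
    using A.a_rcos_module[OF that(2,1)] A.a_repr_independence'[of x y] A.a_repr_independenceD[of x y] that
    by (auto simp: a_minus_def)
  have minus_zero: "\<ominus>\<^bsub>M\<^esub> \<zero>\<^bsub>M\<^esub> = \<zero>\<^bsub>M\<^esub>" by (rule M.M.minus_equality) simp_all
  have coset_zero: "N +>\<^bsub>M\<^esub> \<zero>\<^bsub>M\<^esub> = N"
    by (rule M.a_coset_join2[OF M.M.zero_closed A.a_subgroup N.zero_closed])
  show "N +>\<^bsub>M\<^esub> x = N \<longleftrightarrow> x \<in> N" if x: "x \<in> carrier M"
  proof -
    have "x \<ominus>\<^bsub>M\<^esub> \<zero>\<^bsub>M\<^esub> = x" unfolding a_minus_def minus_zero by (rule M.M.r_zero[OF x])
    then show ?thesis using eq_iff[OF x M.M.zero_closed] unfolding coset_zero by simp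
  qed
  show "r \<odot>\<^bsub>quot_module R M N\<^esub> (N +>\<^bsub>M\<^esub> x) = N +>\<^bsub>M\<^esub> (r \<odot>\<^bsub>M\<^esub> x)"
    if r: "r \<in> carrier R" and x: "x \<in> carrier M"
  proof -
    have "N +>\<^bsub>M\<^esub> (r \<odot>\<^bsub>M\<^esub> y) = N +>\<^bsub>M\<^esub> (r \<odot>\<^bsub>M\<^esub> x)" if y: "y \<in> N +>\<^bsub>M\<^esub> x" for y
    proof -
      have yc: "y \<in> carrier M" using y A.a_elemrcos_carrier x by blast
      have "y \<ominus>\<^bsub>M\<^esub> x \<in> N" using A.a_rcos_module_imp[OF x y] by (simp add: a_minus_def)
      then have "r \<odot>\<^bsub>M\<^esub> y \<ominus>\<^bsub>M\<^esub> r \<odot>\<^bsub>M\<^esub> x \<in> N"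
        using N.smult_closed[OF r] r x yc by (simp add: M.smult_minus_right[symmetric])
      then show ?thesis using eq_iff r x yc by simp
    qed
    moreover have "x \<in> N +>\<^bsub>M\<^esub> x" using x by (rule A.a_rcos_self)
    ultimately have "(\<Union>y\<in>N +>\<^bsub>M\<^esub> x. N +>\<^bsub>M\<^esub> (r \<odot>\<^bsub>M\<^esub> y)) = N +>\<^bsub>M\<^esub> (r \<odot>\<^bsub>M\<^esub> x)" by blast
    then show ?thesis by (simp add: quot_module_def)
  qed
qed

lemma module_quot_module:
  assumes N: "submodule R N M"
  shows "module R (quot_module R M N)"
proof -
  interpret N: submodule R N M by (rule N)
  interpret M: module R M by (rule N.module)
  note facts = carrier_quot_module[OF N] zero_quot_module[OF N] add_quot_module[OF N] smult_quot_module[OF N]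
  have zero: "N = N +>\<^bsub>M\<^esub> \<zero>\<^bsub>M\<^esub>" using coset_eq_zero_iff[OF N M.zero_closed] by simp
  show ?thesis
  proof (rule module_criteria)
    show "cring R" by (rule M.is_cring)
    show "\<forall>v\<in>carrier (quot_module R M N). \<exists>w\<in>carrier (quot_module R M N).
      v \<oplus>\<^bsub>quot_module R M N\<^esub> w = \<zero>\<^bsub>quot_module R M N\<^esub>"
    proof
      fix v assume "v \<in> carrier (quot_module R M N)"
      then obtain x where x: "v = N +>\<^bsub>M\<^esub> x" "x \<in> carrier M" by (auto simp: facts(1))
      show "\<exists>w\<in>carrier (quot_module R M N). v \<oplus>\<^bsub>quot_module R M N\<^esub> w = \<zero>\<^bsub>quot_module R M N\<^esub>"
        using x by (intro bexI[of _ "N +>\<^bsub>M\<^esub> (\<ominus>\<^bsub>M\<^esub> x)"]) (auto simp: facts M.r_neg zero[symmetric])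
    qed
    show "\<zero>\<^bsub>quot_module R M N\<^esub> \<in> carrier (quot_module R M N)"
      using zero by (auto simp: facts)
    show "\<forall>v\<in>carrier (quot_module R M N). v \<oplus>\<^bsub>quot_module R M N\<^esub> \<zero>\<^bsub>quot_module R M N\<^esub> = v"
      using facts(3)[of _ "\<zero>\<^bsub>M\<^esub>"] zero by (auto simp: facts(1,2))
  qed (auto simp: facts M.a_ac M.smult_l_distr M.smult_r_distr M.smult_assoc1)
qed

lemma module_Hom_module:
  assumes M: "module R M" and N: "module R N"
  shows "module R (Hom_module R M N)"
proof -
  interpret M: module R M by (rule M)
  interpret N: module R N by (rule N)
  have cl: "f x \<in> carrier N" if "f \<in> module_hom R M N" "x \<in> carrier M" for f x
    using that module_hom_closed by blast
  have ext: "f = g" if "f \<in> extensional (carrier M)" "g \<in> extensional (carrier M)" "\<And>x. x \<in> carrier M \<Longrightarrow> f x = g x"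
    for f g
    using that by (rule extensionalityI)
  show ?thesis
  proof (rule module_criteria)
    show "cring R" by (rule M.is_cring)
    show "\<zero>\<^bsub>Hom_module R M N\<^esub> \<in> carrier (Hom_module R M N)"
      by (simp add: Hom_module_def module_hom_def)
    show "\<forall>v w. v \<in> carrier (Hom_module R M N) \<and> w \<in> carrier (Hom_module R M N) \<longrightarrow>
        v \<oplus>\<^bsub>Hom_module R M N\<^esub> w \<in> carrier (Hom_module R M N)"
      by (auto simp: Hom_module_def module_hom_def Pi_iff N.a_ac N.smult_r_distr)
    show "\<forall>c v. c \<in> carrier R \<and> v \<in> carrier (Hom_module R M N) \<longrightarrow>
        c \<odot>\<^bsub>Hom_module R M N\<^esub> v \<in> carrier (Hom_module R M N)"
      by (auto simp: Hom_module_def module_hom_def Pi_iff N.smult_r_distr N.smult_assoc1[symmetric] M.R.m_comm)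
    show "\<forall>v\<in>carrier (Hom_module R M N). \<exists>w\<in>carrier (Hom_module R M N).
        v \<oplus>\<^bsub>Hom_module R M N\<^esub> w = \<zero>\<^bsub>Hom_module R M N\<^esub>"
    proof
      fix f assume f: "f \<in> carrier (Hom_module R M N)"
      let ?g = "\<lambda>x\<in>carrier M. \<ominus>\<^bsub>N\<^esub> f x"
      have "?g \<in> carrier (Hom_module R M N)"
        using f by (auto simp: Hom_module_def module_hom_def Pi_iff N.minus_add N.smult_r_minus)
      moreover have "f \<oplus>\<^bsub>Hom_module R M N\<^esub> ?g = \<zero>\<^bsub>Hom_module R M N\<^esub>"
        using f cl by (auto simp: Hom_module_def N.r_neg intro!: ext)
      ultimately show "\<exists>w\<in>carrier (Hom_module R M N). f \<oplus>\<^bsub>Hom_module R M N\<^esub> w = \<zero>\<^bsub>Hom_module R M N\<^esub>"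
        by blast
    qed
  qed (auto simp: Hom_module_def cl N.a_ac N.smult_l_distr N.smult_r_distr N.smult_assoc1 intro!: ext)
qed

lemma finsum_Hom_module_apply:
  assumes M: "module R M" and N: "module R N" and F: "finite F"
    and f: "\<And>l. l \<in> F \<Longrightarrow> f l \<in> carrier (Hom_module R M N)" and x: "x \<in> carrier M"
  shows "(\<Oplus>\<^bsub>Hom_module R M N\<^esub>l\<in>F. f l) x = (\<Oplus>\<^bsub>N\<^esub>l\<in>F. f l x)"
proof -
  interpret N: module R N by (rule N)
  interpret H: module R "Hom_module R M N" by (rule module_Hom_module[OF M N])
  have cl: "g \<in> carrier (Hom_module R M N) \<Longrightarrow> g x \<in> carrier N" for g
    using x by (auto simp: Hom_module_def dest: module_hom_closed)
  show ?thesis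
    using F f
  proof (induction F rule: finite_induct)
    case empty
    have "\<zero>\<^bsub>Hom_module R M N\<^esub> x = \<zero>\<^bsub>N\<^esub>" using x by (simp add: Hom_module_def)
    then show ?case by simp
  next
    case (insert l F)
    have "(\<Oplus>\<^bsub>Hom_module R M N\<^esub>l\<in>insert l F. f l) x
        = (f l \<oplus>\<^bsub>Hom_module R M N\<^esub> (\<Oplus>\<^bsub>Hom_module R M N\<^esub>l\<in>F. f l)) x"
      using insert by (subst H.finsum_insert) auto
    also have "\<dots> = f l x \<oplus>\<^bsub>N\<^esub> (\<Oplus>\<^bsub>Hom_module R M N\<^esub>l\<in>F. f l) x"
      using x by (simp add: Hom_module_def)
    also have "\<dots> = (\<Oplus>\<^bsub>N\<^esub>l\<in>insert l F. f l x)"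
      using insert cl by (subst N.finsum_insert) auto
    finally show ?case .
  qed
qed

text \<open>
  A homomorphism out of a direct limit \<open>R/(X\<^sub>1, \<dots>, X\<^sub>p) \<rightarrow> R/(X\<^sub>1\<^sup>2, \<dots>, X\<^sub>p\<^sup>2) \<rightarrow> \<dots>\<close> is a compatible
  sequence of elements of the target.
\<close>

lemma (in power_series) hom_from_fractions:
  assumes p: "p \<le> n" and H: "module R H" and E: "module R E"
    and h: "\<And>s. h s \<in> carrier H" "\<And>s. var_product p 1 \<odot>\<^bsub>H\<^esub> h (Suc s) = h s"
    and e: "\<And>s. e s \<in> carrier E" "\<And>s. var_product p 1 \<odot>\<^bsub>E\<^esub> e (Suc s) = e s"
    and generates: "\<And>x. x \<in> carrier H \<Longrightarrow> \<exists>r\<in>carrier R. \<exists>s. x = r \<odot>\<^bsub>H\<^esub> h s"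
    and annihilator: "\<And>r s. r \<in> carrier R \<Longrightarrow> r \<odot>\<^bsub>H\<^esub> h s = \<zero>\<^bsub>H\<^esub> \<Longrightarrow> r \<odot>\<^bsub>E\<^esub> e s = \<zero>\<^bsub>E\<^esub>"
  obtains \<delta> where "\<delta> \<in> carrier (Hom_module R H E)" "\<And>s. \<delta> (h s) = e s"
proof -
  interpret H: module R H by (rule H)
  interpret E: module R E by (rule E)
  note X = var_product_closed[OF p]
  have h_lift: "r \<odot>\<^bsub>H\<^esub> h s = (r \<otimes> var_product p t) \<odot>\<^bsub>H\<^esub> h (s + t)" if "r \<in> carrier R" for r s t
    using that X h(1) by (simp add: H.smult_assoc1 var_product_iterate[OF p H, of h, OF h])
  have e_lift: "r \<odot>\<^bsub>E\<^esub> e s = (r \<otimes> var_product p t) \<odot>\<^bsub>E\<^esub> e (s + t)" if "r \<in> carrier R" for r s t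
    using that X e(1) by (simp add: E.smult_assoc1 var_product_iterate[OF p E, of e, OF e])
  have well_defined: "r \<odot>\<^bsub>E\<^esub> e s = r' \<odot>\<^bsub>E\<^esub> e s'"
    if r: "r \<in> carrier R" "r' \<in> carrier R" and eq: "r \<odot>\<^bsub>H\<^esub> h s = r' \<odot>\<^bsub>H\<^esub> h s'" for r r' s s'
  proof -
    let ?a = "r \<otimes> var_product p s'" and ?b = "r' \<otimes> var_product p s"
    have ab: "?a \<in> carrier R" "?b \<in> carrier R" using r X by auto
    have "?a \<odot>\<^bsub>H\<^esub> h (s + s') = r \<odot>\<^bsub>H\<^esub> h s" by (rule h_lift[OF r(1), symmetric])
    also have "\<dots> = ?b \<odot>\<^bsub>H\<^esub> h (s' + s)" unfolding eq by (rule h_lift[OF r(2)])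
    also have "\<dots> = ?b \<odot>\<^bsub>H\<^esub> h (s + s')" by (simp only: add.commute)
    finally have "(?a \<ominus> ?b) \<odot>\<^bsub>H\<^esub> h (s + s') = \<zero>\<^bsub>H\<^esub>"
      using ab h(1) by (simp add: H.smult_minus_left)
    then have "(?a \<ominus> ?b) \<odot>\<^bsub>E\<^esub> e (s + s') = \<zero>\<^bsub>E\<^esub>"
      by (rule annihilator[OF minus_closed[OF ab]])
    then have ab_eq: "?a \<odot>\<^bsub>E\<^esub> e (s + s') = ?b \<odot>\<^bsub>E\<^esub> e (s + s')"
      using ab e(1) by (simp add: E.smult_minus_left)
    have "r \<odot>\<^bsub>E\<^esub> e s = ?a \<odot>\<^bsub>E\<^esub> e (s + s')" by (rule e_lift[OF r(1)])
    also have "\<dots> = ?b \<odot>\<^bsub>E\<^esub> e (s' + s)" unfolding ab_eq by (simp only: add.commute)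
    also have "\<dots> = r' \<odot>\<^bsub>E\<^esub> e s'" by (rule e_lift[OF r(2), symmetric])
    finally show ?thesis .
  qed
  define \<delta> where "\<delta> = (\<lambda>x\<in>carrier H. SOME y. \<exists>r\<in>carrier R. \<exists>s. x = r \<odot>\<^bsub>H\<^esub> h s \<and> y = r \<odot>\<^bsub>E\<^esub> e s)"
  have \<delta>: "\<delta> (r \<odot>\<^bsub>H\<^esub> h s) = r \<odot>\<^bsub>E\<^esub> e s" if r: "r \<in> carrier R" for r s
  proof -
    have "(SOME y. \<exists>q\<in>carrier R. \<exists>t. r \<odot>\<^bsub>H\<^esub> h s = q \<odot>\<^bsub>H\<^esub> h t \<and> y = q \<odot>\<^bsub>E\<^esub> e t) = r \<odot>\<^bsub>E\<^esub> e s"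
    proof (rule some_equality)
      show "\<exists>q\<in>carrier R. \<exists>t. r \<odot>\<^bsub>H\<^esub> h s = q \<odot>\<^bsub>H\<^esub> h t \<and> r \<odot>\<^bsub>E\<^esub> e s = q \<odot>\<^bsub>E\<^esub> e t"
        using r by blast
      fix y assume "\<exists>q\<in>carrier R. \<exists>t. r \<odot>\<^bsub>H\<^esub> h s = q \<odot>\<^bsub>H\<^esub> h t \<and> y = q \<odot>\<^bsub>E\<^esub> e t"
      then obtain q t where "q \<in> carrier R" "r \<odot>\<^bsub>H\<^esub> h s = q \<odot>\<^bsub>H\<^esub> h t" "y = q \<odot>\<^bsub>E\<^esub> e t" by auto
      then show "y = r \<odot>\<^bsub>E\<^esub> e s" using well_defined[OF r, of q s t] by simp
    qed
    then show ?thesis using r h(1) by (simp add: \<delta>_def)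
  qed
  show thesis
  proof
    show "\<delta> (h s) = e s" for s using \<delta>[OF one_closed, of s] h(1) e(1) by simp
    have "\<delta> \<in> module_hom R H E"
      unfolding module_hom_def
    proof (intro CollectI conjI allI impI)
      show "\<delta> \<in> carrier H \<rightarrow> carrier E"
      proof
        fix x assume "x \<in> carrier H"
        then obtain r s where "r \<in> carrier R" "x = r \<odot>\<^bsub>H\<^esub> h s" using generates by blast
        then show "\<delta> x \<in> carrier E" using \<delta> e(1) by simp
      qed
      fix x y assume "x \<in> carrier H \<and> y \<in> carrier H"
      then obtain r s r' s' where r: "r \<in> carrier R" "x = r \<odot>\<^bsub>H\<^esub> h s" "r' \<in> carrier R" "y = r' \<odot>\<^bsub>H\<^esub> h s'"
        using generates by metis
      let ?a = "r \<otimes> var_product p s'" and ?b = "r' \<otimes> var_product p s"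
      have ab: "?a \<in> carrier R" "?b \<in> carrier R" using r X by auto
      have x: "x = ?a \<odot>\<^bsub>H\<^esub> h (s + s')" unfolding r(2) by (rule h_lift[OF r(1)])
      have y: "y = ?b \<odot>\<^bsub>H\<^esub> h (s + s')"
        unfolding r(4) add.commute[of s] by (rule h_lift[OF r(3)])
      have "x \<oplus>\<^bsub>H\<^esub> y = (?a \<oplus> ?b) \<odot>\<^bsub>H\<^esub> h (s + s')"
        unfolding x y using ab h(1) by (simp only: H.smult_l_distr)
      then show "\<delta> (x \<oplus>\<^bsub>H\<^esub> y) = \<delta> x \<oplus>\<^bsub>E\<^esub> \<delta> y"
        unfolding x y using ab e(1) by (simp only: \<delta> a_closed E.smult_l_distr)
    next
      fix r x assume rx: "r \<in> carrier R \<and> x \<in> carrier H"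
      then obtain q s where q: "q \<in> carrier R" "x = q \<odot>\<^bsub>H\<^esub> h s" using generates by blast
      then have "r \<odot>\<^bsub>H\<^esub> x = (r \<otimes> q) \<odot>\<^bsub>H\<^esub> h s" using rx h(1) by (simp add: H.smult_assoc1)
      then show "\<delta> (r \<odot>\<^bsub>H\<^esub> x) = r \<odot>\<^bsub>E\<^esub> \<delta> x" using q rx e(1) by (simp add: \<delta> E.smult_assoc1)
    qed
    then show "\<delta> \<in> carrier (Hom_module R H E)" by (simp add: Hom_module_def \<delta>_def)
  qed
qed


section \<open>Torsion with respect to powers of the ideal\<close>

context power_series
begin

text \<open>
  In terms of coefficients, this is the \<open>t\<close>-th power of \<open>(X\<^sub>1, \<dots>, X\<^sub>p)\<close>; below it only serves as
  an upper bound for that power.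
\<close>

definition low_degree_ideal :: "nat \<Rightarrow> nat \<Rightarrow> (nat multiset \<Rightarrow> 'k) set" where
  "low_degree_ideal p t = {f \<in> carrier R. \<forall>m. (\<Sum>j\<in>{1..p}. count m j) < t \<longrightarrow> f m = 0}"

lemma low_degree_ideal_mult:
  assumes f: "f \<in> low_degree_ideal p a" and g: "g \<in> low_degree_ideal p b"
  shows "f \<otimes> g \<in> low_degree_ideal p (a + b)"
proof -
  have "f c * g (m - c) = 0" if c: "c \<subseteq># m" and m: "(\<Sum>j\<in>{1..p}. count m j) < a + b" for m c
  proof -
    have "(\<Sum>j\<in>{1..p}. count c j) + (\<Sum>j\<in>{1..p}. count (m - c) j) = (\<Sum>j\<in>{1..p}. count m j)"
      unfolding sum.distrib[symmetric]
      by (rule sum.cong) (use c in \<open>auto simp: mset_subset_eq_count\<close>)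
    then have "(\<Sum>j\<in>{1..p}. count c j) < a \<or> (\<Sum>j\<in>{1..p}. count (m - c) j) < b" using m by linarith
    then show ?thesis using f g by (auto simp: low_degree_ideal_def)
  qed
  then have "(f \<otimes> g) m = 0" if "(\<Sum>j\<in>{1..p}. count m j) < a + b" for m
    unfolding coeff_mult using that by (intro sum.neutral) blast
  then show ?thesis using f g by (simp add: low_degree_ideal_def)
qed

lemma ideal_low_degree_ideal: "ideal (low_degree_ideal p t) R"
proof (rule idealI)
  show "subgroup (low_degree_ideal p t) (add_monoid R)"
  proof (rule add.subgroupI)
    have "\<zero> \<in> low_degree_ideal p t" by (simp add: low_degree_ideal_def coeff_zero)
    then show "low_degree_ideal p t \<noteq> {}" by blast
  qed (auto simp: low_degree_ideal_def coeff_add coeff_minus)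
  fix f r assume f: "f \<in> low_degree_ideal p t" and r: "r \<in> carrier R"
  then have "r \<otimes> f \<in> low_degree_ideal p (0 + t)"
    by (intro low_degree_ideal_mult) (auto simp: low_degree_ideal_def)
  then show "r \<otimes> f \<in> low_degree_ideal p t" by simp
  then show "f \<otimes> r \<in> low_degree_ideal p t"
    using f r by (simp add: m_comm low_degree_ideal_def)
qed (rule ring_axioms)

text \<open>
  Being killed by a power of \<open>(X\<^sub>1, \<dots>, X\<^sub>p)\<close> is the same as being killed by powers of the
  generators: the two filtrations of the ring by these ideals are cofinal.
\<close>

lemma ideal_power_torsion_iff:
  assumes p: "p \<le> n" and I: "I = Idl (mps_var ` {1..p})" and M: "module R M" and x: "x \<in> carrier M"
  shows "(\<exists>t::nat. \<forall>a \<in> I [^]\<^bsub>ideals_set R\<^esub> t. a \<odot>\<^bsub>M\<^esub> x = \<zero>\<^bsub>M\<^esub>)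
     \<longleftrightarrow> (\<exists>s. \<forall>f\<in>monomial_ideal p s. f \<odot>\<^bsub>M\<^esub> x = \<zero>\<^bsub>M\<^esub>)"
proof
  have power_Suc: "I [^]\<^bsub>ideals_set R\<^esub> Suc t = ideal_prod R (I [^]\<^bsub>ideals_set R\<^esub> t) I" for t
    by (simp add: nat_pow_def ideals_set_def)
  have power_0: "I [^]\<^bsub>ideals_set R\<^esub> (0::nat) = carrier R"
    by (simp add: nat_pow_def ideals_set_def)
  {
    assume "\<exists>t::nat. \<forall>a \<in> I [^]\<^bsub>ideals_set R\<^esub> t. a \<odot>\<^bsub>M\<^esub> x = \<zero>\<^bsub>M\<^esub>"
    then obtain t :: nat where t: "\<forall>a \<in> I [^]\<^bsub>ideals_set R\<^esub> t. a \<odot>\<^bsub>M\<^esub> x = \<zero>\<^bsub>M\<^esub>" by blast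
    have var: "monomial {#j#} \<in> I" if "j \<in> {1..p}" for j
    proof -
      have "mps_var ` {1..p} \<subseteq> carrier R" using p by (auto simp: mps_var_eq_monomial)
      then show ?thesis using genideal_self that unfolding I mps_var_eq_monomial[symmetric] by blast
    qed
    have "monomial (replicate_mset t j) \<in> I [^]\<^bsub>ideals_set R\<^esub> t" if j: "j \<in> {1..p}" for j and t :: nat
    proof (induction t)
      case 0
      then show ?case by (simp only: power_0) auto
    next
      case (Suc t)
      have "monomial (replicate_mset t j) \<otimes> monomial {#j#} \<in> I [^]\<^bsub>ideals_set R\<^esub> Suc t"
        unfolding power_Suc by (rule ideal_prod.prod[OF Suc var[OF j]])
      then show ?case by (simp add: monomial_mult)
    qed
    then show "\<exists>s. \<forall>f\<in>monomial_ideal p s. f \<odot>\<^bsub>M\<^esub> x = \<zero>\<^bsub>M\<^esub>"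
      using monomial_ideal_annihilates[OF M x p, of t] t by blast
  }
  assume "\<exists>s. \<forall>f\<in>monomial_ideal p s. f \<odot>\<^bsub>M\<^esub> x = \<zero>\<^bsub>M\<^esub>"
  then obtain s where s: "\<And>f. f \<in> monomial_ideal p s \<Longrightarrow> f \<odot>\<^bsub>M\<^esub> x = \<zero>\<^bsub>M\<^esub>" by blast
  have I_le: "I \<subseteq> low_degree_ideal p 1"
    unfolding I
  proof (rule genideal_minimal[OF ideal_low_degree_ideal], rule image_subsetI)
    fix j assume j: "j \<in> {1..p}"
    have "(monomial {#j#} :: _ \<Rightarrow> 'k) m = 0" if "(\<Sum>j\<in>{1..p}. count m j) < 1" for m
    proof -
      have "count m j = 0" using that j by (simp add: sum_eq_0_iff)
      then show ?thesis by (auto simp: monomial_def)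
    qed
    then show "mps_var j \<in> low_degree_ideal p 1"
      using j p by (simp add: mps_var_eq_monomial low_degree_ideal_def monomial_closed)
  qed
  have power_le: "I [^]\<^bsub>ideals_set R\<^esub> t \<subseteq> low_degree_ideal p t" for t :: nat
  proof (induction t)
    case 0
    show ?case unfolding power_0 by (auto simp: low_degree_ideal_def)
  next
    case (Suc t)
    show ?case
      unfolding power_Suc
    proof
      fix f assume "f \<in> ideal_prod R (I [^]\<^bsub>ideals_set R\<^esub> t) I"
      then show "f \<in> low_degree_ideal p (Suc t)"
      proof (induction rule: ideal_prod.induct)
        case (prod a b)
        then have "a \<otimes> b \<in> low_degree_ideal p (t + 1)"
          using Suc I_le by (intro low_degree_ideal_mult) blast+
        then show ?case by simp
      next
        case (sum a b)
        show ?case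
          by (rule additive_subgroup.a_closed[OF ideal.axioms(1)[OF ideal_low_degree_ideal] sum.IH])
      qed
    qed
  qed
  have "low_degree_ideal p (p * s + 1) \<subseteq> monomial_ideal p s"
  proof
    fix f assume f: "f \<in> low_degree_ideal p (p * s + 1)"
    have "(\<Sum>j\<in>{1..p}. count m j) < p * s + 1" if "\<forall>j\<in>{1..p}. count m j < s" for m
      using sum_bounded_above[of "{1..p}" "count m" s] that by (simp add: less_imp_le)
    then show "f \<in> monomial_ideal p s" using f by (simp add: low_degree_ideal_def monomial_ideal_def)
  qed
  then show "\<exists>t::nat. \<forall>a \<in> I [^]\<^bsub>ideals_set R\<^esub> t. a \<odot>\<^bsub>M\<^esub> x = \<zero>\<^bsub>M\<^esub>"
    using power_le[of "p * s + 1"] s by blast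
qed

end


section \<open>The maximal ideal\<close>

lemma size_diff_less:
  assumes "a \<subseteq># m" "a \<noteq> {#}"
  shows "size (m - a) < size m"
proof -
  have "0 < size a" using assms(2) by (simp add: nonempty_has_size)
  then show ?thesis using size_mset_mono[OF assms(1)] by (simp add: size_Diff_submset[OF assms(1)])
qed

text \<open>The coefficients of \<open>1 / f\<close>, obtained by comparing coefficients in \<open>f \<otimes> (1 / f) = \<one>\<close>.\<close>

function inverse_series :: "(nat multiset \<Rightarrow> 'k::field) \<Rightarrow> nat multiset \<Rightarrow> 'k" where
  "inverse_series f m =
     ((if m = {#} then 1 else 0) - (\<Sum>a | a \<subseteq># m \<and> a \<noteq> {#}. f a * inverse_series f (m - a))) / f {#}"
  by auto
termination
proof (relation "measure (\<lambda>(f, m). size m)")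
  fix f :: "nat multiset \<Rightarrow> 'k" and m a :: "nat multiset"
  assume "a \<in> {a. a \<subseteq># m \<and> a \<noteq> {#}}"
  then show "((f, m - a), f, m) \<in> measure (\<lambda>(f, m). size m)"
    by (simp add: size_diff_less)
qed auto

declare inverse_series.simps [simp del]

context power_series
begin

lemma inverse_series_closed:
  assumes f: "f \<in> carrier R"
  shows "inverse_series f \<in> carrier R"
proof -
  have "\<not> set_mset m \<subseteq> {1..n} \<Longrightarrow> inverse_series f m = 0" for m
  proof (induction m rule: measure_induct_rule[of size])
    case (less m)
    have "f a * inverse_series f (m - a) = 0" if a: "a \<subseteq># m" "a \<noteq> {#}" for a
    proof -
      have "set_mset m = set_mset a \<union> set_mset (m - a)"
        using a by (metis set_mset_union subset_mset.add_diff_inverse)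
      then have "\<not> set_mset a \<subseteq> {1..n} \<or> \<not> set_mset (m - a) \<subseteq> {1..n}" using less.prems by blast
      moreover have "size (m - a) < size m"
        using a by (rule size_diff_less)
      ultimately have "f a = 0 \<or> inverse_series f (m - a) = 0"
        using less.IH f unfolding carrier_iff by blast
      then show ?thesis by auto
    qed
    then have "(\<Sum>a | a \<subseteq># m \<and> a \<noteq> {#}. f a * inverse_series f (m - a)) = 0"
      by (intro sum.neutral) blast
    moreover have "m \<noteq> {#}" using less.prems by auto
    ultimately show ?case by (subst inverse_series.simps) simp
  qed
  then show ?thesis by (simp add: carrier_iff)
qed

lemma mult_inverse_series:
  assumes f: "f \<in> carrier R" "f {#} \<noteq> 0"
  shows "f \<otimes> inverse_series f = \<one>"
proof (rule coeff_eqI)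
  fix m
  have "(f \<otimes> inverse_series f) m
      = f {#} * inverse_series f m + (\<Sum>a\<in>{a. a \<subseteq># m} - {{#}}. f a * inverse_series f (m - a))"
    unfolding coeff_mult by (subst sum.remove[of _ "{#}"]) (auto simp: finite_submultisets)
  also have "{a. a \<subseteq># m} - {{#}} = {a. a \<subseteq># m \<and> a \<noteq> {#}}" by auto
  also have "f {#} * inverse_series f m
      = (if m = {#} then 1 else 0) - (\<Sum>a | a \<subseteq># m \<and> a \<noteq> {#}. f a * inverse_series f (m - a))"
    using f(2) by (subst inverse_series.simps) simp
  finally show "(f \<otimes> inverse_series f) m = \<one> m" by (simp add: one_eq_monomial monomial_def)
qed

lemma monomial_ideal_all_vars: "monomial_ideal n 1 = {f \<in> carrier R. f {#} = 0}"
proof -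
  have "f m = 0" if "f \<in> carrier R" "f {#} = 0" "\<forall>j\<in>{1..n}. count m j < 1" for f m
  proof (cases "m = {#}")
    case False
    then obtain j where "j \<in># m" by blast
    then have "j \<notin> {1..n}" using that(3) by (auto simp: not_in_iff[symmetric])
    with \<open>j \<in># m\<close> have "\<not> set_mset m \<subseteq> {1..n}" by blast
    then show ?thesis using that(1) by (simp add: carrier_iff)
  qed (use that in simp)
  then show ?thesis unfolding monomial_ideal_def by (intro Collect_cong) auto
qed

text \<open>
  A series \<open>f\<close> without constant term lies in every maximal ideal: otherwise \<open>\<one> = a \<oplus> r \<otimes> f\<close> with \<open>a\<close> in the
  ideal, but then \<open>a\<close> has constant term \<open>1\<close> and is a unit.
\<close>

lemma maximal_ideal_contains:
  assumes m: "maximalideal \<mm> R" and f: "f \<in> monomial_ideal n 1"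
  shows "f \<in> \<mm>"
proof (rule ccontr)
  assume notin: "f \<notin> \<mm>"
  interpret m: maximalideal \<mm> R by (rule m)
  have fc: "f \<in> carrier R" "f {#} = 0" using f unfolding monomial_ideal_all_vars by auto
  have id: "ideal (\<mm> <+> PIdl f) R"
    by (rule add_ideals[OF m.ideal_axioms cgenideal_ideal[OF fc(1)]])
  have "\<mm> \<subseteq> \<mm> <+> PIdl f"
  proof
    fix a assume a: "a \<in> \<mm>"
    have "a \<oplus> \<zero> \<in> \<mm> <+> PIdl f"
      unfolding set_add_def'
      using a additive_subgroup.zero_closed[OF ideal.axioms(1)[OF cgenideal_ideal[OF fc(1)]]] by blast
    then show "a \<in> \<mm> <+> PIdl f" using m.a_Hcarr[OF a] by simp
  qed
  moreover have "f \<in> \<mm> <+> PIdl f"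
  proof -
    have "\<zero> \<oplus> f \<in> \<mm> <+> PIdl f"
      unfolding set_add_def' using cgenideal_self[OF fc(1)] m.zero_closed by blast
    then show ?thesis using fc(1) by simp
  qed
  ultimately have "\<mm> <+> PIdl f = carrier R"
    using m.I_maximal[OF id] ideal.Icarr[OF id] notin by blast
  then have "\<one> \<in> \<mm> <+> PIdl f" by simp
  then obtain a r where a: "a \<in> \<mm>" and r: "r \<in> carrier R" and eq: "\<one> = a \<oplus> r \<otimes> f"
    unfolding set_add_def' cgenideal_def by blast
  have "(r \<otimes> f) {#} = 0" using fc(2) by (simp add: coeff_mult)
  moreover have "\<one> {#} = a {#} + (r \<otimes> f) {#}" unfolding eq by (rule coeff_add)
  ultimately have "a {#} = 1" by (simp add: one_eq_monomial monomial_def)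
  then have "a \<otimes> inverse_series a = \<one>" using mult_inverse_series m.a_Hcarr[OF a] by simp
  moreover have "a \<otimes> inverse_series a \<in> \<mm>"
    using m.I_r_closed[OF a inverse_series_closed] m.a_Hcarr[OF a] by simp
  ultimately have "\<mm> = carrier R" using m.one_imp_carrier by simp
  then show False using m.I_notcarr by simp
qed

text \<open>
  The generator of the socle is the image of the class of \<open>\<one>\<close> under the embedding of the residue field;
  the series without constant term kill it because they are the nonunits.
\<close>

lemma injective_hull_socle:
  assumes m: "maximalideal \<mm> R"
    and E: "injective_hull R (quot_module R (regular_module R) \<mm>) E \<iota>"
  obtains e where "e \<in> carrier E" "e \<noteq> \<zero>\<^bsub>E\<^esub>" "\<And>f. f \<in> monomial_ideal n 1 \<Longrightarrow> f \<odot>\<^bsub>E\<^esub> e = \<zero>\<^bsub>E\<^esub>"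
proof -
  interpret m: maximalideal \<mm> R by (rule m)
  interpret reg: module R "regular_module R" by (rule module_regular_module) (rule cring_R)
  have sub: "submodule R \<mm> (regular_module R)"
    by (rule submodule.intro[OF reg.module_axioms])
       (auto simp: regular_module_def m.a_Hcarr m.I_l_closed)
  let ?k = "quot_module R (regular_module R) \<mm>"
  interpret k: module R ?k by (rule module_quot_module[OF sub])
  have Ei: "injective_module R E" and \<iota>: "\<iota> \<in> module_hom R ?k E" and inj: "inj_on \<iota> (carrier ?k)"
    using E by (auto simp: injective_hull_def)
  interpret E: module R E using Ei by (simp add: injective_module_def)
  interpret \<iota>: mod_hom R ?k E \<iota> by unfold_locales (rule \<iota>)
  have one: "\<one> \<in> carrier (regular_module R)" by (simp add: regular_module_def)
  let ?c = "\<mm> +>\<^bsub>regular_module R\<^esub> \<one>"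
  have c: "?c \<in> carrier ?k" using one by (auto simp: carrier_quot_module[OF sub])
  have "\<one> \<notin> \<mm>" using m.one_imp_carrier m.I_notcarr by blast
  then have c0: "?c \<noteq> \<zero>\<^bsub>?k\<^esub>"
    using coset_eq_zero_iff[OF sub one] by (simp add: zero_quot_module[OF sub])
  show thesis
  proof
    show "\<iota> ?c \<in> carrier E" using c by (rule \<iota>.f_im)
    show "\<iota> ?c \<noteq> \<zero>\<^bsub>E\<^esub>"
      using inj_onD[OF inj, of ?c "\<zero>\<^bsub>?k\<^esub>"] c c0 \<iota>.f0_is_0 k.M.zero_closed by metis
    fix f assume f: "f \<in> monomial_ideal n 1"
    then have fc: "f \<in> carrier R" by (rule monomial_ideal_closed)
    then have f': "f \<in> carrier (regular_module R)" by (simp add: regular_module_def)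
    have "f \<odot>\<^bsub>?k\<^esub> ?c = \<mm> +>\<^bsub>regular_module R\<^esub> f"
      using smult_quot_module[OF sub fc one] fc by (simp add: regular_module_def)
    also have "\<dots> = \<zero>\<^bsub>?k\<^esub>"
      using coset_eq_zero_iff[OF sub f'] maximal_ideal_contains[OF m f] by (simp add: zero_quot_module[OF sub])
    finally have "f \<odot>\<^bsub>E\<^esub> \<iota> ?c = \<iota> \<zero>\<^bsub>?k\<^esub>" using \<iota>.f_smult[OF fc c] by simp
    then show "f \<odot>\<^bsub>E\<^esub> \<iota> ?c = \<zero>\<^bsub>E\<^esub>" by (simp only: \<iota>.f0_is_0)
  qed
qed

end


section \<open>Inverse polynomials in the injective hull\<close>

text \<open>
  The element \<open>w N\<close> plays the role of the inverse monomial \<open>(X\<^sub>1 \<cdots> X\<^sub>n)\<^sup>-\<^sup>N\<close> of Macaulay's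
  inverse system, \<open>w 0\<close> being a generator of the socle.
\<close>

locale inverse_system = power_series n R
  for n :: nat and R :: "(nat multiset \<Rightarrow> 'k::field) ring" (structure) +
  fixes E :: "(nat multiset \<Rightarrow> 'k, 'h) module" and w :: "nat \<Rightarrow> 'h"
  assumes module_E: "module R E"
    and w_closed: "\<And>N. w N \<in> carrier E"
    and w_chain: "\<And>N. var_product n 1 \<odot>\<^bsub>E\<^esub> w (Suc N) = w N"
    and w_annihilated: "\<And>N f. f \<in> monomial_ideal n (Suc N) \<Longrightarrow> f \<odot>\<^bsub>E\<^esub> w N = \<zero>\<^bsub>E\<^esub>"
    and socle_nonzero: "w 0 \<noteq> \<zero>\<^bsub>E\<^esub>"

lemma (in power_series) inverse_system_exists:
  assumes E: "injective_module R E" and e: "e \<in> carrier E" "e \<noteq> \<zero>\<^bsub>E\<^esub>"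
    "\<And>f. f \<in> monomial_ideal n 1 \<Longrightarrow> f \<odot>\<^bsub>E\<^esub> e = \<zero>\<^bsub>E\<^esub>"
  obtains w where "inverse_system n R E w"
proof -
  interpret E: module R E using E by (simp add: injective_module_def)
  let ?P = "\<lambda>N x. x \<in> carrier E \<and> (\<forall>f\<in>monomial_ideal n (Suc N). f \<odot>\<^bsub>E\<^esub> x = \<zero>\<^bsub>E\<^esub>) \<and> (N = 0 \<longrightarrow> x = e)"
  have X: "var_product n 1 \<in> carrier R" by (rule var_product_closed) simp
  have "\<exists>w. \<forall>N. ?P N (w N) \<and> var_product n 1 \<odot>\<^bsub>E\<^esub> w (Suc N) = w N"
  proof (rule dependent_nat_choice)
    show "\<exists>x. ?P 0 x" using e by auto
    fix x N assume x: "?P N x"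
    obtain y where y: "y \<in> carrier E" "var_product n 1 \<odot>\<^bsub>E\<^esub> y = x"
      "\<And>f. f \<in> monomial_ideal n (Suc (Suc N)) \<Longrightarrow> f \<odot>\<^bsub>E\<^esub> y = \<zero>\<^bsub>E\<^esub>"
    proof (rule injective_module_solves_two[OF E, of "var_product n 1" \<zero> x "\<zero>\<^bsub>E\<^esub>" "monomial_ideal n (Suc (Suc N))"])
      fix r r' k assume r: "r \<in> carrier R" "r' \<in> carrier R" "k \<in> monomial_ideal n (Suc (Suc N))"
        and eq: "r \<otimes> var_product n 1 \<oplus> r' \<otimes> \<zero> \<oplus> k = \<zero>"
      note k = monomial_ideal_closed[OF r(3)]
      have "\<ominus> k = r \<otimes> var_product n 1 \<oplus> r' \<otimes> \<zero>"
        by (rule minus_equality[OF eq k]) (use r X in simp)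
      then have "var_product n 1 \<otimes> r = \<ominus> k" using r X by (simp add: m_comm)
      then have "var_product n 1 \<otimes> r \<in> monomial_ideal n (Suc N + 1)"
        using monomial_ideal_minus[OF r(3)] by simp
      then have "r \<in> monomial_ideal n (Suc N)" by (rule monomial_ideal_cancel_var_product[OF r(1)])
      then have "r \<odot>\<^bsub>E\<^esub> x = \<zero>\<^bsub>E\<^esub>" using x by blast
      then show "r \<odot>\<^bsub>E\<^esub> x \<oplus>\<^bsub>E\<^esub> r' \<odot>\<^bsub>E\<^esub> \<zero>\<^bsub>E\<^esub> = \<zero>\<^bsub>E\<^esub>" using r(2) by simp
    next
      fix y assume "y \<in> carrier E" "var_product n 1 \<odot>\<^bsub>E\<^esub> y = x"
        "\<And>k. k \<in> monomial_ideal n (Suc (Suc N)) \<Longrightarrow> k \<odot>\<^bsub>E\<^esub> y = \<zero>\<^bsub>E\<^esub>"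
      then show thesis by (rule that)
    next
      show "monomial_ideal n (Suc (Suc N)) \<subseteq> carrier R" using monomial_ideal_closed by blast
    qed (use x in \<open>simp_all only: X zero_closed E.M.zero_closed monomial_ideal_zero monomial_ideal_add monomial_ideal_mult\<close>)
    then show "\<exists>y. ?P (Suc N) y \<and> var_product n 1 \<odot>\<^bsub>E\<^esub> y = x" by blast
  qed
  then obtain w where w: "\<forall>N. ?P N (w N) \<and> var_product n 1 \<odot>\<^bsub>E\<^esub> w (Suc N) = w N" ..
  show thesis
  proof (rule that[of w], unfold_locales)
    show "w 0 \<noteq> \<zero>\<^bsub>E\<^esub>" using w e(2) by metis
  qed (use w in blast)+
qed

context inverse_system
begin

sublocale E: module R E
  by (rule module_E)

definition box :: "nat \<Rightarrow> nat multiset" where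
  "box N = repeat_mset N (mset_set {1..n})"

lemma count_box: "count (box N) j = (if j \<in> {1..n} then N else 0)"
  by (simp add: box_def count_mset_set')

lemma set_box: "m \<subseteq># box N \<Longrightarrow> set_mset m \<subseteq> {1..n}"
proof
  fix j assume "m \<subseteq># box N" "j \<in># m"
  then have "0 < count (box N) j" by (metis count_greater_zero_iff less_le_trans mset_subset_eq_count)
  then show "j \<in> {1..n}" by (simp add: count_box split: if_splits)
qed

lemma subset_box_iff:
  assumes "set_mset m \<subseteq> {1..n}"
  shows "m \<subseteq># box N \<longleftrightarrow> (\<forall>j\<in>{1..n}. count m j < Suc N)"
proof -
  have "count m j = 0" if "j \<notin> {1..n}" for j using assms that by (metis count_eq_zero_iff subsetD)
  then show ?thesis by (auto simp: subseteq_mset_def count_box less_Suc_eq_le)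
qed

lemma in_monomial_ideal_iff:
  "f \<in> monomial_ideal n (Suc N) \<longleftrightarrow> f \<in> carrier R \<and> (\<forall>m. m \<subseteq># box N \<longrightarrow> f m = 0)"
proof -
  have "(\<forall>m. (\<forall>j\<in>{1..n}. count m j < Suc N) \<longrightarrow> f m = 0) \<longleftrightarrow> (\<forall>m. m \<subseteq># box N \<longrightarrow> f m = 0)"
    if f: "f \<in> carrier R"
  proof (intro iffI allI impI)
    fix m assume "\<forall>m. (\<forall>j\<in>{1..n}. count m j < Suc N) \<longrightarrow> f m = 0" "m \<subseteq># box N"
    then show "f m = 0" using set_box subset_box_iff by blast
  next
    fix m assume *: "\<forall>m. m \<subseteq># box N \<longrightarrow> f m = 0" "\<forall>j\<in>{1..n}. count m j < Suc N"
    show "f m = 0"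
    proof (cases "set_mset m \<subseteq> {1..n}")
      case True
      then show ?thesis using * subset_box_iff by blast
    next
      case False
      then show ?thesis using f by (simp add: carrier_iff)
    qed
  qed
  then show ?thesis by (auto simp: monomial_ideal_def)
qed

text \<open>
  If a monomial of minimal degree outside \<open>(X\<^sub>1\<^sup>N\<^sup>+\<^sup>1, \<dots>, X\<^sub>n\<^sup>N\<^sup>+\<^sup>1)\<close> occurs in a series \<open>r\<close>, then
  multiplication with the complementary monomial moves it to \<open>(X\<^sub>1 \<cdots> X\<^sub>n)\<^sup>N\<close> and everything else into
  that ideal; so \<open>r \<odot> w N\<close> has a nonzero multiple in the socle.
\<close>

lemma w_annihilator:
  assumes r: "r \<in> carrier R" and zero: "r \<odot>\<^bsub>E\<^esub> w N = \<zero>\<^bsub>E\<^esub>"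
  shows "r \<in> monomial_ideal n (Suc N)"
proof (rule ccontr)
  assume "r \<notin> monomial_ideal n (Suc N)"
  then have "\<exists>m. m \<subseteq># box N \<and> r m \<noteq> 0" using r by (simp add: in_monomial_ideal_iff)
  then obtain \<mu> where \<mu>: "\<mu> \<subseteq># box N" "r \<mu> \<noteq> 0"
    and min: "\<And>m. m \<subseteq># box N \<Longrightarrow> r m \<noteq> 0 \<Longrightarrow> size \<mu> \<le> size m"
    using ex_has_least_nat[of "\<lambda>m. m \<subseteq># box N \<and> r m \<noteq> 0" _ size] by blast
  define A where "A = box N - \<mu>"
  have A: "A + \<mu> = box N" using \<mu>(1) by (simp add: A_def)
  then have Ac: "monomial A \<in> carrier R"
    by (intro monomial_closed set_box[of _ N]) (metis mset_subset_eq_add_left)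
  have boxc: "monomial (box N) \<in> carrier R" by (intro monomial_closed set_box[of _ N]) simp
  define c :: "nat multiset \<Rightarrow> 'k" where "c = (\<lambda>m. if m = {#} then r \<mu> else 0)"
  have c: "c \<in> carrier R" by (simp add: carrier_iff c_def)
  let ?f = "monomial A \<otimes> r \<ominus> monomial (box N) \<otimes> c"
  have fc: "?f \<in> carrier R" using r c Ac boxc by simp
  have "?f \<in> monomial_ideal n (Suc N)"
    unfolding in_monomial_ideal_iff
  proof (intro conjI allI impI fc)
    fix m assume m: "m \<subseteq># box N"
    have "(monomial A \<otimes> r) m = (monomial (box N) \<otimes> c) m"
    proof (cases "m = box N")
      case True
      then have "(monomial A \<otimes> r) m = r \<mu>" using A[symmetric] by (simp add: coeff_monomial_mult)
      moreover have "(monomial (box N) \<otimes> c) m = r \<mu>" using True by (simp add: coeff_monomial_mult c_def)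
      ultimately show ?thesis by simp
    next
      case False
      have "(monomial A \<otimes> r) m = 0"
      proof (cases "A \<subseteq># m")
        case True
        then obtain \<rho> where \<rho>: "m = A + \<rho>" by (metis subset_mset.le_iff_add)
        then have "\<rho> \<subseteq># \<mu>" using m A by (metis subset_mset.add_le_cancel_left)
        moreover have "\<rho> \<noteq> \<mu>" using False \<rho> A by auto
        ultimately have "\<rho> \<subset># \<mu>" by (simp add: subset_mset.le_neq_trans)
        then have "size \<rho> < size \<mu>" by (rule mset_subset_size)
        moreover have "\<rho> \<subseteq># box N" using \<open>\<rho> \<subseteq># \<mu>\<close> \<mu>(1) by (rule subset_mset.order_trans)
        ultimately have "r \<rho> = 0" using min by (meson not_le)
        then show ?thesis using \<rho> by (simp add: coeff_monomial_mult)
      qed (simp add: coeff_monomial_mult)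
      moreover have "\<not> box N \<subseteq># m" using False m by (simp add: subset_mset.eq_iff)
      ultimately show ?thesis by (simp add: coeff_monomial_mult)
    qed
    then show "?f m = 0" using r c Ac boxc by (simp add: minus_eq coeff_add coeff_minus)
  qed
  then have "?f \<odot>\<^bsub>E\<^esub> w N = \<zero>\<^bsub>E\<^esub>" by (rule w_annihilated)
  then have "(monomial A \<otimes> r) \<odot>\<^bsub>E\<^esub> w N = (monomial (box N) \<otimes> c) \<odot>\<^bsub>E\<^esub> w N"
    using r c Ac boxc w_closed by (simp add: E.smult_minus_left)
  moreover have "(monomial A \<otimes> r) \<odot>\<^bsub>E\<^esub> w N = \<zero>\<^bsub>E\<^esub>"
    using r Ac w_closed zero by (simp add: E.smult_assoc1)
  moreover have "(monomial (box N) \<otimes> c) \<odot>\<^bsub>E\<^esub> w N = c \<odot>\<^bsub>E\<^esub> w 0"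
  proof -
    have "monomial (box N) \<odot>\<^bsub>E\<^esub> w N = w 0"
      using var_product_iterate[OF order.refl module_E, of w N 0, OF w_closed w_chain]
      by (simp add: var_product_def box_def)
    moreover have "monomial (box N) \<otimes> c = c \<otimes> monomial (box N)" using c boxc by (rule m_comm[rotated])
    ultimately show ?thesis using c boxc w_closed by (simp add: E.smult_assoc1)
  qed
  ultimately have cw: "c \<odot>\<^bsub>E\<^esub> w 0 = \<zero>\<^bsub>E\<^esub>" by simp
  have "c {#} \<noteq> 0" using \<mu>(2) by (simp add: c_def)
  then have "inverse_series c \<otimes> c = \<one>"
    using mult_inverse_series[OF c] inverse_series_closed[OF c] c by (simp add: m_comm)
  then have "w 0 = (inverse_series c \<otimes> c) \<odot>\<^bsub>E\<^esub> w 0" using w_closed by simp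
  also have "\<dots> = \<zero>\<^bsub>E\<^esub>" using c inverse_series_closed[OF c] w_closed cw by (simp add: E.smult_assoc1)
  finally show False using socle_nonzero by simp
qed

text \<open>
  A finitely supported coefficient function \<open>g\<close> represents the inverse polynomial
  \<open>\<Sum>\<^sub>\<mu> g \<mu> X\<^sup>-\<^sup>\<mu>\<close>; the corresponding element of \<open>E\<close> is obtained by multiplying
  \<open>w N = (X\<^sub>1 \<cdots> X\<^sub>n)\<^sup>-\<^sup>N\<close> with a polynomial. Every \<open>N\<close> for which the support of \<open>g\<close> divides
  \<open>(X\<^sub>1 \<cdots> X\<^sub>n)\<^sup>N\<close> gives the same element (\<open>inverse_polynomial_eq\<close>).
\<close>

definition reflect :: "nat \<Rightarrow> (nat multiset \<Rightarrow> 'k) \<Rightarrow> (nat multiset \<Rightarrow> 'k)" where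
  "reflect N g = (\<lambda>m. if m \<subseteq># box N then g (box N - m) else 0)"

definition supported :: "nat \<Rightarrow> (nat multiset \<Rightarrow> 'k) \<Rightarrow> bool" where
  "supported N g \<longleftrightarrow> (\<forall>m. g m \<noteq> 0 \<longrightarrow> m \<subseteq># box N)"

definition inverse_polynomial :: "(nat multiset \<Rightarrow> 'k) \<Rightarrow> 'h" where
  "inverse_polynomial g = (let N = LEAST N. supported N g in reflect N g \<odot>\<^bsub>E\<^esub> w N)"

lemma reflect_closed: "reflect N g \<in> carrier R"
  unfolding carrier_iff reflect_def using set_box by auto

lemma box_Suc: "box (Suc N) = box N + mset_set {1..n}"
  by (simp add: box_def)

lemma reflect_Suc:
  assumes "supported N g"
  shows "reflect (Suc N) g = var_product n 1 \<otimes> reflect N g"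
proof (rule coeff_eqI)
  fix m
  have X: "var_product n 1 = monomial (mset_set {1..n})" by (simp add: var_product_def)
  show "reflect (Suc N) g m = (var_product n 1 \<otimes> reflect N g) m"
  proof (cases "mset_set {1..n} \<subseteq># m")
    case True
    define \<rho> where "\<rho> = m - mset_set {1..n}"
    have m: "m = \<rho> + mset_set {1..n}" using True by (simp add: \<rho>_def)
    have "reflect (Suc N) g m = reflect N g \<rho>"
      unfolding reflect_def m box_Suc by simp
    moreover have "(var_product n 1 \<otimes> reflect N g) m = reflect N g \<rho>"
      unfolding X m by (rule coeff_monomial_mult_add)
    ultimately show ?thesis by simp
  next
    case False
    then obtain j where j: "count m j < count (mset_set {1..n}) j" by (auto simp: subseteq_mset_def not_le)
    then have "j \<in> {1..n}" "count m j = 0" by (simp_all add: count_mset_set' split: if_splits)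
    then have "count (box N) j < count (box (Suc N) - m) j" by (simp add: count_box)
    then have "\<not> box (Suc N) - m \<subseteq># box N" by (metis mset_subset_eq_count not_le)
    then have "g (box (Suc N) - m) = 0" using assms by (auto simp: supported_def)
    moreover have "(var_product n 1 \<otimes> reflect N g) m = 0"
      unfolding X coeff_monomial_mult using False by (rule if_not_P)
    ultimately show ?thesis by (simp add: reflect_def)
  qed
qed

lemma supported_mono: "supported N g \<Longrightarrow> N \<le> M \<Longrightarrow> supported M g"
proof -
  assume "supported N g" "N \<le> M"
  moreover have "box N \<subseteq># box M" using \<open>N \<le> M\<close> by (simp add: subseteq_mset_def count_box)
  ultimately show "supported M g" unfolding supported_def using subset_mset.order_trans by blast
qed

lemma reflect_w_mono:
  assumes "supported N g" "N \<le> M"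
  shows "reflect M g \<odot>\<^bsub>E\<^esub> w M = reflect N g \<odot>\<^bsub>E\<^esub> w N"
  using assms(2)
proof (induction M rule: dec_induct)
  case base
  show ?case ..
next
  case (step M)
  have X: "var_product n 1 \<in> carrier R" by (rule var_product_closed) simp
  have "reflect (Suc M) g \<odot>\<^bsub>E\<^esub> w (Suc M) = (reflect M g \<otimes> var_product n 1) \<odot>\<^bsub>E\<^esub> w (Suc M)"
    using reflect_Suc[OF supported_mono[OF assms(1) step(1)]] X reflect_closed by (simp add: m_comm)
  also have "\<dots> = reflect M g \<odot>\<^bsub>E\<^esub> w M"
    using X reflect_closed w_closed w_chain by (simp only: E.smult_assoc1)
  finally show ?case using step.IH by simp
qed

lemma inverse_polynomial_eq:
  assumes "supported N g"
  shows "inverse_polynomial g = reflect N g \<odot>\<^bsub>E\<^esub> w N"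
proof -
  have "supported (LEAST N. supported N g) g" using assms by (rule LeastI)
  moreover have "(LEAST N. supported N g) \<le> N" using assms by (rule Least_le)
  ultimately show ?thesis unfolding inverse_polynomial_def Let_def by (rule reflect_w_mono[symmetric])
qed

lemma inverse_polynomial_closed: "supported N g \<Longrightarrow> inverse_polynomial g \<in> carrier E"
  using inverse_polynomial_eq reflect_closed w_closed by simp

lemma inverse_polynomial_zero: "inverse_polynomial (\<lambda>m. 0) = \<zero>\<^bsub>E\<^esub>"
proof -
  have "reflect 0 (\<lambda>m. 0) = \<zero>" by (rule coeff_eqI) (simp add: reflect_def coeff_zero)
  then show ?thesis using inverse_polynomial_eq[of 0 "\<lambda>m. 0"] w_closed by (simp add: supported_def)
qed

lemma monomial_inverse_polynomial:
  assumes A: "set_mset A \<subseteq> {1..n}" and g: "supported N g"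
  shows "monomial A \<odot>\<^bsub>E\<^esub> inverse_polynomial g = inverse_polynomial (\<lambda>m. g (m + A))"
proof -
  have supp: "supported N (\<lambda>m. g (m + A))"
    unfolding supported_def
  proof (intro allI impI)
    fix m assume "g (m + A) \<noteq> 0"
    then have "m + A \<subseteq># box N" using g by (simp add: supported_def)
    then show "m \<subseteq># box N" by (metis mset_subset_eq_add_left subset_mset.order_trans)
  qed
  have Ac: "monomial A \<in> carrier R" using A by (rule monomial_closed)
  let ?f = "monomial A \<otimes> reflect N g \<ominus> reflect N (\<lambda>m. g (m + A))"
  have "?f \<in> monomial_ideal n (Suc N)"
    unfolding in_monomial_ideal_iff
  proof (intro conjI allI impI)
    show "?f \<in> carrier R" using Ac reflect_closed by simp
    fix m assume m: "m \<subseteq># box N"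
    have "(monomial A \<otimes> reflect N g) m = reflect N (\<lambda>m. g (m + A)) m"
    proof (cases "A \<subseteq># m")
      case True
      then have "m - A \<subseteq># box N" using m by (metis diff_subset_eq_self subset_mset.order_trans)
      moreover have "box N - (m - A) = box N - m + A"
      proof (rule multiset_eqI)
        fix j show "count (box N - (m - A)) j = count (box N - m + A) j"
          using mset_subset_eq_count[OF True, of j] mset_subset_eq_count[OF m, of j] by simp
      qed
      ultimately show ?thesis using True m by (simp add: coeff_monomial_mult reflect_def)
    next
      case False
      have "\<not> box N - m + A \<subseteq># box N"
      proof
        assume sub: "box N - m + A \<subseteq># box N"
        have "A \<subseteq># m"
          unfolding subseteq_mset_def
        proof
          fix j show "count A j \<le> count m j"
            using mset_subset_eq_count[OF sub, of j] mset_subset_eq_count[OF m, of j] by simp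
        qed
        then show False using False by simp
      qed
      then have "reflect N (\<lambda>m. g (m + A)) m = 0"
        using g by (auto simp only: supported_def reflect_def split: if_split)
      moreover have "(monomial A \<otimes> reflect N g) m = 0"
        unfolding coeff_monomial_mult using False by (rule if_not_P)
      ultimately show ?thesis by simp
    qed
    then show "?f m = 0" using Ac reflect_closed by (simp add: minus_eq coeff_add coeff_minus)
  qed
  then have "?f \<odot>\<^bsub>E\<^esub> w N = \<zero>\<^bsub>E\<^esub>" by (rule w_annihilated)
  then have "(monomial A \<otimes> reflect N g) \<odot>\<^bsub>E\<^esub> w N = reflect N (\<lambda>m. g (m + A)) \<odot>\<^bsub>E\<^esub> w N"
    using Ac reflect_closed w_closed by (simp add: E.smult_minus_left)
  then show ?thesis
    using Ac reflect_closed w_closed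
    by (simp add: inverse_polynomial_eq[OF g] inverse_polynomial_eq[OF supp] E.smult_assoc1)
qed

lemma coeff_finsum:
  assumes "finite F" "\<And>l. l \<in> F \<Longrightarrow> f l \<in> carrier R"
  shows "(\<Oplus>l\<in>F. f l) m = (\<Sum>l\<in>F. f l m)"
  using assms
proof (induction F rule: finite_induct)
  case empty
  then show ?case by (simp add: coeff_zero)
next
  case (insert l F)
  then show ?case by (subst finsum_insert) (auto simp: coeff_add)
qed

text \<open>
  A linear relation between inverse polynomials holds coefficientwise, as if they were multiplied by
  contraction: the series killed by \<open>w N\<close> are those in which no divisor of \<open>(X\<^sub>1 \<cdots> X\<^sub>n)\<^sup>N\<close> occurs.
\<close>

lemma inverse_polynomial_relation:
  assumes F: "finite F" and r: "\<And>l. l \<in> F \<Longrightarrow> r l \<in> carrier R"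
    and g: "\<And>l. l \<in> F \<Longrightarrow> supported N (g l)"
    and zero: "(\<Oplus>\<^bsub>E\<^esub>l\<in>F. r l \<odot>\<^bsub>E\<^esub> inverse_polynomial (g l)) = \<zero>\<^bsub>E\<^esub>"
    and \<mu>: "\<mu> \<subseteq># box N"
  shows "(\<Sum>l\<in>F. \<Sum>a | a \<subseteq># box N - \<mu>. r l a * g l (\<mu> + a)) = 0"
proof -
  let ?G = "\<Oplus>l\<in>F. r l \<otimes> reflect N (g l)"
  have Gc: "?G \<in> carrier R" using r reflect_closed by (intro finsum_closed) auto
  have "?G \<odot>\<^bsub>E\<^esub> w N = (\<Oplus>\<^bsub>E\<^esub>l\<in>F. r l \<odot>\<^bsub>E\<^esub> inverse_polynomial (g l))"
    using F r g
  proof (induction F rule: finite_induct)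
    case empty
    then show ?case using w_closed by simp
  next
    case (insert l F)
    have rl: "r l \<in> carrier R" and rF: "(\<lambda>l. r l \<otimes> reflect N (g l)) \<in> F \<rightarrow> carrier R"
      using insert.prems(1) reflect_closed by auto
    have ec: "inverse_polynomial (g l') \<in> carrier E" if "l' \<in> insert l F" for l'
      by (rule inverse_polynomial_closed[OF insert.prems(2)[OF that]])
    have eF: "(\<lambda>l. r l \<odot>\<^bsub>E\<^esub> inverse_polynomial (g l)) \<in> F \<rightarrow> carrier E"
      using insert.prems(1) ec by auto
    note el = ec[OF insertI1]
    have IH: "(\<Oplus>l\<in>F. r l \<otimes> reflect N (g l)) \<odot>\<^bsub>E\<^esub> w N
        = (\<Oplus>\<^bsub>E\<^esub>l\<in>F. r l \<odot>\<^bsub>E\<^esub> inverse_polynomial (g l))"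
      by (rule insert.IH) (use insert.prems in auto)
    have eq: "inverse_polynomial (g l) = reflect N (g l) \<odot>\<^bsub>E\<^esub> w N"
      by (rule inverse_polynomial_eq) (use insert.prems in auto)
    have "(\<Oplus>l\<in>insert l F. r l \<otimes> reflect N (g l)) \<odot>\<^bsub>E\<^esub> w N
        = (r l \<otimes> reflect N (g l) \<oplus> (\<Oplus>l\<in>F. r l \<otimes> reflect N (g l))) \<odot>\<^bsub>E\<^esub> w N"
      by (subst finsum_insert[OF insert.hyps rF]) (use rl reflect_closed in auto)
    also have "\<dots> = (r l \<otimes> reflect N (g l)) \<odot>\<^bsub>E\<^esub> w N
        \<oplus>\<^bsub>E\<^esub> (\<Oplus>l\<in>F. r l \<otimes> reflect N (g l)) \<odot>\<^bsub>E\<^esub> w N"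
      using rl reflect_closed w_closed finsum_closed[OF rF] by (intro E.smult_l_distr) auto
    also have "\<dots> = r l \<odot>\<^bsub>E\<^esub> inverse_polynomial (g l) \<oplus>\<^bsub>E\<^esub> (\<Oplus>\<^bsub>E\<^esub>l\<in>F. r l \<odot>\<^bsub>E\<^esub> inverse_polynomial (g l))"
      unfolding IH eq using E.smult_assoc1[OF rl reflect_closed w_closed] by simp
    also have "\<dots> = (\<Oplus>\<^bsub>E\<^esub>l\<in>insert l F. r l \<odot>\<^bsub>E\<^esub> inverse_polynomial (g l))"
      by (subst E.finsum_insert[OF insert.hyps eF]) (use rl el in auto)
    finally show ?case .
  qed
  then have "?G \<in> monomial_ideal n (Suc N)" using zero w_annihilator[OF Gc] by simp
  then have "?G (box N - \<mu>) = 0" by (simp add: in_monomial_ideal_iff)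
  moreover have "?G (box N - \<mu>) = (\<Sum>l\<in>F. (r l \<otimes> reflect N (g l)) (box N - \<mu>))"
    using F r reflect_closed by (intro coeff_finsum) auto
  moreover have "(r l \<otimes> reflect N (g l)) (box N - \<mu>)
      = (\<Sum>a | a \<subseteq># box N - \<mu>. r l a * g l (\<mu> + a))" for l
    unfolding coeff_mult
  proof (rule sum.cong)
    fix a assume "a \<in> {a. a \<subseteq># box N - \<mu>}"
    then have a: "a \<subseteq># box N - \<mu>" by simp
    have "box N - \<mu> - a \<subseteq># box N" by (metis diff_subset_eq_self subset_mset.order_trans)
    moreover have "box N - (box N - \<mu> - a) = \<mu> + a"
    proof (rule multiset_eqI)
      fix j show "count (box N - (box N - \<mu> - a)) j = count (\<mu> + a) j"
        using mset_subset_eq_count[OF a, of j] mset_subset_eq_count[OF \<mu>, of j] by simp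
    qed
    ultimately show "r l a * reflect N (g l) (box N - \<mu> - a) = r l a * g l (\<mu> + a)"
      by (simp add: reflect_def)
  qed simp
  ultimately show ?thesis by simp
qed

end


section \<open>Extension of scalars to a field\<close>

locale scalar_extension =
  fixes R :: "('r, 'z) ring_scheme" and Q :: "('q, 'y) ring_scheme" and \<phi> :: "'r \<Rightarrow> 'q"
    and M :: "('r, 'm) module"
  assumes module_M: "module R M" and field_Q: "field Q" and \<phi>_hom: "\<phi> \<in> ring_hom R Q"
begin

sublocale M: module R M
  by (rule module_M)

sublocale Q: field Q
  by (rule field_Q)

sublocale \<phi>: ring_hom_cring R Q \<phi>
  by unfold_locales (rule \<phi>_hom)

abbreviation N :: "('r, 'q) module" where
  "N \<equiv> restrict_scalars \<phi> Q"

abbreviation G :: "('m \<times> 'q \<Rightarrow>\<^sub>0 int) monoid" where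
  "G \<equiv> free_Abelian_group (carrier M \<times> carrier Q)"

abbreviation K :: "('m \<times> 'q \<Rightarrow>\<^sub>0 int) set" where
  "K \<equiv> tensor_kernel R M N"

abbreviation V :: "('q, ('m \<times> 'q \<Rightarrow>\<^sub>0 int) set) module" where
  "V \<equiv> extend_scalars R Q \<phi> M"

definition tensor_class :: "('m \<times> 'q \<Rightarrow>\<^sub>0 int) \<Rightarrow> ('m \<times> 'q \<Rightarrow>\<^sub>0 int) set" where
  "tensor_class c = (\<lambda>k. k + c) ` K"

definition scale :: "'q \<Rightarrow> ('m \<times> 'q \<Rightarrow>\<^sub>0 int) \<Rightarrow> ('m \<times> 'q \<Rightarrow>\<^sub>0 int)" where
  "scale q = frag_extend (\<lambda>(x, p). frag_of (x, q \<otimes>\<^bsub>Q\<^esub> p))"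

lemma N_simps [simp]:
  "carrier N = carrier Q" "x \<oplus>\<^bsub>N\<^esub> y = x \<oplus>\<^bsub>Q\<^esub> y" "r \<odot>\<^bsub>N\<^esub> x = \<phi> r \<otimes>\<^bsub>Q\<^esub> x"
  by (simp_all add: restrict_scalars_def)

lemma kernel_def': "K = generate G (tensor_relators R M N)"
  by (simp add: tensor_kernel_def)

lemma keys_frag_diff: "Poly_Mapping.keys (frag_of a - frag_of b) \<subseteq> {a, b}"
  using keys_diff[of "frag_of a" "frag_of b"] by auto

lemma keys_frag_diff3: "Poly_Mapping.keys (frag_of a - frag_of b - frag_of c) \<subseteq> {a, b, c}"
  using keys_diff[of "frag_of a - frag_of b" "frag_of c"] keys_frag_diff[of a b] by auto

lemma relators_closed: "tensor_relators R M N \<subseteq> carrier G"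
proof
  fix t assume "t \<in> tensor_relators R M N"
  then consider
    (1) x x' y where "t = frag_of (x \<oplus>\<^bsub>M\<^esub> x', y) - frag_of (x, y) - frag_of (x', y)"
      "x \<in> carrier M" "x' \<in> carrier M" "y \<in> carrier Q"
    | (2) x y y' where "t = frag_of (x, y \<oplus>\<^bsub>Q\<^esub> y') - frag_of (x, y) - frag_of (x, y')"
      "x \<in> carrier M" "y \<in> carrier Q" "y' \<in> carrier Q"
    | (3) r x y where "t = frag_of (r \<odot>\<^bsub>M\<^esub> x, y) - frag_of (x, \<phi> r \<otimes>\<^bsub>Q\<^esub> y)"
      "r \<in> carrier R" "x \<in> carrier M" "y \<in> carrier Q"
    unfolding tensor_relators_def by auto
  then show "t \<in> carrier G"
  proof cases
    case 1
    then show ?thesis using keys_frag_diff3[of "(x \<oplus>\<^bsub>M\<^esub> x', y)" "(x, y)" "(x', y)"] by auto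
  next
    case 2
    then show ?thesis using keys_frag_diff3[of "(x, y \<oplus>\<^bsub>Q\<^esub> y')" "(x, y)" "(x, y')"] by auto
  next
    case 3
    then show ?thesis using keys_frag_diff[of "(r \<odot>\<^bsub>M\<^esub> x, y)" "(x, \<phi> r \<otimes>\<^bsub>Q\<^esub> y)"] by auto
  qed
qed

lemma relatorsI:
  "x \<in> carrier M \<Longrightarrow> x' \<in> carrier M \<Longrightarrow> y \<in> carrier Q \<Longrightarrow>
     frag_of (x \<oplus>\<^bsub>M\<^esub> x', y) - frag_of (x, y) - frag_of (x', y) \<in> tensor_relators R M N"
  "x \<in> carrier M \<Longrightarrow> y \<in> carrier Q \<Longrightarrow> y' \<in> carrier Q \<Longrightarrow>
     frag_of (x, y \<oplus>\<^bsub>Q\<^esub> y') - frag_of (x, y) - frag_of (x, y') \<in> tensor_relators R M N"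
  "r \<in> carrier R \<Longrightarrow> x \<in> carrier M \<Longrightarrow> y \<in> carrier Q \<Longrightarrow>
     frag_of (r \<odot>\<^bsub>M\<^esub> x, y) - frag_of (x, \<phi> r \<otimes>\<^bsub>Q\<^esub> y) \<in> tensor_relators R M N"
  unfolding tensor_relators_def N_simps by blast+

lemma subgroup_K: "subgroup K G"
  unfolding kernel_def' by (rule group.generate_is_subgroup[OF group_free_Abelian_group relators_closed])

lemma K_closed: "k \<in> K \<Longrightarrow> Poly_Mapping.keys k \<subseteq> carrier M \<times> carrier Q"
  using subsetD[OF subgroup.subset[OF subgroup_K], of k] by simp

lemma K_zero: "0 \<in> K"
  using subgroup.one_closed[OF subgroup_K] by simp

lemma K_add: "k \<in> K \<Longrightarrow> l \<in> K \<Longrightarrow> k + l \<in> K"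
  using subgroup.m_closed[OF subgroup_K, of k l] by simp

lemma K_minus: "k \<in> K \<Longrightarrow> - k \<in> K"
  using subgroup.m_inv_closed[OF subgroup_K, of k] K_closed[of k] by simp

lemma K_diff: "k \<in> K \<Longrightarrow> l \<in> K \<Longrightarrow> k - l \<in> K"
  using K_add[of k "- l"] K_minus[of l] by simp

lemma K_relator: "t \<in> tensor_relators R M N \<Longrightarrow> t \<in> K"
  unfolding kernel_def' by (rule generate.incl)

text \<open>Induction over the relations in terms of the addition of integer-valued functions.\<close>

lemma K_induct [consumes 1, case_names zero relator minus add]:
  assumes "k \<in> K" "P 0" "\<And>t. t \<in> tensor_relators R M N \<Longrightarrow> P t"
    "\<And>k. P k \<Longrightarrow> P (- k)" "\<And>k l. P k \<Longrightarrow> P l \<Longrightarrow> P (k + l)"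
  shows "P k"
  using assms(1) unfolding kernel_def'
proof (induction rule: generate.induct)
  case one
  then show ?case using assms(2) by simp
next
  case (incl h)
  then show ?case by (rule assms(3))
next
  case (inv h)
  have "Poly_Mapping.keys h \<subseteq> carrier M \<times> carrier Q" using subsetD[OF relators_closed inv] by simp
  then show ?case using assms(3,4) inv by simp
next
  case (eng h1 h2)
  then show ?case using assms(5) by simp
qed

lemma tensor_class_eq_iff: "tensor_class c = tensor_class c' \<longleftrightarrow> c - c' \<in> K"
proof
  assume "tensor_class c = tensor_class c'"
  moreover have "c \<in> tensor_class c" using K_zero by (auto simp: tensor_class_def image_iff intro: bexI[of _ 0])
  ultimately obtain k where "k \<in> K" "c = k + c'" by (auto simp: tensor_class_def)
  then show "c - c' \<in> K" by simp
next
  assume cc: "c - c' \<in> K"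
  show "tensor_class c = tensor_class c'"
  proof (intro equalityI subsetI)
    fix t assume "t \<in> tensor_class c"
    then obtain k where k: "k \<in> K" "t = k + c" by (auto simp: tensor_class_def)
    then have "t = (k + (c - c')) + c'" by simp
    then show "t \<in> tensor_class c'" unfolding tensor_class_def using K_add[OF k(1) cc] by blast
  next
    fix t assume "t \<in> tensor_class c'"
    then obtain k where k: "k \<in> K" "t = k + c'" by (auto simp: tensor_class_def)
    then have "t = (k - (c - c')) + c" by simp
    then show "t \<in> tensor_class c" unfolding tensor_class_def using K_diff[OF k(1) cc] by blast
  qed
qed

lemma r_coset_eq: "K #>\<^bsub>G\<^esub> c = tensor_class c"
  by (auto simp: r_coset_def tensor_class_def)

lemma carrier_V: "carrier V = tensor_class ` carrier G"
  unfolding extend_scalars_def Let_def tensor_group_def FactGroup_def RCOSETS_def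
  by (auto simp: r_coset_eq)

lemma zero_V: "\<zero>\<^bsub>V\<^esub> = tensor_class 0"
  unfolding extend_scalars_def Let_def tensor_group_def FactGroup_def
  by (simp add: tensor_class_def)

lemma add_V: "tensor_class c \<oplus>\<^bsub>V\<^esub> tensor_class c' = tensor_class (c + c')"
proof -
  have "tensor_class c <#>\<^bsub>G\<^esub> tensor_class c' = tensor_class (c + c')"
  proof (intro equalityI subsetI)
    fix t assume "t \<in> tensor_class c <#>\<^bsub>G\<^esub> tensor_class c'"
    then obtain k l where "k \<in> K" "l \<in> K" "t = (k + c) + (l + c')"
      by (auto simp: set_mult_def tensor_class_def)
    then have "k + l \<in> K" "t = (k + l) + (c + c')" by (auto intro: K_add)
    then show "t \<in> tensor_class (c + c')" unfolding tensor_class_def by blast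
  next
    fix t assume "t \<in> tensor_class (c + c')"
    then obtain k where k: "k \<in> K" "t = (k + c) + (0 + c')" by (auto simp: tensor_class_def add.assoc)
    then show "t \<in> tensor_class c <#>\<^bsub>G\<^esub> tensor_class c'"
      unfolding set_mult_def tensor_class_def using K_zero by force
  qed
  then show ?thesis by (simp add: extend_scalars_def Let_def tensor_group_def FactGroup_def)
qed

lemma scale_simps [simp]:
  "scale q 0 = 0" "scale q (frag_of (x, p)) = frag_of (x, q \<otimes>\<^bsub>Q\<^esub> p)"
  "scale q (c + c') = scale q c + scale q c'" "scale q (c - c') = scale q c - scale q c'"
  "scale q (- c) = - scale q c"
  by (simp_all add: scale_def frag_extend_add frag_extend_diff frag_extend_minus)

lemma G_induct [consumes 1, case_names zero diff frag]:
  assumes "Poly_Mapping.keys c \<subseteq> carrier M \<times> carrier Q" "P 0"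
    "\<And>c d. Poly_Mapping.keys c \<subseteq> carrier M \<times> carrier Q \<Longrightarrow> Poly_Mapping.keys d \<subseteq> carrier M \<times> carrier Q \<Longrightarrow>
      P c \<Longrightarrow> P d \<Longrightarrow> P (c - d)"
    "\<And>x p. x \<in> carrier M \<Longrightarrow> p \<in> carrier Q \<Longrightarrow> P (frag_of (x, p))"
  shows "P c"
  using assms(1)
  by (rule free_Abelian_group_induct[where P = P]) (use assms(2-4) in auto)

lemma scale_closed:
  assumes q: "q \<in> carrier Q" and c: "Poly_Mapping.keys c \<subseteq> carrier M \<times> carrier Q"
  shows "Poly_Mapping.keys (scale q c) \<subseteq> carrier M \<times> carrier Q"
  using c
proof (induction c rule: G_induct)
  case (diff x y)
  then show ?case using keys_diff[of "scale q x" "scale q y"] by auto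
qed (use q in auto)

lemma scale_K:
  assumes q: "q \<in> carrier Q" and k: "k \<in> K"
  shows "scale q k \<in> K"
  using k
proof (induction rule: K_induct)
  case (relator t)
  then consider
    (1) x x' y where "t = frag_of (x \<oplus>\<^bsub>M\<^esub> x', y) - frag_of (x, y) - frag_of (x', y)"
      "x \<in> carrier M" "x' \<in> carrier M" "y \<in> carrier Q"
    | (2) x y y' where "t = frag_of (x, y \<oplus>\<^bsub>Q\<^esub> y') - frag_of (x, y) - frag_of (x, y')"
      "x \<in> carrier M" "y \<in> carrier Q" "y' \<in> carrier Q"
    | (3) r x y where "t = frag_of (r \<odot>\<^bsub>M\<^esub> x, y) - frag_of (x, \<phi> r \<otimes>\<^bsub>Q\<^esub> y)"
      "r \<in> carrier R" "x \<in> carrier M" "y \<in> carrier Q"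
    unfolding tensor_relators_def by auto
  then show ?case
  proof cases
    case 1
    then show ?thesis using K_relator[OF relatorsI(1)[of x x' "q \<otimes>\<^bsub>Q\<^esub> y"]] q by simp
  next
    case 2
    then show ?thesis
      using K_relator[OF relatorsI(2)[of x "q \<otimes>\<^bsub>Q\<^esub> y" "q \<otimes>\<^bsub>Q\<^esub> y'"]] q by (simp add: Q.r_distr)
  next
    case 3
    then show ?thesis
      using K_relator[OF relatorsI(3)[of r x "q \<otimes>\<^bsub>Q\<^esub> y"]] q by (simp add: Q.m_lcomm)
  qed
qed (auto simp: K_zero K_minus K_add)

lemma smult_V:
  assumes q: "q \<in> carrier Q"
  shows "q \<odot>\<^bsub>V\<^esub> tensor_class c = tensor_class (scale q c)"
proof -
  have "tensor_class (scale q t) = tensor_class (scale q c)" if "t \<in> tensor_class c" for t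
  proof -
    obtain k where "k \<in> K" "t = k + c" using \<open>t \<in> tensor_class c\<close> by (auto simp: tensor_class_def)
    then show ?thesis using scale_K[OF q] by (simp add: tensor_class_eq_iff)
  qed
  moreover have "c \<in> tensor_class c" using K_zero by (auto simp: tensor_class_def image_iff intro: bexI[of _ 0])
  ultimately have "(\<Union>t\<in>tensor_class c. tensor_class (scale q t)) = tensor_class (scale q c)" by blast
  then show ?thesis
    by (simp add: extend_scalars_def Let_def scale_def[symmetric] r_coset_eq)
qed

lemma scale_add:
  assumes q: "q \<in> carrier Q" "q' \<in> carrier Q" and c: "Poly_Mapping.keys c \<subseteq> carrier M \<times> carrier Q"
  shows "scale (q \<oplus>\<^bsub>Q\<^esub> q') c - (scale q c + scale q' c) \<in> K"
  using c
proof (induction c rule: G_induct)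
  case (diff x y)
  then show ?case
    using K_diff[OF diff.IH] by (simp add: algebra_simps)
next
  case (frag x p)
  then show ?case
    using q K_relator[OF relatorsI(2)[of x "q \<otimes>\<^bsub>Q\<^esub> p" "q' \<otimes>\<^bsub>Q\<^esub> p"]]
    by (simp add: Q.l_distr algebra_simps)
qed (simp add: K_zero)

lemma scale_mult:
  assumes q: "q \<in> carrier Q" "q' \<in> carrier Q" and c: "Poly_Mapping.keys c \<subseteq> carrier M \<times> carrier Q"
  shows "scale (q \<otimes>\<^bsub>Q\<^esub> q') c = scale q (scale q' c)"
  using c
proof (induction c rule: G_induct)
  case (frag x p)
  then show ?case using q by (simp add: Q.m_assoc)
qed auto

lemma scale_one:
  assumes "Poly_Mapping.keys c \<subseteq> carrier M \<times> carrier Q"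
  shows "scale \<one>\<^bsub>Q\<^esub> c = c"
  using assms
proof (induction c rule: G_induct)
  case (frag x p)
  then show ?case by simp
qed auto

lemma vectorspace_V: "vectorspace Q V"
proof -
  have cl: "tensor_class c \<in> carrier V" if "Poly_Mapping.keys c \<subseteq> carrier M \<times> carrier Q" for c
    using that by (auto simp: carrier_V)
  have ex: "\<exists>c. v = tensor_class c \<and> Poly_Mapping.keys c \<subseteq> carrier M \<times> carrier Q" if "v \<in> carrier V" for v
    using that by (auto simp: carrier_V)
  have "module Q V"
  proof (rule module_criteria)
    show "cring Q" by (rule Q.is_cring)
    show "\<zero>\<^bsub>V\<^esub> \<in> carrier V" unfolding zero_V by (rule cl) simp
    show "\<forall>v w. v \<in> carrier V \<and> w \<in> carrier V \<longrightarrow> v \<oplus>\<^bsub>V\<^esub> w \<in> carrier V"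
    proof (intro allI impI)
      fix v w assume "v \<in> carrier V \<and> w \<in> carrier V"
      then obtain c d where "v = tensor_class c" "Poly_Mapping.keys c \<subseteq> carrier M \<times> carrier Q"
        "w = tensor_class d" "Poly_Mapping.keys d \<subseteq> carrier M \<times> carrier Q" using ex by metis
      then show "v \<oplus>\<^bsub>V\<^esub> w \<in> carrier V" using keys_add[of c d] by (auto simp: add_V intro!: cl)
    qed
    show "\<forall>v\<in>carrier V. \<exists>w\<in>carrier V. v \<oplus>\<^bsub>V\<^esub> w = \<zero>\<^bsub>V\<^esub>"
    proof
      fix v assume "v \<in> carrier V"
      then obtain c where c: "v = tensor_class c" "Poly_Mapping.keys c \<subseteq> carrier M \<times> carrier Q" using ex by metis
      then show "\<exists>w\<in>carrier V. v \<oplus>\<^bsub>V\<^esub> w = \<zero>\<^bsub>V\<^esub>"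
        using cl[of "- c"] by (intro bexI[of _ "tensor_class (- c)"]) (auto simp: add_V zero_V)
    qed
    show "\<forall>q v. q \<in> carrier Q \<and> v \<in> carrier V \<longrightarrow> q \<odot>\<^bsub>V\<^esub> v \<in> carrier V"
      using scale_closed cl by (auto dest!: ex simp: smult_V)
    show "\<forall>v w. v \<in> carrier V \<and> w \<in> carrier V \<longrightarrow> v \<oplus>\<^bsub>V\<^esub> w = w \<oplus>\<^bsub>V\<^esub> v"
      by (auto dest!: ex simp: add_V add.commute)
    show "\<forall>v w x. v \<in> carrier V \<and> w \<in> carrier V \<and> x \<in> carrier V \<longrightarrow>
        v \<oplus>\<^bsub>V\<^esub> w \<oplus>\<^bsub>V\<^esub> x = v \<oplus>\<^bsub>V\<^esub> (w \<oplus>\<^bsub>V\<^esub> x)"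
      by (auto dest!: ex simp: add_V add.assoc)
    show "\<forall>v\<in>carrier V. v \<oplus>\<^bsub>V\<^esub> \<zero>\<^bsub>V\<^esub> = v"
      unfolding zero_V by (auto dest!: ex simp: add_V)
    show "\<forall>a b v. a \<in> carrier Q \<and> b \<in> carrier Q \<and> v \<in> carrier V \<longrightarrow>
        a \<otimes>\<^bsub>Q\<^esub> b \<odot>\<^bsub>V\<^esub> v = a \<odot>\<^bsub>V\<^esub> (b \<odot>\<^bsub>V\<^esub> v)"
      by (auto dest!: ex simp: smult_V scale_mult)
    show "\<forall>v\<in>carrier V. \<one>\<^bsub>Q\<^esub> \<odot>\<^bsub>V\<^esub> v = v"
      by (auto dest!: ex simp: smult_V scale_one)
    show "\<forall>a b v. a \<in> carrier Q \<and> b \<in> carrier Q \<and> v \<in> carrier V \<longrightarrow>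
        (a \<oplus>\<^bsub>Q\<^esub> b) \<odot>\<^bsub>V\<^esub> v = a \<odot>\<^bsub>V\<^esub> v \<oplus>\<^bsub>V\<^esub> b \<odot>\<^bsub>V\<^esub> v"
    proof (intro allI impI)
      fix a b v assume abv: "a \<in> carrier Q \<and> b \<in> carrier Q \<and> v \<in> carrier V"
      then obtain c where c: "v = tensor_class c" "Poly_Mapping.keys c \<subseteq> carrier M \<times> carrier Q" using ex by metis
      show "(a \<oplus>\<^bsub>Q\<^esub> b) \<odot>\<^bsub>V\<^esub> v = a \<odot>\<^bsub>V\<^esub> v \<oplus>\<^bsub>V\<^esub> b \<odot>\<^bsub>V\<^esub> v"
        using abv scale_add[of a b c] c by (simp add: smult_V add_V tensor_class_eq_iff)
    qed
    show "\<forall>a v w. a \<in> carrier Q \<and> v \<in> carrier V \<and> w \<in> carrier V \<longrightarrow>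
        a \<odot>\<^bsub>V\<^esub> (v \<oplus>\<^bsub>V\<^esub> w) = a \<odot>\<^bsub>V\<^esub> v \<oplus>\<^bsub>V\<^esub> a \<odot>\<^bsub>V\<^esub> w"
    proof (intro allI impI)
      fix a v w assume avw: "a \<in> carrier Q \<and> v \<in> carrier V \<and> w \<in> carrier V"
      then obtain c d where "v = tensor_class c" "w = tensor_class d" using ex by metis
      then show "a \<odot>\<^bsub>V\<^esub> (v \<oplus>\<^bsub>V\<^esub> w) = a \<odot>\<^bsub>V\<^esub> v \<oplus>\<^bsub>V\<^esub> a \<odot>\<^bsub>V\<^esub> w"
        using avw by (simp add: smult_V add_V)
    qed
  qed
  then show ?thesis by (intro vectorspace.intro field_Q)
qed

end


section \<open>Infinite rank\<close>

definition independent_family ::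
  "('r, 'z) ring_scheme \<Rightarrow> ('r, 'm) module \<Rightarrow> ('l \<Rightarrow> 'm) \<Rightarrow> bool" where
  "independent_family R M \<delta> \<longleftrightarrow>
     (\<forall>F r. finite F \<longrightarrow> (\<forall>l\<in>F. r l \<in> carrier R) \<longrightarrow> (\<Oplus>\<^bsub>M\<^esub>l\<in>F. r l \<odot>\<^bsub>M\<^esub> \<delta> l) = \<zero>\<^bsub>M\<^esub> \<longrightarrow>
       (\<forall>l\<in>F. r l = \<zero>\<^bsub>R\<^esub>))"

locale fraction_field_extension = scalar_extension R Q \<phi> M
  for R :: "('r, 'z) ring_scheme" and Q :: "('q, 'y) ring_scheme" and \<phi> :: "'r \<Rightarrow> 'q"
    and M :: "('r, 'm) module" +
  assumes fractions: "quotient_field R Q \<phi>"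
begin

lemma \<phi>_inj: "inj_on \<phi> (carrier R)"
  using fractions by (simp add: quotient_field_def)

lemma \<phi>_eq_zero: "r \<in> carrier R \<Longrightarrow> \<phi> r = \<zero>\<^bsub>Q\<^esub> \<longleftrightarrow> r = \<zero>\<^bsub>R\<^esub>"
  using inj_onD[OF \<phi>_inj, of r "\<zero>\<^bsub>R\<^esub>"] \<phi>.hom_zero by auto

definition denominators :: "'q \<Rightarrow> 'r set" where
  "denominators q = {b \<in> carrier R. \<phi> b \<otimes>\<^bsub>Q\<^esub> q \<in> \<phi> ` carrier R}"

definition numerator :: "'r \<Rightarrow> 'q \<Rightarrow> 'r" where
  "numerator b q = the_inv_into (carrier R) \<phi> (\<phi> b \<otimes>\<^bsub>Q\<^esub> q)"

lemma numerator:
  assumes "b \<in> denominators q"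
  shows "numerator b q \<in> carrier R" "\<phi> (numerator b q) = \<phi> b \<otimes>\<^bsub>Q\<^esub> q"
  using assms the_inv_into_into[OF \<phi>_inj, of "\<phi> b \<otimes>\<^bsub>Q\<^esub> q" "carrier R"]
    f_the_inv_into_f[OF \<phi>_inj, of "\<phi> b \<otimes>\<^bsub>Q\<^esub> q"]
  by (auto simp: denominators_def numerator_def)

lemma numerator_eqI:
  "r \<in> carrier R \<Longrightarrow> \<phi> r = \<phi> b \<otimes>\<^bsub>Q\<^esub> q \<Longrightarrow> numerator b q = r"
  unfolding numerator_def by (rule the_inv_into_f_eq[OF \<phi>_inj])

lemma denominators_mult:
  assumes a: "a \<in> carrier R" and b: "b \<in> denominators q" and q: "q \<in> carrier Q"
  shows "a \<otimes>\<^bsub>R\<^esub> b \<in> denominators q"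
proof -
  obtain r where r: "r \<in> carrier R" "\<phi> b \<otimes>\<^bsub>Q\<^esub> q = \<phi> r" and bc: "b \<in> carrier R"
    using b by (auto simp: denominators_def)
  have "\<phi> (a \<otimes>\<^bsub>R\<^esub> b) \<otimes>\<^bsub>Q\<^esub> q = \<phi> (a \<otimes>\<^bsub>R\<^esub> r)"
    using a r bc q by (simp add: Q.m_assoc)
  then show ?thesis using a r bc unfolding denominators_def by (simp del: \<phi>.hom_mult)
qed

lemma nonzero_mult:
  assumes "a \<in> carrier R - {\<zero>\<^bsub>R\<^esub>}" "b \<in> carrier R - {\<zero>\<^bsub>R\<^esub>}"
  shows "a \<otimes>\<^bsub>R\<^esub> b \<in> carrier R - {\<zero>\<^bsub>R\<^esub>}"
proof -
  have "\<phi> (a \<otimes>\<^bsub>R\<^esub> b) \<noteq> \<zero>\<^bsub>Q\<^esub>" using assms by (simp add: Q.integral_iff \<phi>_eq_zero)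
  then have "a \<otimes>\<^bsub>R\<^esub> b \<noteq> \<zero>\<^bsub>R\<^esub>" by (metis \<phi>.hom_zero)
  then show ?thesis using assms by simp
qed

lemma denominator_exists:
  assumes q: "q \<in> carrier Q"
  obtains b where "b \<in> carrier R - {\<zero>\<^bsub>R\<^esub>}" "b \<in> denominators q"
proof -
  obtain a b where ab: "a \<in> carrier R" "b \<in> carrier R - {\<zero>\<^bsub>R\<^esub>}" "q = \<phi> a \<otimes>\<^bsub>Q\<^esub> inv\<^bsub>Q\<^esub> (\<phi> b)"
    using fractions q unfolding quotient_field_def by blast
  have "\<phi> b \<in> Units Q" using ab(2) by (simp add: Q.field_Units \<phi>_eq_zero)
  then have "\<phi> b \<otimes>\<^bsub>Q\<^esub> q = \<phi> a"
    using ab by (simp add: Q.m_lcomm[of "\<phi> b"] Q.Units_r_inv)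
  then show thesis using ab that by (auto simp: denominators_def)
qed

lemma common_denominator_exists:
  assumes "finite F" "\<And>l. l \<in> F \<Longrightarrow> q l \<in> carrier Q"
  shows "\<exists>a\<in>carrier R - {\<zero>\<^bsub>R\<^esub>}. \<forall>l\<in>F. a \<in> denominators (q l)"
  using assms
proof (induction F rule: finite_induct)
  case empty
  have "\<phi> \<one>\<^bsub>R\<^esub> \<noteq> \<zero>\<^bsub>Q\<^esub>" by simp
  then have "\<one>\<^bsub>R\<^esub> \<noteq> \<zero>\<^bsub>R\<^esub>" using \<phi>_eq_zero[OF M.R.one_closed] by blast
  then show ?case using M.R.one_closed by blast
next
  case (insert l F)
  then obtain a where a: "a \<in> carrier R - {\<zero>\<^bsub>R\<^esub>}" "\<forall>l\<in>F. a \<in> denominators (q l)" by auto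
  obtain b where b: "b \<in> carrier R - {\<zero>\<^bsub>R\<^esub>}" "b \<in> denominators (q l)"
    using denominator_exists insert.prems by blast
  have "a \<otimes>\<^bsub>R\<^esub> b \<in> denominators (q l)" using a b insert.prems by (auto intro: denominators_mult)
  moreover have "a \<otimes>\<^bsub>R\<^esub> b \<in> denominators (q l')" if "l' \<in> F" for l'
    using denominators_mult[of b a "q l'"] a b that insert.prems by (auto simp: M.R.m_comm)
  ultimately show ?case using nonzero_mult[OF a(1) b(1)] by blast
qed

text \<open>
  Clearing the denominator \<open>b\<close> turns \<open>x \<otimes> q\<close> into \<open>(b q) \<odot> x\<close>. Where \<open>b q\<close> is not in \<open>R\<close>, the value is zero
  by default; for this reason relations are evaluated only at multiples of a common denominator.
\<close>

definition cleared :: "'r \<Rightarrow> 'm \<times> 'q \<Rightarrow> 'm" where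
  "cleared b k = (if b \<in> denominators (snd k) then numerator b (snd k) \<odot>\<^bsub>M\<^esub> fst k else \<zero>\<^bsub>M\<^esub>)"

definition clears :: "'r \<Rightarrow> (('m \<times> 'q \<Rightarrow>\<^sub>0 int) \<Rightarrow> 'm) \<Rightarrow> bool" where
  "clears b h \<longleftrightarrow> h \<in> hom G (add_monoid M) \<and> (\<forall>k\<in>carrier M \<times> carrier Q. h (frag_of k) = cleared b k)"

definition ev :: "'r \<Rightarrow> ('m \<times> 'q \<Rightarrow>\<^sub>0 int) \<Rightarrow> 'm" where
  "ev b = (SOME h. clears b h)"

lemma clears_ev: "clears b (ev b)"
proof -
  have img: "cleared b ` (carrier M \<times> carrier Q) \<subseteq> carrier (add_monoid M)"
    using numerator(1) by (auto simp: cleared_def)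
  obtain h where "h \<in> hom G (add_monoid M)" "\<And>k. k \<in> carrier M \<times> carrier Q \<Longrightarrow> h (frag_of k) = cleared b k"
    using comm_group.free_Abelian_group_universal[OF M.M.a_comm_group img] by blast
  then have "clears b h" unfolding clears_def by blast
  then have "\<exists>h. clears b h" by blast
  then show ?thesis unfolding ev_def by (rule someI_ex)
qed

lemma ev_hom: "ev b \<in> hom G (add_monoid M)"
  using clears_ev unfolding clears_def by blast

lemma ev_frag:
  assumes "x \<in> carrier M" "q \<in> carrier Q" "b \<in> denominators q"
  shows "ev b (frag_of (x, q)) = numerator b q \<odot>\<^bsub>M\<^esub> x"
proof -
  have "ev b (frag_of (x, q)) = cleared b (x, q)"
    using clears_ev[of b] assms(1,2) unfolding clears_def by blast
  then show ?thesis using assms(3) by (simp add: cleared_def)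
qed

lemma ev_closed: "Poly_Mapping.keys c \<subseteq> carrier M \<times> carrier Q \<Longrightarrow> ev b c \<in> carrier M"
  using hom_in_carrier[OF ev_hom, of c b] by simp

lemma ev_add:
  "Poly_Mapping.keys c \<subseteq> carrier M \<times> carrier Q \<Longrightarrow> Poly_Mapping.keys c' \<subseteq> carrier M \<times> carrier Q \<Longrightarrow>
     ev b (c + c') = ev b c \<oplus>\<^bsub>M\<^esub> ev b c'"
  using hom_mult[OF ev_hom, of c c' b] by simp

lemma ev_zero: "ev b 0 = \<zero>\<^bsub>M\<^esub>"
proof -
  have "ev b 0 \<oplus>\<^bsub>M\<^esub> ev b 0 = ev b 0" using ev_add[of 0 0 b] by simp
  then show ?thesis using ev_closed[of 0 b] by simp
qed

lemma ev_minus: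
  assumes c: "Poly_Mapping.keys c \<subseteq> carrier M \<times> carrier Q"
  shows "ev b (- c) = \<ominus>\<^bsub>M\<^esub> ev b c"
proof -
  have "ev b (- c) \<oplus>\<^bsub>M\<^esub> ev b c = \<zero>\<^bsub>M\<^esub>" using ev_add[of "- c" c b] c by (simp add: ev_zero)
  then show ?thesis using M.M.minus_equality ev_closed[of c b] ev_closed[of "- c" b] c by simp
qed

lemma ev_diff:
  "Poly_Mapping.keys c \<subseteq> carrier M \<times> carrier Q \<Longrightarrow> Poly_Mapping.keys c' \<subseteq> carrier M \<times> carrier Q \<Longrightarrow>
     ev b (c - c') = ev b c \<ominus>\<^bsub>M\<^esub> ev b c'"
  using ev_add[of c "- c'" b] by (simp add: ev_minus a_minus_def)

text \<open>
  This detects nonzero tensors without constructing the localization of \<open>M\<close>. Allowing all multiples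
  of the denominator \<open>b\<close> makes the property stable under addition: for a sum, the product of the two
  denominators works.
\<close>

lemma ev_K:
  assumes "k \<in> K"
  shows "\<exists>b\<in>carrier R - {\<zero>\<^bsub>R\<^esub>}. \<forall>a\<in>carrier R - {\<zero>\<^bsub>R\<^esub>}. ev (a \<otimes>\<^bsub>R\<^esub> b) k = \<zero>\<^bsub>M\<^esub>"
proof -
  have "Poly_Mapping.keys k \<subseteq> carrier M \<times> carrier Q \<and>
    (\<exists>b\<in>carrier R - {\<zero>\<^bsub>R\<^esub>}. \<forall>a\<in>carrier R - {\<zero>\<^bsub>R\<^esub>}. ev (a \<otimes>\<^bsub>R\<^esub> b) k = \<zero>\<^bsub>M\<^esub>)"
    using assms
  proof (induction rule: K_induct)
    case zero
    obtain b where "b \<in> carrier R - {\<zero>\<^bsub>R\<^esub>}" using denominator_exists[OF Q.zero_closed] by blast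
    then show ?case by (auto simp: ev_zero)
  next
    case (relator t)
    have ev_denominator: "ev (a \<otimes>\<^bsub>R\<^esub> b) (frag_of (x, q)) = numerator (a \<otimes>\<^bsub>R\<^esub> b) q \<odot>\<^bsub>M\<^esub> x"
      "numerator (a \<otimes>\<^bsub>R\<^esub> b) q \<in> carrier R" "\<phi> (numerator (a \<otimes>\<^bsub>R\<^esub> b) q) = \<phi> (a \<otimes>\<^bsub>R\<^esub> b) \<otimes>\<^bsub>Q\<^esub> q"
      if "a \<in> carrier R" "b \<in> denominators q" "q \<in> carrier Q" "x \<in> carrier M" for a b x q
      using ev_frag[OF that(4,3)] denominators_mult[OF that(1,2,3)] numerator by auto
    from relator consider
      (1) x x' y where "t = frag_of (x \<oplus>\<^bsub>M\<^esub> x', y) - frag_of (x, y) - frag_of (x', y)"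
        "x \<in> carrier M" "x' \<in> carrier M" "y \<in> carrier Q"
      | (2) x y y' where "t = frag_of (x, y \<oplus>\<^bsub>Q\<^esub> y') - frag_of (x, y) - frag_of (x, y')"
        "x \<in> carrier M" "y \<in> carrier Q" "y' \<in> carrier Q"
      | (3) r x y where "t = frag_of (r \<odot>\<^bsub>M\<^esub> x, y) - frag_of (x, \<phi> r \<otimes>\<^bsub>Q\<^esub> y)"
        "r \<in> carrier R" "x \<in> carrier M" "y \<in> carrier Q"
      unfolding tensor_relators_def by auto
    then have "\<exists>b\<in>carrier R - {\<zero>\<^bsub>R\<^esub>}. \<forall>a\<in>carrier R - {\<zero>\<^bsub>R\<^esub>}. ev (a \<otimes>\<^bsub>R\<^esub> b) t = \<zero>\<^bsub>M\<^esub>"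
    proof cases
      case 1
      obtain b where b: "b \<in> carrier R - {\<zero>\<^bsub>R\<^esub>}" "b \<in> denominators y"
        using denominator_exists[OF 1(4)] by blast
      have "ev (a \<otimes>\<^bsub>R\<^esub> b) t = \<zero>\<^bsub>M\<^esub>" if a: "a \<in> carrier R" for a
      proof -
        note ev_y = ev_denominator[OF a b(2) 1(4)]
        have "ev (a \<otimes>\<^bsub>R\<^esub> b) t = ev (a \<otimes>\<^bsub>R\<^esub> b) (frag_of (x \<oplus>\<^bsub>M\<^esub> x', y))
            \<ominus>\<^bsub>M\<^esub> ev (a \<otimes>\<^bsub>R\<^esub> b) (frag_of (x, y)) \<ominus>\<^bsub>M\<^esub> ev (a \<otimes>\<^bsub>R\<^esub> b) (frag_of (x', y))"
          unfolding 1(1) using 1(2-4) keys_frag_diff[of "(x \<oplus>\<^bsub>M\<^esub> x', y)" "(x, y)"]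
          by (subst ev_diff, force, force) (subst ev_diff, force, force, simp)
        also have "\<dots> = \<zero>\<^bsub>M\<^esub>"
          using 1(2,3) ev_y(2)[OF 1(2)]
          by (simp add: ev_y(1) M.smult_r_distr a_minus_def M.M.a_assoc M.M.a_lcomm M.M.r_neg)
        finally show ?thesis .
      qed
      then show ?thesis using b(1) by blast
    next
      case 2
      obtain b where b: "b \<in> carrier R - {\<zero>\<^bsub>R\<^esub>}" "b \<in> denominators y"
        using denominator_exists[OF 2(3)] by blast
      obtain b' where b': "b' \<in> carrier R - {\<zero>\<^bsub>R\<^esub>}" "b' \<in> denominators y'"
        using denominator_exists[OF 2(4)] by blast
      have bb: "b \<otimes>\<^bsub>R\<^esub> b' \<in> carrier R" using b b' by auto
      have dy': "b \<otimes>\<^bsub>R\<^esub> b' \<in> denominators y'"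
        by (rule denominators_mult) (use b b' 2 in auto)
      have dy: "b \<otimes>\<^bsub>R\<^esub> b' \<in> denominators y"
        using denominators_mult[of b' b y] b b' 2 by (simp add: M.R.m_comm)
      have "\<phi> (b \<otimes>\<^bsub>R\<^esub> b') \<otimes>\<^bsub>Q\<^esub> (y \<oplus>\<^bsub>Q\<^esub> y')
          = \<phi> (numerator (b \<otimes>\<^bsub>R\<^esub> b') y \<oplus>\<^bsub>R\<^esub> numerator (b \<otimes>\<^bsub>R\<^esub> b') y')"
        using numerator[OF dy] numerator[OF dy'] 2 bb
        by (simp only: \<phi>.hom_add Q.r_distr \<phi>.hom_closed)
      then have dsum: "b \<otimes>\<^bsub>R\<^esub> b' \<in> denominators (y \<oplus>\<^bsub>Q\<^esub> y')"
        using numerator(1)[OF dy] numerator(1)[OF dy'] bb unfolding denominators_def by blast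
      have "ev (a \<otimes>\<^bsub>R\<^esub> (b \<otimes>\<^bsub>R\<^esub> b')) t = \<zero>\<^bsub>M\<^esub>" if a: "a \<in> carrier R" for a
      proof -
        let ?c = "a \<otimes>\<^bsub>R\<^esub> (b \<otimes>\<^bsub>R\<^esub> b')"
        note ev_y = ev_denominator[OF a dy 2(3,2)] and ev_y' = ev_denominator[OF a dy' 2(4,2)]
          and ev_sum = ev_denominator[OF a dsum Q.a_closed[OF 2(3,4)] 2(2)]
        have "numerator ?c (y \<oplus>\<^bsub>Q\<^esub> y') = numerator ?c y \<oplus>\<^bsub>R\<^esub> numerator ?c y'"
        proof (rule numerator_eqI)
          show "numerator ?c y \<oplus>\<^bsub>R\<^esub> numerator ?c y' \<in> carrier R" using ev_y(2) ev_y'(2) by simp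
          have "?c \<in> carrier R" using a bb by simp
          then show "\<phi> (numerator ?c y \<oplus>\<^bsub>R\<^esub> numerator ?c y') = \<phi> ?c \<otimes>\<^bsub>Q\<^esub> (y \<oplus>\<^bsub>Q\<^esub> y')"
            using ev_y(2,3) ev_y'(2,3) 2(3,4) by (simp only: \<phi>.hom_add Q.r_distr \<phi>.hom_closed)
        qed
        then have "ev ?c (frag_of (x, y \<oplus>\<^bsub>Q\<^esub> y')) = numerator ?c y \<odot>\<^bsub>M\<^esub> x \<oplus>\<^bsub>M\<^esub> numerator ?c y' \<odot>\<^bsub>M\<^esub> x"
          using ev_sum(1) ev_y(2) ev_y'(2) 2(2) by (simp add: M.smult_l_distr)
        moreover have "ev ?c t = ev ?c (frag_of (x, y \<oplus>\<^bsub>Q\<^esub> y')) \<ominus>\<^bsub>M\<^esub> ev ?c (frag_of (x, y)) \<ominus>\<^bsub>M\<^esub> ev ?c (frag_of (x, y'))"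
          unfolding 2(1) using 2(2-4) keys_frag_diff[of "(x, y \<oplus>\<^bsub>Q\<^esub> y')" "(x, y)"]
          by (subst ev_diff, force, force) (subst ev_diff, force, force, simp)
        ultimately show ?thesis
          using ev_y(2) ev_y'(2) 2(2) 
          by (simp add: ev_y(1) ev_y'(1) a_minus_def M.M.a_assoc M.M.a_lcomm M.M.r_neg)
      qed
      then show ?thesis using nonzero_mult[OF b(1) b'(1)] by blast
    next
      case 3
      obtain b where b: "b \<in> carrier R - {\<zero>\<^bsub>R\<^esub>}" "b \<in> denominators y"
        using denominator_exists[OF 3(4)] by blast
      have bc: "b \<in> carrier R" using b(1) by simp
      have ry: "\<phi> r \<otimes>\<^bsub>Q\<^esub> y \<in> carrier Q" using 3 by simp
      have "\<phi> b \<otimes>\<^bsub>Q\<^esub> (\<phi> r \<otimes>\<^bsub>Q\<^esub> y) = \<phi> (r \<otimes>\<^bsub>R\<^esub> numerator b y)"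
        using numerator[OF b(2)] 3 bc by (simp add: Q.m_lcomm)
      then have dry: "b \<in> denominators (\<phi> r \<otimes>\<^bsub>Q\<^esub> y)"
        using numerator(1)[OF b(2)] 3(2) bc unfolding denominators_def by (simp del: \<phi>.hom_mult)
      have "ev (a \<otimes>\<^bsub>R\<^esub> b) t = \<zero>\<^bsub>M\<^esub>" if a: "a \<in> carrier R" for a
      proof -
        let ?c = "a \<otimes>\<^bsub>R\<^esub> b"
        have cc: "?c \<in> carrier R" using a bc by simp
        note ev_y = ev_denominator[OF a b(2) 3(4) M.smult_closed[OF 3(2,3)]]
          and ev_ry = ev_denominator[OF a dry ry 3(3)]
        have "numerator ?c (\<phi> r \<otimes>\<^bsub>Q\<^esub> y) = numerator ?c y \<otimes>\<^bsub>R\<^esub> r"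
          by (rule numerator_eqI)
             (use ev_y(2,3) 3(2,4) cc in \<open>simp_all add: Q.m_assoc Q.m_comm[of y] del: \<phi>.hom_mult add: \<phi>.hom_mult[of "numerator ?c y" r]\<close>)
        then have "ev ?c (frag_of (x, \<phi> r \<otimes>\<^bsub>Q\<^esub> y)) = ev ?c (frag_of (r \<odot>\<^bsub>M\<^esub> x, y))"
          using ev_y ev_ry 3(2,3) by (simp add: M.smult_assoc1)
        moreover have "ev ?c t = ev ?c (frag_of (r \<odot>\<^bsub>M\<^esub> x, y)) \<ominus>\<^bsub>M\<^esub> ev ?c (frag_of (x, \<phi> r \<otimes>\<^bsub>Q\<^esub> y))"
          unfolding 3(1) by (rule ev_diff) (use 3 ry in auto)
        moreover have "ev ?c (frag_of (r \<odot>\<^bsub>M\<^esub> x, y)) \<in> carrier M" by (rule ev_closed) (use 3 in auto)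
        ultimately show ?thesis by simp
      qed
      then show ?thesis using b(1) by blast
    qed
    moreover have "Poly_Mapping.keys t \<subseteq> carrier M \<times> carrier Q"
      using subsetD[OF relators_closed relator] by simp
    ultimately show ?case by blast
  next
    case (minus k)
    have minus_zero: "\<ominus>\<^bsub>M\<^esub> \<zero>\<^bsub>M\<^esub> = \<zero>\<^bsub>M\<^esub>" by (rule M.M.minus_equality) simp_all
    obtain b where b: "b \<in> carrier R - {\<zero>\<^bsub>R\<^esub>}" "\<forall>a\<in>carrier R - {\<zero>\<^bsub>R\<^esub>}. ev (a \<otimes>\<^bsub>R\<^esub> b) k = \<zero>\<^bsub>M\<^esub>"
      using minus.IH by blast
    have "\<forall>a\<in>carrier R - {\<zero>\<^bsub>R\<^esub>}. ev (a \<otimes>\<^bsub>R\<^esub> b) (- k) = \<zero>\<^bsub>M\<^esub>"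
      using b(2) minus.IH by (simp add: ev_minus minus_zero)
    then show ?case using b(1) minus.IH by (simp only: keys_minus) blast
  next
    case (add k l)
    obtain b where b: "b \<in> carrier R - {\<zero>\<^bsub>R\<^esub>}" "\<forall>a\<in>carrier R - {\<zero>\<^bsub>R\<^esub>}. ev (a \<otimes>\<^bsub>R\<^esub> b) k = \<zero>\<^bsub>M\<^esub>"
      using add.IH(1) by blast
    obtain b' where b': "b' \<in> carrier R - {\<zero>\<^bsub>R\<^esub>}" "\<forall>a\<in>carrier R - {\<zero>\<^bsub>R\<^esub>}. ev (a \<otimes>\<^bsub>R\<^esub> b') l = \<zero>\<^bsub>M\<^esub>"
      using add.IH(2) by blast
    have keys_cl: "Poly_Mapping.keys k \<subseteq> carrier M \<times> carrier Q" "Poly_Mapping.keys l \<subseteq> carrier M \<times> carrier Q" using add.IH by auto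
    have "ev (a \<otimes>\<^bsub>R\<^esub> (b \<otimes>\<^bsub>R\<^esub> b')) (k + l) = \<zero>\<^bsub>M\<^esub>" if a: "a \<in> carrier R - {\<zero>\<^bsub>R\<^esub>}" for a
    proof -
      have c: "a \<in> carrier R" "b \<in> carrier R" "b' \<in> carrier R" using a b b' by auto
      have "ev (a \<otimes>\<^bsub>R\<^esub> b' \<otimes>\<^bsub>R\<^esub> b) k = \<zero>\<^bsub>M\<^esub>" using b(2) nonzero_mult[OF a b'(1)] by blast
      moreover have "ev (a \<otimes>\<^bsub>R\<^esub> b \<otimes>\<^bsub>R\<^esub> b') l = \<zero>\<^bsub>M\<^esub>" using b'(2) nonzero_mult[OF a b(1)] by blast
      moreover have "a \<otimes>\<^bsub>R\<^esub> b' \<otimes>\<^bsub>R\<^esub> b = a \<otimes>\<^bsub>R\<^esub> (b \<otimes>\<^bsub>R\<^esub> b')" "a \<otimes>\<^bsub>R\<^esub> b \<otimes>\<^bsub>R\<^esub> b' = a \<otimes>\<^bsub>R\<^esub> (b \<otimes>\<^bsub>R\<^esub> b')"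
        using c by (simp_all add: M.R.m_ac)
      ultimately show ?thesis using ev_add[OF keys_cl] by simp
    qed
    moreover have "Poly_Mapping.keys (k + l) \<subseteq> carrier M \<times> carrier Q" using keys_cl keys_add[of k l] by blast
    ultimately show ?case using nonzero_mult[OF b(1) b'(1)] by blast
  qed
  then show ?thesis by blast
qed

lemma keys_sum_frag:
  assumes "finite F" "\<And>l. l \<in> F \<Longrightarrow> f l \<in> S"
  shows "Poly_Mapping.keys (\<Sum>l\<in>F. frag_of (f l)) \<subseteq> S"
  using assms
proof (induction F rule: finite_induct)
  case (insert l F)
  then show ?case using keys_add[of "frag_of (f l)" "\<Sum>l\<in>F. frag_of (f l)"] by auto
qed simp

text \<open>
  Evaluate a vanishing combination of tensors \<open>\<delta> l \<otimes> q l\<close> at a number \<open>c\<close> that is a multiple both of a common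
  denominator of the \<open>q l\<close> and of the denominator supplied by \<open>ev_K\<close>. The result is a linear relation
  over \<open>R\<close> with coefficients \<open>c q l\<close>.
\<close>

lemma tensor_independent:
  assumes \<delta>: "\<And>l. \<delta> l \<in> carrier M"
    and independent: "independent_family R M \<delta>"
    and F: "finite F" and q: "\<And>l. l \<in> F \<Longrightarrow> q l \<in> carrier Q"
    and zero: "(\<Sum>l\<in>F. frag_of (\<delta> l, q l)) \<in> K"
  shows "\<forall>l\<in>F. q l = \<zero>\<^bsub>Q\<^esub>"
proof
  fix l assume l: "l \<in> F"
  obtain b where b: "b \<in> carrier R - {\<zero>\<^bsub>R\<^esub>}"
    and ev0: "\<forall>a\<in>carrier R - {\<zero>\<^bsub>R\<^esub>}. ev (a \<otimes>\<^bsub>R\<^esub> b) (\<Sum>l\<in>F. frag_of (\<delta> l, q l)) = \<zero>\<^bsub>M\<^esub>"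
    using bexE[OF ev_K[OF zero]] .
  have "\<exists>a\<in>carrier R - {\<zero>\<^bsub>R\<^esub>}. \<forall>l\<in>F. a \<in> denominators (q l)"
    by (rule common_denominator_exists[OF F q])
  then obtain a where a: "a \<in> carrier R - {\<zero>\<^bsub>R\<^esub>}" "\<forall>l\<in>F. a \<in> denominators (q l)" ..
  let ?c = "a \<otimes>\<^bsub>R\<^esub> b"
  have c: "?c \<in> carrier R - {\<zero>\<^bsub>R\<^esub>}" by (rule nonzero_mult[OF a(1) b])
  have denom: "?c \<in> denominators (q l)" if "l \<in> F" for l
    using denominators_mult[of b a "q l"] a b q that by (auto simp: M.R.m_comm)
  have "ev ?c (\<Sum>l\<in>F. frag_of (\<delta> l, q l)) = (\<Oplus>\<^bsub>M\<^esub>l\<in>F. numerator ?c (q l) \<odot>\<^bsub>M\<^esub> \<delta> l)"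
    using F q denom
  proof (induction F rule: finite_induct)
    case empty
    then show ?case by (simp add: ev_zero)
  next
    case (insert l F)
    have keys_cl: "Poly_Mapping.keys (\<Sum>l\<in>F. frag_of (\<delta> l, q l)) \<subseteq> carrier M \<times> carrier Q"
      by (rule keys_sum_frag) (use insert \<delta> in auto)
    have "ev ?c (\<Sum>l\<in>insert l F. frag_of (\<delta> l, q l))
        = ev ?c (frag_of (\<delta> l, q l)) \<oplus>\<^bsub>M\<^esub> ev ?c (\<Sum>l\<in>F. frag_of (\<delta> l, q l))"
      using insert.hyps insert.prems \<delta> keys_cl by (simp add: ev_add)
    also have "\<dots> = numerator ?c (q l) \<odot>\<^bsub>M\<^esub> \<delta> l \<oplus>\<^bsub>M\<^esub> (\<Oplus>\<^bsub>M\<^esub>l\<in>F. numerator ?c (q l) \<odot>\<^bsub>M\<^esub> \<delta> l)"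
      using insert.IH insert.prems \<delta> by (simp add: ev_frag)
    also have "\<dots> = (\<Oplus>\<^bsub>M\<^esub>l\<in>insert l F. numerator ?c (q l) \<odot>\<^bsub>M\<^esub> \<delta> l)"
      using insert.hyps insert.prems numerator \<delta> by (subst M.finsum_insert) auto
    finally show ?case .
  qed
  then have "(\<Oplus>\<^bsub>M\<^esub>l\<in>F. numerator ?c (q l) \<odot>\<^bsub>M\<^esub> \<delta> l) = \<zero>\<^bsub>M\<^esub>" using ev0 a(1) by simp
  then have "numerator ?c (q l) = \<zero>\<^bsub>R\<^esub>"
    using independent[unfolded independent_family_def, rule_format, of F "\<lambda>l. numerator ?c (q l)" l]
      F numerator(1)[OF denom] l by simp
  then have "\<phi> ?c \<otimes>\<^bsub>Q\<^esub> q l = \<zero>\<^bsub>Q\<^esub>" using numerator(2)[OF denom[OF l]] by simp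
  moreover have "\<phi> ?c \<noteq> \<zero>\<^bsub>Q\<^esub>" "\<phi> ?c \<in> carrier Q" using c \<phi>_eq_zero by auto
  ultimately show "q l = \<zero>\<^bsub>Q\<^esub>" using q[OF l] Q.integral_iff by blast
qed

lemma infinite_rank:
  fixes \<delta> :: "nat \<Rightarrow> 'm"
  assumes \<delta>: "\<And>l. \<delta> l \<in> carrier M"
    and independent: "independent_family R M \<delta>"
  shows "\<not> vectorspace.fin_dim Q V"
proof
  interpret V: vectorspace Q V by (rule vectorspace_V)
  assume fin_dim: "V.fin_dim"
  have indep: "\<forall>l\<in>F. q l = \<zero>\<^bsub>Q\<^esub>"
    if "finite F" "\<And>l. l \<in> F \<Longrightarrow> q l \<in> carrier Q" "(\<Sum>l\<in>F. frag_of (\<delta> l, q l)) \<in> K" for F q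
    by (rule tensor_independent[OF \<delta> independent that])
  define u where "u l = tensor_class (frag_of (\<delta> l, \<one>\<^bsub>Q\<^esub>))" for l
  have u: "u l \<in> carrier V" for l using \<delta> by (auto simp: u_def carrier_V)
  have "inj u"
  proof (rule injI, rule ccontr)
    fix l l' assume eq: "u l = u l'" and "l \<noteq> l'"
    let ?q = "\<lambda>m. if m = l then \<one>\<^bsub>Q\<^esub> else \<ominus>\<^bsub>Q\<^esub> \<one>\<^bsub>Q\<^esub>"
    have "u l \<oplus>\<^bsub>V\<^esub> (\<ominus>\<^bsub>Q\<^esub> \<one>\<^bsub>Q\<^esub>) \<odot>\<^bsub>V\<^esub> u l' = \<zero>\<^bsub>V\<^esub>"
      using eq u by (simp add: V.smult_minus_1 V.M.r_neg)
    then have "tensor_class (\<Sum>m\<in>{l, l'}. frag_of (\<delta> m, ?q m)) = tensor_class 0"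
      using \<open>l \<noteq> l'\<close> by (simp add: u_def smult_V add_V zero_V)
    then have rel: "(\<Sum>m\<in>{l, l'}. frag_of (\<delta> m, ?q m)) \<in> K" by (simp only: tensor_class_eq_iff diff_zero)
    have "\<forall>m\<in>{l, l'}. ?q m = \<zero>\<^bsub>Q\<^esub>"
      by (rule indep[OF _ _ rel]) auto
    then have "\<one>\<^bsub>Q\<^esub> = \<zero>\<^bsub>Q\<^esub>" by auto
    then show False using Q.one_not_zero by blast
  qed
  have "V.lin_indpt (range u)"
  proof
    assume "V.lin_dep (range u)"
    then obtain A a v where A: "finite A" "A \<subseteq> range u" "a \<in> A \<rightarrow> carrier Q"
      "V.lincomb a A = \<zero>\<^bsub>V\<^esub>" "v \<in> A" "a v \<noteq> \<zero>\<^bsub>Q\<^esub>"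
      unfolding V.lin_dep_def by blast
    obtain F where F: "A = u ` F" using A(2) subset_imageE by metis
    have finF: "finite F" using A(1) \<open>inj u\<close> F finite_imageD inj_on_subset by blast
    have aF: "\<And>l. l \<in> F \<Longrightarrow> a (u l) \<in> carrier Q" using A(3) F by auto
    have "V.lincomb a A = (\<Oplus>\<^bsub>V\<^esub>l\<in>F. a (u l) \<odot>\<^bsub>V\<^esub> u l)"
      unfolding V.lincomb_def F
      by (rule V.finsum_reindex) (use aF u \<open>inj u\<close> in \<open>auto intro: inj_on_subset\<close>)
    also have "\<dots> = tensor_class (\<Sum>l\<in>F. frag_of (\<delta> l, a (u l)))"
      using finF aF
    proof (induction F rule: finite_induct)
      case empty
      then show ?case by (simp add: zero_V)
    next
      case (insert l F)
      have "(\<Oplus>\<^bsub>V\<^esub>l\<in>insert l F. a (u l) \<odot>\<^bsub>V\<^esub> u l)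
          = a (u l) \<odot>\<^bsub>V\<^esub> u l \<oplus>\<^bsub>V\<^esub> (\<Oplus>\<^bsub>V\<^esub>l\<in>F. a (u l) \<odot>\<^bsub>V\<^esub> u l)"
        using insert u by (subst V.finsum_insert) auto
      also have "\<dots> = tensor_class (frag_of (\<delta> l, a (u l))) \<oplus>\<^bsub>V\<^esub> tensor_class (\<Sum>l\<in>F. frag_of (\<delta> l, a (u l)))"
      proof -
        have "a (u l) \<odot>\<^bsub>V\<^esub> u l = tensor_class (frag_of (\<delta> l, a (u l)))"
          using insert.prems smult_V[of "a (u l)" "frag_of (\<delta> l, \<one>\<^bsub>Q\<^esub>)"] by (simp add: u_def)
        then show ?thesis using insert.IH insert.prems by simp
      qed
      finally show ?case using insert.hyps by (simp add: add_V)
    qed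
    finally have "tensor_class (\<Sum>l\<in>F. frag_of (\<delta> l, a (u l))) = tensor_class 0"
      using A(4) by (simp only: zero_V)
    then have "(\<Sum>l\<in>F. frag_of (\<delta> l, a (u l))) \<in> K" by (simp only: tensor_class_eq_iff diff_zero)
    then have "\<forall>l\<in>F. a (u l) = \<zero>\<^bsub>Q\<^esub>" by (intro indep finF aF)
    then show False using A(5,6) F by blast
  qed
  moreover have "range u \<subseteq> carrier V" using u by blast
  ultimately have "finite (range u)" using V.fin_dim_li_fin[OF fin_dim] by blast
  then show False using \<open>inj u\<close> finite_imageD by blast
qed

end


section \<open>Independent homomorphisms from local cohomology to the injective hull\<close>

text \<open>
  Two features of these exponents matter. As long as \<open>l\<close> is bounded, the cubic term makes the step from
  \<open>t\<close> to \<open>t + 1\<close> exceed both any constant and the spread of the linear terms (\<open>growth_gap\<close>); and for the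
  same large \<open>t\<close>, different \<open>l\<close> are separated by more than any constant (\<open>growth_slope\<close>).
\<close>

definition growth :: "nat \<Rightarrow> nat \<Rightarrow> nat" where
  "growth l t = t ^ 3 + l * t"

lemma growth_gap:
  assumes "t < u" "l \<le> B" "B + C < u"
  shows "growth l t + C < growth l' u"
proof -
  obtain v where u: "u = Suc v" "t \<le> v" "B + C \<le> v" using assms(1,3) by (cases u) auto
  have "growth l t \<le> v ^ 3 + B * v"
    unfolding growth_def using u(2) assms(2) by (intro add_mono mult_mono power_mono) auto
  moreover have "B * v \<le> v * v" "C \<le> v" using u(3) by auto
  moreover have "growth l' u \<ge> v ^ 3 + v * v + v + 1"
    unfolding growth_def u(1) by (simp add: power3_eq_cube algebra_simps)
  ultimately show ?thesis by linarith
qed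

lemma growth_slope:
  assumes "l < l'" "C < u"
  shows "growth l u + C < growth l' u"
proof -
  have "Suc l * u \<le> l' * u" using assms(1) by (intro mult_right_mono) auto
  then show ?thesis using assms(2) by (simp add: growth_def)
qed

locale split_variables = inverse_system n R E w
  for n :: nat and R :: "(nat multiset \<Rightarrow> 'k::field) ring" (structure)
    and E :: "(nat multiset \<Rightarrow> 'k, 'h) module" and w :: "nat \<Rightarrow> 'h" +
  fixes i :: nat
  assumes i: "1 \<le> i" "i < n"
begin

definition node :: "nat \<Rightarrow> nat \<Rightarrow> nat \<Rightarrow> nat multiset" where
  "node s l t = repeat_mset (s - 1 - t) (mset_set {1..i}) + repeat_mset (growth l t) (mset_set {Suc i..n})"

text \<open>
  For fixed \<open>l\<close>, these inverse polynomials are the truncations of the formal sum over \<open>t\<close> of the terms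
  \<open>(X\<^sub>1 \<cdots> X\<^sub>i)\<^sup>t (X\<^bsub>i+1\<^esub> \<cdots> X\<^sub>n)\<^sup>-\<^sup>c\<close> with \<open>c = growth l t\<close>, divided by \<open>(X\<^sub>1 \<cdots> X\<^sub>i)\<^bsup>s-1\<^esup>\<close>.
\<close>

definition nodes :: "nat \<Rightarrow> nat \<Rightarrow> (nat multiset \<Rightarrow> 'k)" where
  "nodes l s = (\<lambda>m. if \<exists>t<s. m = node s l t then 1 else 0)"

lemma count_node:
  "count (node s l t) j =
     (if j \<in> {1..i} then s - 1 - t else if j \<in> {Suc i..n} then growth l t else 0)"
  by (auto simp: node_def count_mset_set')

lemma nodes_supported:
  assumes "s + growth l s \<le> N"
  shows "supported N (nodes l s)"
proof -
  have "node s l t \<subseteq># box N" if "t < s" for t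
  proof -
    have "growth l t \<le> growth l s"
      unfolding growth_def using that by (intro add_mono mult_mono power_mono) auto
    then show ?thesis
      using assms i by (auto simp: subseteq_mset_def count_node count_box)
  qed
  then show ?thesis by (auto simp: supported_def nodes_def split: if_splits)
qed

lemma var_product_nodes:
  "var_product i 1 \<odot>\<^bsub>E\<^esub> inverse_polynomial (nodes l (Suc s)) = inverse_polynomial (nodes l s)"
proof -
  let ?P = "mset_set {1..i}"
  have node_Suc: "node (Suc s) l t = node s l t + ?P" if "t < s" for t
  proof (rule multiset_eqI)
    fix j show "count (node (Suc s) l t) j = count (node s l t + ?P) j"
      using that by (auto simp: count_node count_mset_set')
  qed
  have "nodes l (Suc s) (m + ?P) = nodes l s m" for m
  proof -
    have "(\<exists>t<Suc s. m + ?P = node (Suc s) l t) \<longleftrightarrow> (\<exists>t<s. m = node s l t)"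
    proof
      assume "\<exists>t<Suc s. m + ?P = node (Suc s) l t"
      then obtain t where t: "t < Suc s" "m + ?P = node (Suc s) l t" by blast
      have "t \<noteq> s"
      proof
        assume "t = s"
        then have "count (m + ?P) 1 = 0" unfolding t(2) using i by (simp add: count_node)
        then show False using i by (simp add: count_mset_set')
      qed
      then have "t < s" using t(1) by simp
      moreover have "m = node s l t" using t(2) node_Suc[OF \<open>t < s\<close>] by simp
      ultimately show "\<exists>t<s. m = node s l t" by blast
    next
      assume "\<exists>t<s. m = node s l t"
      then obtain t where t: "t < s" "m = node s l t" by blast
      then have "m + ?P = node (Suc s) l t" using node_Suc by simp
      then show "\<exists>t<Suc s. m + ?P = node (Suc s) l t" using t(1) less_SucI by blast
    qed
    then show ?thesis by (simp add: nodes_def)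
  qed
  then have shift: "(\<lambda>m. nodes l (Suc s) (m + ?P)) = nodes l s" by (rule ext)
  have "monomial ?P \<odot>\<^bsub>E\<^esub> inverse_polynomial (nodes l (Suc s)) = inverse_polynomial (\<lambda>m. nodes l (Suc s) (m + ?P))"
    by (rule monomial_inverse_polynomial[OF _ nodes_supported[OF order.refl]]) (use i in auto)
  then show ?thesis unfolding shift by (simp add: var_product_def)
qed

lemma nodes_annihilated:
  assumes f: "f \<in> monomial_ideal i s"
  shows "f \<odot>\<^bsub>E\<^esub> inverse_polynomial (nodes l s) = \<zero>\<^bsub>E\<^esub>"
proof (rule monomial_ideal_annihilates[OF module_E _ _ _ f])
  show "inverse_polynomial (nodes l s) \<in> carrier E"
    by (rule inverse_polynomial_closed[OF nodes_supported[OF order.refl]])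
  show "i \<le> n" using i by simp
  fix j assume j: "j \<in> {1..i}"
  have "nodes l s (m + replicate_mset s j) = 0" for m
  proof -
    have "m + replicate_mset s j \<noteq> node s l t" if "t < s" for t
    proof
      assume "m + replicate_mset s j = node s l t"
      then have "count (m + replicate_mset s j) j = s - 1 - t" using j by (simp add: count_node)
      then show False using that by simp
    qed
    then show ?thesis by (auto simp: nodes_def)
  qed
  then have shift: "(\<lambda>m. nodes l s (m + replicate_mset s j)) = (\<lambda>m. 0)" by (rule ext)
  have "monomial (replicate_mset s j) \<odot>\<^bsub>E\<^esub> inverse_polynomial (nodes l s)
      = inverse_polynomial (\<lambda>m. nodes l s (m + replicate_mset s j))"
    by (rule monomial_inverse_polynomial[OF _ nodes_supported[OF order.refl]]) (use i j in auto)
  then show "monomial (replicate_mset s j) \<odot>\<^bsub>E\<^esub> inverse_polynomial (nodes l s) = \<zero>\<^bsub>E\<^esub>"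
    unfolding shift inverse_polynomial_zero .
qed

definition first_part :: "nat multiset \<Rightarrow> nat multiset" where
  "first_part a = filter_mset (\<lambda>j. j \<in> {1..i}) a"

text \<open>
  A leading term argument. Among the monomials \<open>a\<close> occurring in the coefficients \<open>r l\<close>, take one of
  minimal degree in \<open>X\<^sub>1, \<dots>, X\<^sub>i\<close>, and among the \<open>l\<close> for which such a monomial has the same part in these
  variables, take the largest. Let \<open>a0\<close> and \<open>l0\<close> be the result, and compare coefficients at
  \<open>\<mu> = node s l0 t0 - a0\<close> for a large \<open>t0\<close>. Another product of a monomial \<open>a\<close> of \<open>r l\<close> and a node with
  parameter \<open>t\<close> cannot contribute: for \<open>t < t0\<close> the power of \<open>X\<^sub>n\<close> is too small, for \<open>t > t0\<close> the monomial
  \<open>a\<close> would have smaller degree in \<open>X\<^sub>1, \<dots>, X\<^sub>i\<close>, and for \<open>t = t0\<close> both \<open>l < l0\<close> and \<open>l > l0\<close> are excluded, by the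
  power of \<open>X\<^sub>n\<close> and by the choice of \<open>l0\<close>.
\<close>

lemma nodes_independent:
  assumes F: "finite F" and r: "\<And>l. l \<in> F \<Longrightarrow> r l \<in> carrier R"
    and zero: "\<And>s. (\<Oplus>\<^bsub>E\<^esub>l\<in>F. r l \<odot>\<^bsub>E\<^esub> inverse_polynomial (nodes l s)) = \<zero>\<^bsub>E\<^esub>"
    and l: "l \<in> F"
  shows "r l = \<zero>"
proof (rule ccontr)
  assume "r l \<noteq> \<zero>"
  then have "\<exists>a. r l a \<noteq> 0" using coeff_eqI[of "r l" \<zero>] by (auto simp: coeff_zero)
  then obtain a where "r l a \<noteq> 0" by blast
  let ?P = "\<lambda>x. fst x \<in> F \<and> r (fst x) (snd x) \<noteq> 0" and ?m = "\<lambda>x. size (first_part (snd x))"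
  have "?P (l, a)" using l \<open>r l a \<noteq> 0\<close> by simp
  then obtain x where x: "?P x" and min_x: "\<And>y. ?P y \<Longrightarrow> ?m x \<le> ?m y"
    using ex_has_least_nat[of ?P "(l, a)" ?m] by blast
  define l1 a1 where "l1 = fst x" and "a1 = snd x"
  have l1: "l1 \<in> F" "r l1 a1 \<noteq> 0" using x by (simp_all add: l1_def a1_def)
  have min: "size (first_part a1) \<le> size (first_part a)" if "l \<in> F" "r l a \<noteq> 0" for l a
    using min_x[of "(l, a)"] that by (simp add: a1_def)
  define L where "L = {l \<in> F. \<exists>a. r l a \<noteq> 0 \<and> first_part a = first_part a1}"
  have L: "finite L" "L \<noteq> {}" using F l1 by (auto simp: L_def)
  define l0 where "l0 = Max L"
  have "l0 \<in> L" unfolding l0_def by (rule Max_in[OF L])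
  then obtain a0 where l0: "l0 \<in> F" and a0: "r l0 a0 \<noteq> 0" "first_part a0 = first_part a1"
    by (auto simp: L_def)
  have max: "l \<le> l0" if "l \<in> F" "r l a \<noteq> 0" "first_part a = first_part a0" for l a
    unfolding l0_def by (rule Max_ge[OF L(1)]) (use that a0(2) in \<open>auto simp: L_def\<close>)
  define B where "B = Max F"
  have B: "l \<le> B" if "l \<in> F" for l unfolding B_def by (rule Max_ge[OF F that])
  define C where "C = size a0"
  have C: "count a0 j \<le> C" for j unfolding C_def by (rule count_le_size)
  \<comment> \<open>From \<open>t0\<close> on, the gaps between the exponents exceed the degree of the chosen monomial.\<close>
  define t0 where "t0 = B + C + 1"
  define s where "s = t0 + C + 1"
  define N where "N = s + growth B s"
  have supp: "supported N (nodes l s)" if "l \<in> F" for l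
    by (rule nodes_supported) (use B[OF that] in \<open>simp add: N_def growth_def\<close>)
  let ?\<nu> = "node s l0 t0"
  have "t0 < s" by (simp add: s_def)
  then have \<nu>: "nodes l0 s ?\<nu> = 1" by (auto simp: nodes_def)
  have \<nu>_box: "?\<nu> \<subseteq># box N" using supp[OF l0] \<nu> by (simp add: supported_def)
  have "set_mset a0 \<subseteq> {1..n}" using r[OF l0] a0(1) unfolding carrier_iff by blast
  then have a0_outside: "count a0 j = 0" if "j \<notin> {1..n}" for j using that by (meson count_inI subsetD)
  have "t0 \<le> growth l0 t0"
    unfolding growth_def using self_le_power[of t0 3] by (simp add: t0_def trans_le_add1)
  then have "count a0 j \<le> count ?\<nu> j" for j
    using C[of j] a0_outside[of j] i by (auto simp: count_node s_def t0_def)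
  then have a0_\<nu>: "a0 \<subseteq># ?\<nu>" by (simp add: subseteq_mset_def)
  define \<mu> where "\<mu> = ?\<nu> - a0"
  have \<mu>: "\<mu> + a0 = ?\<nu>" using a0_\<nu> by (simp add: \<mu>_def)
  have \<mu>_box: "\<mu> \<subseteq># box N" using \<nu>_box unfolding \<mu>_def by (meson diff_subset_eq_self subset_mset.order_trans)
  have only: "l = l0 \<and> a = a0" if l: "l \<in> F" and la: "r l a \<noteq> 0" and node: "nodes l s (\<mu> + a) \<noteq> 0" for l a
  proof -
    obtain t where t: "t < s" "\<mu> + a = node s l t"
      using node by (auto simp: nodes_def split: if_splits)
    have cnt: "count (node s l0 t0) j + count a j = count (node s l t) j + count a0 j" for j
      unfolding t(2)[symmetric] \<mu>[symmetric] by simp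
    have last: "growth l0 t0 \<le> growth l t + C"
      using cnt[of n] C[of n] i by (simp add: count_node)
    have first: "s - 1 - t0 + count a j = s - 1 - t + count a0 j" if "j \<in> {1..i}" for j
      using cnt[of j] that by (simp add: count_node)
    have "\<not> t < t0"
    proof
      assume "t < t0"
      then have "growth l t + C < growth l0 t0"
        by (rule growth_gap[OF _ B[OF l]]) (simp add: t0_def)
      then show False using last by simp
    qed
    moreover have "\<not> t0 < t"
    proof
      assume "t0 < t"
      have smaller: "count a j < count a0 j" if "j \<in> {1..i}" for j
        using first[OF that] \<open>t0 < t\<close> t(1) by simp
      have "first_part a \<subseteq># first_part a0"
        using smaller by (auto simp: subseteq_mset_def first_part_def intro: less_imp_le)
      moreover have "first_part a \<noteq> first_part a0"
      proof
        assume "first_part a = first_part a0"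
        then have "count (first_part a) 1 = count (first_part a0) 1" by simp
        then show False using smaller[of 1] i by (simp add: first_part_def)
      qed
      ultimately have "size (first_part a) < size (first_part a0)"
        by (intro mset_subset_size) (simp add: subset_mset.le_neq_trans)
      then show False using min[OF l la] a0(2) by simp
    qed
    ultimately have t_eq: "t = t0" by simp
    have "count a j = count a0 j" if "j \<in> {1..i}" for j using first[OF that] t_eq by simp
    then have "first_part a = first_part a0"
      by (intro multiset_eqI) (simp add: first_part_def)
    then have "l \<le> l0" using max l la by blast
    moreover have "\<not> l < l0"
    proof
      assume "l < l0"
      then have "growth l t0 + C < growth l0 t0" by (rule growth_slope) (simp add: t0_def)
      then show False using last t_eq by simp
    qed
    ultimately have "l = l0" by simp
    then have "\<mu> + a = \<mu> + a0" using t(2) t_eq \<mu> by simp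
    then show ?thesis using \<open>l = l0\<close> by simp
  qed
  have "a0 \<subseteq># box N - \<mu>"
  proof -
    have "\<mu> + a0 \<subseteq># box N" using \<nu>_box \<mu> by simp
    then show ?thesis by (simp add: subset_mset.le_diff_conv2[OF \<mu>_box] add.commute)
  qed
  then have "(\<Sum>a | a \<subseteq># box N - \<mu>. r l0 a * nodes l0 s (\<mu> + a)) = r l0 a0 * nodes l0 s (\<mu> + a0)"
    by (rule sum_submultisets_single) (use only[OF l0] in force)
  moreover have "(\<Sum>a | a \<subseteq># box N - \<mu>. r l a * nodes l s (\<mu> + a)) = 0" if "l \<in> F" "l \<noteq> l0" for l
    by (rule sum.neutral) (use only[OF that(1)] that(2) in force)
  ultimately have "(\<Sum>l\<in>F. \<Sum>a | a \<subseteq># box N - \<mu>. r l a * nodes l s (\<mu> + a)) = r l0 a0 * nodes l0 s (\<mu> + a0)"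
    using sum.remove[OF F l0, of "\<lambda>l. \<Sum>a | a \<subseteq># box N - \<mu>. r l a * nodes l s (\<mu> + a)"] by simp
  moreover have "(\<Sum>l\<in>F. \<Sum>a | a \<subseteq># box N - \<mu>. r l a * nodes l s (\<mu> + a)) = 0"
    by (rule inverse_polynomial_relation[OF F r supp zero \<mu>_box])
  ultimately show False using a0(1) \<nu> \<mu> by simp
qed

end


section \<open>Local cohomology as a module of fractions\<close>

context resolution_of_power_series
begin

lemma carrier_torsion_module:
  assumes "p \<le> n" "I = Idl (mps_var ` {1..p})"
  shows "carrier (torsion_module R I (J j)) = torsion p j"
  by (simp add: torsion_module_def torsion_def ideal_power_torsion_iff[OF assms module_J] cong: conj_cong)

lemma submodule_cocycles_torsion: "submodule R (cocycles p \<inter> torsion p p) (J p)"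
proof (rule submodule.intro[OF module_J])
  interpret T: submodule R "torsion p p" "J p" by (rule submodule_torsion)
  show "cocycles p \<inter> torsion p p \<subseteq> carrier (J p)" using torsion_closed by blast
  show "\<zero>\<^bsub>J p\<^esub> \<in> cocycles p \<inter> torsion p p" by (simp add: cocycles_iff)
  show "v \<oplus>\<^bsub>J p\<^esub> u \<in> cocycles p \<inter> torsion p p"
    if "v \<in> cocycles p \<inter> torsion p p" "u \<in> cocycles p \<inter> torsion p p" for v u
    using that by (simp add: cocycles_iff)
  show "c \<odot>\<^bsub>J p\<^esub> v \<in> cocycles p \<inter> torsion p p" if "c \<in> carrier R" "v \<in> cocycles p \<inter> torsion p p" for c v
    using that by (simp add: cocycles_iff)
qed

text \<open>
  The classes of a fraction system generate the cohomology and have the annihilators of the fractions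
  \<open>1 / (X\<^sub>1 \<cdots> X\<^sub>p)\<^sup>s\<close>; so local cohomology is the direct limit of the quotients of the ring by the
  ideals \<open>(X\<^sub>1\<^sup>s, \<dots>, X\<^sub>p\<^sup>s)\<close>.
\<close>

lemma local_cohomology_fractions:
  assumes p: "p \<le> n" and I: "I = Idl (mps_var ` {1..p})"
  defines "H \<equiv> local_cohomology R I J d p"
  obtains h where "module R H" "\<And>s. h s \<in> carrier H"
    "\<And>s. var_product p 1 \<odot>\<^bsub>H\<^esub> h (Suc s) = h s"
    "\<And>x. x \<in> carrier H \<Longrightarrow> \<exists>r\<in>carrier R. \<exists>s. x = r \<odot>\<^bsub>H\<^esub> h s"
    "\<And>r s. r \<in> carrier R \<Longrightarrow> r \<odot>\<^bsub>H\<^esub> h s = \<zero>\<^bsub>H\<^esub> \<Longrightarrow> r \<in> monomial_ideal p s"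
proof -
  obtain g where g: "fraction_system p g" using fraction_system_exists[OF p] by blast
  note g' = fraction_systemD[OF g]
  let ?Z = "(J p)\<lparr>carrier := cocycles p \<inter> torsion p p\<rparr>" and ?B = "coboundaries p p"
  interpret Z: module R ?Z by (rule J.submodule_is_module[OF submodule_cocycles_torsion])
  interpret B: submodule R ?B "J p" by (rule submodule_coboundaries)
  have sub: "submodule R ?B ?Z"
    by (rule submodule.intro[OF Z.module_axioms])
       (use coboundaries_subset_torsion coboundaries_subset_cocycles in auto)
  have tm: "x \<in> carrier (torsion_module R I (J j)) \<longleftrightarrow> x \<in> torsion p j" for x j
    by (simp add: carrier_torsion_module[OF p I])
  have "mod_kernel (torsion_module R I (J p)) (torsion_module R I (J (Suc p))) (d p) = cocycles p \<inter> torsion p p"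
    unfolding mod_kernel_def tm using torsion_closed by (auto simp: cocycles_iff torsion_module_def)
  moreover have "torsion_coboundaries R I J d p = ?B"
    by (cases p) (auto simp: carrier_torsion_module[OF p I])
  ultimately have H: "H = quot_module R ?Z ?B" by (simp add: H_def local_cohomology_def)
  define h where "h s = ?B +>\<^bsub>?Z\<^esub> g s" for s
  have gZ: "g s \<in> carrier ?Z" for s using g'(1,3) torsionI[OF g'(2), of p s] by simp
  have smult: "r \<odot>\<^bsub>H\<^esub> h s = ?B +>\<^bsub>?Z\<^esub> (r \<odot>\<^bsub>J p\<^esub> g s)" if "r \<in> carrier R" for r s
    using smult_quot_module[OF sub that gZ] by (simp add: h_def H)
  show thesis
  proof
    show "module R H" unfolding H by (rule module_quot_module[OF sub])
    show "h s \<in> carrier H" for s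
      unfolding H carrier_quot_module[OF sub] h_def using gZ by (rule imageI)
    show "var_product p 1 \<odot>\<^bsub>H\<^esub> h (Suc s) = h s" for s
      unfolding smult[OF var_product_closed[OF p]] unfolding g'(4) h_def by (rule refl)
    show "\<exists>r\<in>carrier R. \<exists>s. x = r \<odot>\<^bsub>H\<^esub> h s" if "x \<in> carrier H" for x
    proof -
      obtain z where z: "x = ?B +>\<^bsub>?Z\<^esub> z" "z \<in> carrier ?Z"
        using \<open>x \<in> carrier H\<close> unfolding H carrier_quot_module[OF sub] by blast
      then obtain r s b where r: "r \<in> carrier R" and b: "b \<in> ?B" and eq: "z = r \<odot>\<^bsub>J p\<^esub> g s \<oplus>\<^bsub>J p\<^esub> b"
        using g'(5)[of z] by auto
      have bZ: "b \<in> carrier ?Z" using b submodule.subset[OF sub] by blast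
      have rgZ: "r \<odot>\<^bsub>J p\<^esub> g s \<in> carrier ?Z" using Z.smult_closed[OF r gZ] by simp
      have "x = (?B +>\<^bsub>?Z\<^esub> (r \<odot>\<^bsub>J p\<^esub> g s)) \<oplus>\<^bsub>H\<^esub> (?B +>\<^bsub>?Z\<^esub> b)"
        unfolding z(1) eq H using add_quot_module[OF sub rgZ bZ] by simp
      also have "?B +>\<^bsub>?Z\<^esub> b = \<zero>\<^bsub>H\<^esub>"
        unfolding H zero_quot_module[OF sub] using coset_eq_zero_iff[OF sub bZ] b by simp
      also have "(?B +>\<^bsub>?Z\<^esub> (r \<odot>\<^bsub>J p\<^esub> g s)) \<oplus>\<^bsub>H\<^esub> \<zero>\<^bsub>H\<^esub> = r \<odot>\<^bsub>H\<^esub> h s"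
      proof -
        interpret H: module R H unfolding H by (rule module_quot_module[OF sub])
        have "?B +>\<^bsub>?Z\<^esub> (r \<odot>\<^bsub>J p\<^esub> g s) \<in> carrier H"
          unfolding H carrier_quot_module[OF sub] using rgZ by (rule imageI)
        then show ?thesis unfolding smult[OF r] by (rule H.M.r_zero)
      qed
      finally show ?thesis using r by blast
    qed
    show "r \<in> monomial_ideal p s" if r: "r \<in> carrier R" and zero: "r \<odot>\<^bsub>H\<^esub> h s = \<zero>\<^bsub>H\<^esub>" for r s
    proof -
      have "r \<odot>\<^bsub>J p\<^esub> g s \<in> carrier ?Z" using Z.smult_closed[OF r gZ] by simp
      moreover have "?B +>\<^bsub>?Z\<^esub> (r \<odot>\<^bsub>J p\<^esub> g s) = ?B"
        using zero unfolding smult[OF r] unfolding H zero_quot_module[OF sub] .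
      ultimately have "r \<odot>\<^bsub>J p\<^esub> g s \<in> ?B" using coset_eq_zero_iff[OF sub] by blast
      then show ?thesis by (rule g'(6)[OF r])
    qed
  qed
qed

end

theorem theorem2p3:
  fixes n i :: nat
    and R :: "(nat multiset \<Rightarrow> 'k::field) ring"
    and I \<mm> :: "(nat multiset \<Rightarrow> 'k) set"
    and Q :: "'q ring" and \<phi> :: "(nat multiset \<Rightarrow> 'k) \<Rightarrow> 'q"
    and E :: "(nat multiset \<Rightarrow> 'k, 'h) module" and \<iota> :: "(nat multiset \<Rightarrow> 'k) set \<Rightarrow> 'h"
    and J :: "nat \<Rightarrow> (nat multiset \<Rightarrow> 'k, 'e) module" and d :: "nat \<Rightarrow> 'e \<Rightarrow> 'e"
    and \<epsilon> :: "(nat multiset \<Rightarrow> 'k) \<Rightarrow> 'e"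
  assumes "n \<ge> 2" and "1 \<le> i" and "i < n"
    and "R = mps_ring n"
    and "I = Idl\<^bsub>R\<^esub> (mps_var ` {1..i})"
    and "maximalideal \<mm> R"
    and "injective_hull R (quot_module R (regular_module R) \<mm>) E \<iota>"
    and "injective_resolution R (regular_module R) J d \<epsilon>"
    and "quotient_field R Q \<phi>"
  shows "vectorspace Q (extend_scalars R Q \<phi> (matlis_dual R E (local_cohomology R I J d i))) \<and>
         \<not> vectorspace.fin_dim Q (extend_scalars R Q \<phi> (matlis_dual R E (local_cohomology R I J d i)))"
proof -
  interpret resolution_of_power_series n R J d \<epsilon>
    by unfold_locales (use assms in auto)
  have i_le: "i \<le> n" using assms(3) by simp
  obtain e where e: "e \<in> carrier E" "e \<noteq> \<zero>\<^bsub>E\<^esub>" "\<And>f. f \<in> monomial_ideal n 1 \<Longrightarrow> f \<odot>\<^bsub>E\<^esub> e = \<zero>\<^bsub>E\<^esub>"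
    using injective_hull_socle[OF assms(6,7)] by blast
  have Ei: "injective_module R E" using assms(7) by (simp add: injective_hull_def)
  obtain w where "inverse_system n R E w"
    by (rule inverse_system_exists[OF Ei e])
  then interpret split_variables n R E w i
    using assms(2,3) by (intro split_variables.intro split_variables_axioms.intro)
  let ?H = "local_cohomology R I J d i"
  obtain h where H: "module R ?H" and h: "\<And>s. h s \<in> carrier ?H"
      "\<And>s. var_product i 1 \<odot>\<^bsub>?H\<^esub> h (Suc s) = h s"
    and generates: "\<And>x. x \<in> carrier ?H \<Longrightarrow> \<exists>r\<in>carrier R. \<exists>s. x = r \<odot>\<^bsub>?H\<^esub> h s"
    and annihilator: "\<And>r s. r \<in> carrier R \<Longrightarrow> r \<odot>\<^bsub>?H\<^esub> h s = \<zero>\<^bsub>?H\<^esub> \<Longrightarrow> r \<in> monomial_ideal i s"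
  proof (rule local_cohomology_fractions[OF i_le assms(5)])
    fix h assume "module R ?H" "\<And>s. h s \<in> carrier ?H" "\<And>s. var_product i 1 \<odot>\<^bsub>?H\<^esub> h (Suc s) = h s"
      "\<And>x. x \<in> carrier ?H \<Longrightarrow> \<exists>r\<in>carrier R. \<exists>s. x = r \<odot>\<^bsub>?H\<^esub> h s"
      "\<And>r s. r \<in> carrier R \<Longrightarrow> r \<odot>\<^bsub>?H\<^esub> h s = \<zero>\<^bsub>?H\<^esub> \<Longrightarrow> r \<in> monomial_ideal i s"
    then show thesis by (rule that)
  qed
  have "\<exists>\<delta>. \<delta> \<in> carrier (Hom_module R ?H E) \<and> (\<forall>s. \<delta> (h s) = inverse_polynomial (nodes l s))" for l
  proof -
    obtain \<delta> where "\<delta> \<in> carrier (Hom_module R ?H E)" "\<And>s. \<delta> (h s) = inverse_polynomial (nodes l s)"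
    proof (rule hom_from_fractions[OF i_le H module_E, where h = h and e = "\<lambda>s. inverse_polynomial (nodes l s)"])
      show "inverse_polynomial (nodes l s) \<in> carrier E" for s
        by (rule inverse_polynomial_closed[OF nodes_supported[OF order.refl]])
      show "r \<odot>\<^bsub>E\<^esub> inverse_polynomial (nodes l s) = \<zero>\<^bsub>E\<^esub>"
        if "r \<in> carrier R" "r \<odot>\<^bsub>?H\<^esub> h s = \<zero>\<^bsub>?H\<^esub>" for r s
        by (rule nodes_annihilated[OF annihilator[OF that]])
    next
      fix \<delta> assume "\<delta> \<in> carrier (Hom_module R ?H E)" "\<And>s. \<delta> (h s) = inverse_polynomial (nodes l s)"
      then show thesis by (rule that)
    next
      show "h s \<in> carrier ?H" for s by (rule h(1))
      show "var_product i 1 \<odot>\<^bsub>?H\<^esub> h (Suc s) = h s" for s by (rule h(2))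
      show "var_product i 1 \<odot>\<^bsub>E\<^esub> inverse_polynomial (nodes l (Suc s)) = inverse_polynomial (nodes l s)" for s
        by (rule var_product_nodes)
      show "\<exists>r\<in>carrier R. \<exists>s. x = r \<odot>\<^bsub>?H\<^esub> h s" if "x \<in> carrier ?H" for x
        by (rule generates[OF that])
    qed
    then show ?thesis by blast
  qed
  then have "\<forall>l. \<exists>\<delta>. \<delta> \<in> carrier (Hom_module R ?H E) \<and> (\<forall>s. \<delta> (h s) = inverse_polynomial (nodes l s))"
    by (rule allI)
  from choice[OF this] obtain \<delta> where
    "\<forall>l. \<delta> l \<in> carrier (Hom_module R ?H E) \<and> (\<forall>s. \<delta> l (h s) = inverse_polynomial (nodes l s))" ..
  then have \<delta>: "\<delta> l \<in> carrier (Hom_module R ?H E)" "\<delta> l (h s) = inverse_polynomial (nodes l s)" for l s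
    by simp_all
  interpret Hom: module R "Hom_module R ?H E" by (rule module_Hom_module[OF H module_E])
  have independent: "independent_family R (Hom_module R ?H E) \<delta>"
    unfolding independent_family_def
  proof (intro allI impI ballI)
    fix F :: "nat set" and r l
    assume F: "finite F" and r: "\<forall>l\<in>F. r l \<in> carrier R" and l: "l \<in> F"
      and zero: "(\<Oplus>\<^bsub>Hom_module R ?H E\<^esub>l\<in>F. r l \<odot>\<^bsub>Hom_module R ?H E\<^esub> \<delta> l) = \<zero>\<^bsub>Hom_module R ?H E\<^esub>"
    have relation: "(\<Oplus>\<^bsub>E\<^esub>l\<in>F. r l \<odot>\<^bsub>E\<^esub> inverse_polynomial (nodes l s)) = \<zero>\<^bsub>E\<^esub>" for s
    proof -
      have "(\<Oplus>\<^bsub>E\<^esub>l\<in>F. (r l \<odot>\<^bsub>Hom_module R ?H E\<^esub> \<delta> l) (h s)) = \<zero>\<^bsub>Hom_module R ?H E\<^esub> (h s)"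
        unfolding zero[symmetric]
        by (rule finsum_Hom_module_apply[symmetric, OF H module_E F _ h(1)]) (use r \<delta>(1) in auto)
      then show ?thesis using h(1) by (simp add: Hom_module_def \<delta>(2))
    qed
    show "r l = \<zero>\<^bsub>R\<^esub>" by (rule nodes_independent[OF F _ relation l]) (use r in blast)
  qed
  have V: "fraction_field_extension R Q \<phi> (Hom_module R ?H E)"
  proof (intro fraction_field_extension.intro scalar_extension.intro fraction_field_extension_axioms.intro)
    show "module R (Hom_module R ?H E)" by (rule module_Hom_module[OF H module_E])
    show "field Q" "\<phi> \<in> ring_hom R Q" using assms(9) by (simp_all add: quotient_field_def)
  qed (rule assms(9))
  show ?thesis
    unfolding matlis_dual_def
    using scalar_extension.vectorspace_V[OF fraction_field_extension.axioms(1)[OF V]]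
      fraction_field_extension.infinite_rank[OF V \<delta>(1) independent]
    by (rule conjI)
qed

end
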